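(* Fix $r\in\mathbb R$ with $0<r<1$. Let $A(r)=\{z: r\le|z|\le r^{-1}\}$ and $D(r^{-1})=\{z:|z|\le r^{-1}\}$. Let $h$ be a meromorphic function on $D(r^{-1})$ which is holomorphic on $A(r)$, and let $f$ be a function of $n$ complex variables, invariant under permutations of its variables, such that $z\mapsto f(z,z_2,\dots,z_n)$ is meromorphic on $D(r^{-1})$ and holomorphic on $A(r)$. For $g\in U(N)$ let $\rho_1,\dots,\rho_N$ be its eigenvalues. Then, as a function of $N$, $$\int_{U(N)}\sum_{1\le j_1,\dots,j_n\le N}h(\rho_{j_1})\cdots h(\rho_{j_n})f(\rho_{j_1},\dots,\rho_{j_n})\,dg =\sum_\lambda\left(\frac N2\right)^{n-2l(\lambda)}\frac{z_\lambda}{(2\pi)^n}\sum_{k=0}^n\binom nk\int_{[0,2\pi]^n}\Bigg(\prod_{j=1}^k h(re^{-it_j})\prod_{j=k+1}^n h\!\left(\tfrac{e^{it_j}}{r}\right)f\!\left(re^{-it_1},\dots,re^{-it_k},\tfrac{e^{it_{k+1}}}{r},\dots,\tfrac{e^{it_n}}{r}\right)\mathfrak m_\lambda(re^{-it_1},\dots,re^{-it_k})\,\mathfrak m_\lambda(re^{-it_{k+1}},\dots,re^{-it_n})\Bigg)dt_1\cdots dt_n+O_{r,n,h,f}\!\left(r^{2N}N^{3n+2}\right),$$ where $\lambda$ runs over all partitions.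
   Context: $U(N)$ is the unitary group with normalized Haar measure $dg$. For a partition $\lambda$, $l(\lambda)$ is its number of positive parts, $m_i(\lambda)$ the number of parts equal to $i$, and $z_\lambda=\prod_{i\ge1}i^{m_i(\lambda)}m_i(\lambda)!$. $\mathfrak m_\lambda(x_1,\dots,x_p)$ is the monomial symmetric polynomial: $0$ if $l(\lambda)>p$, and otherwise the sum of $x_1^{\alpha_1}\cdots x_p^{\alpha_p}$ over all distinct rearrangements $\alpha$ of $\lambda$ (padded with zeros to length $p$). The implied constant depends only on $r,n,h,f$.
   Formalization: f is assumed holomorphic in each variable on one common open neighbourhood of A(r), with the other variables ranging over that neighbourhood; if the neighbourhood may depend on z_2,…,z_n, the integrals on the right-hand side can fail to exist. *)

theory Defs
  imports
    "HOL-Complex_Analysis.Complex_Analysis"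
    "HOL-Probability.Probability_Measure"
    "HOL-Combinatorics.Multiset_Permutations"
    "Jordan_Normal_Form.Schur_Decomposition"
begin

definition unitary_group :: "nat \<Rightarrow> complex mat set" where
  "unitary_group N = {g \<in> carrier_mat N N. mat_adjoint g * g = 1\<^sub>m N}"

text \<open>
  The type of matrices carries no topology.  The Borel sets of the unitary group, as a subspace of
  the space of N by N complex matrices, form the sigma-algebra generated by the matrix entries.
\<close>

definition unitary_borel :: "nat \<Rightarrow> complex mat measure" where
  "unitary_borel N = sigma (unitary_group N)
     {{g \<in> unitary_group N. index_mat g (i, j) \<in> B} | i j B. i < N \<and> j < N \<and> B \<in> sets borel}"

definition normalized_haar :: "nat \<Rightarrow> complex mat measure \<Rightarrow> bool" where
  "normalized_haar N M \<longleftrightarrow>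
     prob_space M \<and> space M = unitary_group N \<and> sets M = sets (unitary_borel N) \<and>
     (\<forall>g \<in> unitary_group N. distr M M (\<lambda>x. g * x) = M)"

text \<open>
  The eigenvalues, repeated according to algebraic multiplicity and listed in an arbitrary order.
\<close>

definition eigvals :: "complex mat \<Rightarrow> complex list" where
  "eigvals A = (SOME \<rho>. mset \<rho> = proots (char_poly A))"

lemma mset_eigvals: "mset (eigvals A) = proots (char_poly A)"
  unfolding eigvals_def by (rule someI_ex) (rule ex_mset)

text \<open>
  A partition is encoded as the multiset of its positive parts, so that its length is the
  \<^const>\<open>size\<close> and the number of parts equal to \<open>i\<close> is the \<^const>\<open>count\<close>
  of \<open>i\<close>.
\<close>

definition partitions :: "nat multiset set" where
  "partitions = {l. 0 \<notin># l}"

definition zee :: "nat multiset \<Rightarrow> nat" where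
  "zee l = (\<Prod>i\<in>set_mset l. i ^ count l i * fact (count l i))"

definition monomial_sym :: "nat multiset \<Rightarrow> complex list \<Rightarrow> complex" where
  "monomial_sym l xs =
     (if size l > length xs then 0
      else \<Sum>\<alpha> \<in> permutations_of_multiset (l + replicate_mset (length xs - size l) 0).
             \<Prod>i<length xs. (xs ! i) ^ (\<alpha> ! i))"

definition closed_annulus :: "real \<Rightarrow> complex set" where
  "closed_annulus r = {z. r \<le> norm z \<and> norm z \<le> 1 / r}"

end

theory Submission
  imports Defs "HOL-Probability.Characteristic_Functions"
begin

text \<open>
  A function which is holomorphic in each variable separately is locally bounded (Hartogs), hence
  has an absolutely convergent Laurent expansion on the product of annuli, with coefficients
  \<open>c m\<close> of size \<open>q ^ (\<bar>m\<^sub>1\<bar> + \<dots> + \<bar>m\<^sub>n\<bar>)\<close> for some \<open>q < r\<close>. Inserting it turns both sides into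
  series over \<open>m\<close>. On the left a multi-index contributes the Haar expectation of a product of
  power sums of the eigenvalues. On the right the torus integrals pick out the multi-indices whose
  positive entries and negated negative entries form the same partition \<open>\<lambda>\<close>, with weight
  \<open>z\<^sub>\<lambda> N\<^bsup>n-2l(\<lambda>)\<^esup>\<close>. By Diaconis and Shahshahani the two weights agree as long as the positive
  entries sum to at most \<open>N\<close>; all other multi-indices have \<open>\<bar>m\<^sub>1\<bar> + \<dots> + \<bar>m\<^sub>n\<bar> > 2 N\<close> and go into the
  error term.

  The moments are obtained without representation theory: invariance of the Haar measure under
  infinitesimal rotations yields a linear system of loop equations, which is strictly diagonally
  dominant in degree at most \<open>N\<close> and is solved by the Hall inner product of power sums.
\<close>

section \<open>Hartogs' theorem: separate analyticity implies local boundedness\<close>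

text \<open>Holomorphy is available in one variable at a time, without joint continuity, so a bound
  must come before Laurent coefficients can be treated as functions of the remaining variables. The
  usual proof of Hartogs' lemma uses subharmonic functions; here the logarithm of the modulus is
  majorised on the circle by real parts of polynomials, and Cauchy's formula suffices.

  The factor \<open>N / 2\<close> instead of \<open>N\<close>: in the sum over k with weight
  \<open>n choose k\<close>, each zero entry of a multi-index may lie in either block, so the
  multi-index is met 2^(n - 2 l) times, l being the length of the partition.

  Haar measure is moved only along rank-one Hermitian directions, where the exponential is explicit;
  polarisation recovers all matrix units. Scalar rotations kill moments of unequal degrees, so a
  surviving multi-index of total degree below 2 N has both halves below N.

  The strict inequality q < r pays for the growth of the weights: they are polynomial in the degree,
  and (q / r)^degree absorbs this, leaving r^(2 N) intact.\<close>

lemma Re_mult_cnj_poly_on_circle: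
  "\<exists>r. \<forall>z. norm z = 1 \<longrightarrow> Re (poly p z * cnj (poly q z)) = Re (poly r z)"
proof (induction p q rule: poly_induct2)
  case 0
  show ?case by (rule exI[of _ 0]) simp
next
  case (pCons a p b q)
  then obtain r where r: "norm z = 1 \<Longrightarrow> Re (poly p z * cnj (poly q z)) = Re (poly r z)" for z
    by blast
  show ?case
  proof (intro exI allI impI)
    fix z :: complex assume z: "norm z = 1"
    have zz: "z * cnj z = 1" using z by (simp add: complex_norm_square [symmetric])
    \<comment> \<open>Under \<open>Re\<close> the term with \<open>cnj (z * poly q z)\<close> may be
      conjugated into a polynomial in z, and \<open>z * cnj z = 1\<close> reduces the last product
      to the induction hypothesis.\<close>
    have "poly (pCons a p) z * cnj (poly (pCons b q) z)
       = a * cnj b + a * cnj (z * poly q z) + cnj b * (z * poly p z)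
          + (z * cnj z) * (poly p z * cnj (poly q z))"
      by (simp add: algebra_simps)
    also have "Re \<dots> = Re (a * cnj b) + Re (cnj (cnj a * (z * poly q z)))
       + Re (cnj b * (z * poly p z)) + Re (poly p z * cnj (poly q z))"
      by (simp add: zz)
    also have "\<dots> = Re (poly ([:a * cnj b:] + Polynomial.smult (cnj a) (pCons 0 q) + Polynomial.smult (cnj b) (pCons 0 p) + r) z)"
      using r[OF z] by (simp add: algebra_simps)
    finally show "Re (poly (pCons a p) z * cnj (poly (pCons b q) z)) =
      Re (poly ([:a * cnj b:] + Polynomial.smult (cnj a) (pCons 0 q) + Polynomial.smult (cnj b) (pCons 0 p) + r) z)" .
  qed
qed

text \<open>A real polynomial in Re z and Im z restricts to a trigonometric polynomial, and
  frequencies k and -k merge in the real part of a polynomial in z. Stone-Weierstrass approximants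
  thus become boundary values of harmonic functions with an explicit holomorphic completion.\<close>

lemma real_polynomial_function_on_circle:
  fixes u :: "complex \<Rightarrow> real"
  assumes "real_polynomial_function u"
  shows "\<exists>p. \<forall>z. norm z = 1 \<longrightarrow> u z = Re (poly p z)"
  using assms
proof (induction rule: real_polynomial_function.induct)
  case (linear u)
  interpret bounded_linear u by fact
  \<comment> \<open>A real-linear functional is Re z * u 1 + Im z * u i, which is the real part of
    (u 1 - i * u i) * z.\<close>
  have "u z = Re (poly [:0, Complex (u 1) (- u \<i>):] z)" for z
  proof -
    have "u z = u (Re z *\<^sub>R 1 + Im z *\<^sub>R \<i>)" by (simp add: complex_eq [symmetric] scaleR_conv_of_real mult.commute)
    then show ?thesis by (simp add: add scaleR)
  qed
  then show ?case by blast
next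
  case (const c)
  show ?case by (rule exI[of _ "[:of_real c:]"]) simp
next
  case (add u v)
  then obtain p q where "norm z = 1 \<Longrightarrow> u z = Re (poly p z)" "norm z = 1 \<Longrightarrow> v z = Re (poly q z)" for z
    by blast
  then show ?case by (intro exI[of _ "p + q"]) simp
next
  case (mult u v)
  then obtain p q where pq: "norm z = 1 \<Longrightarrow> u z = Re (poly p z)" "norm z = 1 \<Longrightarrow> v z = Re (poly q z)" for z
    by blast
  obtain r where r: "norm z = 1 \<Longrightarrow> Re (poly p z * cnj (poly q z)) = Re (poly r z)" for z
    using Re_mult_cnj_poly_on_circle by blast
  have "Re a * Re b = Re (a * b) / 2 + Re (a * cnj b) / 2" for a b by (simp add: field_simps)
  then have "norm z = 1 \<Longrightarrow> u z * v z = Re (poly (Polynomial.smult (1/2) (p * q + r)) z)" for z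
    using pq[of z] r[of z] by simp
  then show ?case by blast
qed

section \<open>Averages over circles and Harnack's inequality\<close>

text \<open>Runs at the speed of \<open>circlepath\<close>: integrals over {0..1} are averages over
  the circle, and Cauchy's formula translates without a change of variables.\<close>

definition ucirc :: "real \<Rightarrow> complex" where "ucirc t = cis (2 * pi * t)"

lemma norm_ucirc [simp]: "norm (ucirc t) = 1"
  by (simp add: ucirc_def)

lemma ucirc_nonzero [simp]: "ucirc t \<noteq> 0"
  by (simp add: ucirc_def)

lemma continuous_on_ucirc [continuous_intros]: "continuous_on S ucirc"
  unfolding ucirc_def by (intro continuous_intros)

lemma circlepath_ucirc: "circlepath c R t = c + of_real R * ucirc t"
  by (simp add: circlepath ucirc_def cis_conv_exp mult.assoc mult.commute mult.left_commute)

lemma has_contour_integral_circlepath_ucirc: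
  "(f has_contour_integral I) (circlepath c R) \<longleftrightarrow>
   ((\<lambda>t. f (c + of_real R * ucirc t) * (2 * pi * \<i> * of_real R * ucirc t)) has_integral I) {0..1}"
  unfolding has_contour_integral
  by (rule has_integral_cong)
    (auto simp add: vector_derivative_circlepath circlepath_ucirc ucirc_def cis_conv_exp mult_ac)

text \<open>The Poisson formula is Cauchy's formula for \<open>P \<zeta> (1 - |z|\<^sup>2) / (1 - cnj z \<zeta>)\<close>.\<close>

lemma harnack_poly:
  fixes p :: "complex poly"
  assumes nonneg: "\<And>\<zeta>. norm \<zeta> = 1 \<Longrightarrow> 0 \<le> Re (poly p \<zeta>)" and z: "norm z \<le> 1 / 2"
  shows "Re (poly p z) \<le> 3 * integral {0..1} (\<lambda>t. Re (poly p (ucirc t)))"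
proof -
  define G where "G = (\<lambda>\<zeta>. poly p \<zeta> * (1 - z * cnj z) / (1 - cnj z * \<zeta>))"
  have nz: "1 - cnj z * \<zeta> \<noteq> 0" if "norm \<zeta> \<le> 1" for \<zeta>
  proof
    assume "1 - cnj z * \<zeta> = 0"
    then have "norm (cnj z * \<zeta>) = 1" by (metis eq_iff_diff_eq_0 norm_one)
    then have "norm z * norm \<zeta> = 1" by (simp add: norm_mult)
    moreover have "norm z * norm \<zeta> \<le> (1/2) * 1" using z that by (intro mult_mono) auto
    ultimately show False by simp
  qed
  have "G holomorphic_on cball 0 1"
    unfolding G_def using nz by (intro holomorphic_intros) auto
  then have "((\<lambda>u. G u / (u - z)) has_contour_integral (2 * of_real pi * \<i> * G z)) (circlepath 0 1)"
    using z by (intro Cauchy_integral_circlepath_simple) auto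
  then have "((\<lambda>t. G (ucirc t) / (ucirc t - z) * (2 * pi * \<i> * ucirc t)) has_integral (2 * of_real pi * \<i> * G z)) {0..1}"
    unfolding has_contour_integral_circlepath_ucirc by simp
  then have "((\<lambda>t. G (ucirc t) / (ucirc t - z) * (2 * pi * \<i> * ucirc t) * (1 / (2 * pi * \<i>))) has_integral (2 * of_real pi * \<i> * G z * (1 / (2 * pi * \<i>)))) {0..1}"
    by (rule has_integral_mult_left)
  also have "2 * of_real pi * \<i> * G z * (1 / (2 * pi * \<i>)) = poly p z"
    using nz[of z] z by (simp add: G_def mult.commute)
  also have "(\<lambda>t. G (ucirc t) / (ucirc t - z) * (2 * pi * \<i> * ucirc t) * (1 / (2 * pi * \<i>))) =
      (\<lambda>t. of_real ((1 - (norm z)\<^sup>2) / (norm (ucirc t - z))\<^sup>2) * poly p (ucirc t))"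
  proof
    fix t
    let ?e = "ucirc t"
    \<comment> \<open>With 1 written as e * cnj e, the factor 1 - cnj z * e becomes e * cnj (e - z),
      which turns the corrected Cauchy kernel into the Poisson kernel.\<close>
    have ee: "?e * cnj ?e = 1" by (simp add: complex_norm_square [symmetric])
    have ne: "?e - z \<noteq> 0"
      using z norm_ucirc[of t] by auto
    have ne': "cnj ?e - cnj z \<noteq> 0" using ne by (metis complex_cnj_cancel_iff eq_iff_diff_eq_0)
    have "?e / ((?e - z) * (1 - cnj z * ?e)) = ?e / ((?e - z) * (?e * cnj ?e - cnj z * ?e))"
      by (simp only: ee)
    also have "\<dots> = ?e / (?e * ((?e - z) * (cnj ?e - cnj z)))"
      by (simp add: algebra_simps)
    also have "\<dots> = 1 / ((?e - z) * (cnj ?e - cnj z))"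
      by simp
    also have "\<dots> = 1 / of_real ((norm (?e - z))\<^sup>2)"
      by (simp only: complex_norm_square complex_cnj_diff)
    finally have *: "?e / ((?e - z) * (1 - cnj z * ?e)) = 1 / of_real ((norm (?e - z))\<^sup>2)" .
    have "G ?e / (?e - z) * (2 * pi * \<i> * ?e) * (1 / (2 * pi * \<i>)) = poly p ?e * (1 - z * cnj z) * (?e / ((?e - z) * (1 - cnj z * ?e)))"
      by (simp add: G_def mult.commute)
    also have "\<dots> = of_real ((1 - (norm z)\<^sup>2) / (norm (?e - z))\<^sup>2) * poly p ?e"
      by (simp only: * of_real_divide of_real_diff complex_norm_square of_real_1) (simp add: mult.commute)
    finally show "G ?e / (?e - z) * (2 * pi * \<i> * ?e) * (1 / (2 * pi * \<i>)) = \<dots>" .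
  qed
  finally have "((\<lambda>t. of_real ((1 - (norm z)\<^sup>2) / (norm (ucirc t - z))\<^sup>2) * poly p (ucirc t)) has_integral poly p z) {0..1}" .
  from has_integral_Re[OF this]
  have 1: "((\<lambda>t. ((1 - (norm z)\<^sup>2) / (norm (ucirc t - z))\<^sup>2) * Re (poly p (ucirc t))) has_integral Re (poly p z)) {0..1}"
    by (simp del: of_real_divide of_real_power of_real_diff)
  have 2: "((\<lambda>t. 3 * Re (poly p (ucirc t))) has_integral 3 * integral {0..1} (\<lambda>t. Re (poly p (ucirc t)))) {0..1}"
    by (intro has_integral_mult_right integrable_integral integrable_continuous_real continuous_intros)
  \<comment> \<open>The Poisson kernel is at most (1 + |z|) / (1 - |z|), which is 3 at |z| = 1/2;
    this is the origin of the 3 in \<open>harnack_log_max\<close> and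
    \<open>hartogs_disc\<close>.\<close>
  have K: "(1 - (norm z)\<^sup>2) / (norm (ucirc t - z))\<^sup>2 \<le> 3" for t
  proof -
    have "1 - norm z \<le> norm (ucirc t - z)" using norm_triangle_ineq2[of "ucirc t" z] by simp
    then have "(1 - norm z)\<^sup>2 \<le> (norm (ucirc t - z))\<^sup>2" using z by (intro power_mono) auto
    moreover have "1 - (norm z)\<^sup>2 \<le> 3 * (1 - norm z)\<^sup>2"
    proof -
      have "(1 - norm z) * (1 + norm z) \<le> (1 - norm z) * (3 * (1 - norm z))"
        using z by (intro mult_left_mono) auto
      then show ?thesis by (simp add: power2_eq_square algebra_simps)
    qed
    moreover have "0 < (norm (ucirc t - z))\<^sup>2" using z norm_ucirc[of t] by auto
    ultimately show ?thesis by (simp add: divide_simps)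
  qed
  show ?thesis
    by (rule has_integral_le[OF 1 2]) (intro mult_right_mono K nonneg norm_ucirc)
qed

text \<open>A substitute for the subharmonicity of \<open>ln (max 1 (norm (g z)))\<close>. If Re p
  lies slightly above it on the circle, then g * exp (- p) has modulus at most 1 there, so the
  maximum principle gives |g| \<le> exp (Re p) inside, and \<open>harnack_poly\<close> bounds Re p
  by its mean.\<close>

lemma harnack_log_max:
  assumes cont: "continuous_on (cball 0 1) g" and hol: "g holomorphic_on ball 0 1" and z: "norm z \<le> 1 / 2"
  shows "ln (max 1 (norm (g z))) \<le> 3 * integral {0..1} (\<lambda>t. ln (max 1 (norm (g (ucirc t)))))"
proof (rule field_le_epsilon)
  fix e :: real assume e: "0 < e"
  \<comment> \<open>Approximating u + d within d puts the approximant strictly between u and u + 2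
    d: above u, hence nonnegative, and with a mean exceeding that of u by at most 2 d. Harnack
    multiplies this excess by 3, and 6 d = e.\<close>
  define d where "d = e / 6"
  have d: "d > 0" using e by (simp add: d_def)
  define u where "u = (\<lambda>z. ln (max 1 (norm (g z))))"
  have cu: "continuous_on (sphere 0 1) u" unfolding u_def
    by (intro continuous_intros continuous_on_subset[OF cont]) auto
  then have "continuous_on (sphere 0 1) (\<lambda>z. u z + d)" by (intro continuous_intros)
  from Stone_Weierstrass_real_polynomial_function[OF _ this d]
  obtain q where q: "real_polynomial_function q" "\<And>z. z \<in> sphere 0 1 \<Longrightarrow> \<bar>u z + d - q z\<bar> < d"
    by auto
  obtain p where p: "\<And>z. norm z = 1 \<Longrightarrow> q z = Re (poly p z)"
    using real_polynomial_function_on_circle[OF q(1)] by blast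
  have p1: "u z < Re (poly p z)" "Re (poly p z) < u z + 2 * d" if "norm z = 1" for z
    using q(2)[of z] p[OF that] that by auto
  have u0: "0 \<le> u z" for z by (simp add: u_def)
  have "norm (g z * exp (- poly p z)) \<le> 1"
  proof (rule maximum_modulus_frontier[of "\<lambda>z. g z * exp (- poly p z)" "ball 0 1"])
    show "(\<lambda>z. g z * exp (- poly p z)) holomorphic_on interior (ball 0 1)"
      using hol by (auto intro!: holomorphic_intros)
    show "continuous_on (closure (ball 0 1)) (\<lambda>z. g z * exp (- poly p z))"
      using cont by (auto intro!: continuous_intros)
    fix w :: complex assume "w \<in> frontier (ball 0 1)"
    then have w: "norm w = 1" by simp
    have "norm (g w) \<le> max 1 (norm (g w))" by simp
    also have "\<dots> = exp (u w)" by (simp add: u_def)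
    also have "\<dots> \<le> exp (Re (poly p w))" using p1[OF w] by simp
    finally show "norm (g w * exp (- poly p w)) \<le> 1"
      by (simp add: norm_mult exp_minus norm_divide divide_simps)
  qed (use z in auto)
  then have gz: "norm (g z) \<le> exp (Re (poly p z))"
    by (simp add: norm_mult exp_minus norm_divide divide_simps)
  have h: "Re (poly p z) \<le> 3 * integral {0..1} (\<lambda>t. Re (poly p (ucirc t)))"
    by (rule harnack_poly) (use order_trans[OF u0 less_imp_le[OF p1(1)]] z in auto)
  have cuu: "continuous_on {0..1} (\<lambda>t. u (ucirc t))"
    by (rule continuous_on_compose2[OF cu]) (auto intro: continuous_intros)
  have i0: "0 \<le> integral {0..1} (\<lambda>t. u (ucirc t))"
    using u0 cuu by (intro integral_nonneg integrable_continuous_real) auto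
  have "integral {0..1} (\<lambda>t. Re (poly p (ucirc t))) \<le> integral {0..1} (\<lambda>t. u (ucirc t) + 2 * d)"
    using p1(2) cuu by (intro integral_le integrable_continuous_real continuous_intros) (auto intro: less_imp_le)
  also have "\<dots> = integral {0..1} (\<lambda>t. u (ucirc t)) + 2 * d"
    using cuu by (subst Henstock_Kurzweil_Integration.integral_add) (auto intro: integrable_continuous_real)
  finally have i1: "integral {0..1} (\<lambda>t. Re (poly p (ucirc t))) \<le> integral {0..1} (\<lambda>t. u (ucirc t)) + 2 * d" .
  have fin: "Re (poly p z) \<le> 3 * integral {0..1} (\<lambda>t. u (ucirc t)) + e"
    using h i1 by (simp add: d_def)
  have "ln (max 1 (norm (g z))) \<le> max 0 (Re (poly p z))"
  proof (cases "norm (g z) \<le> 1")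
    case True then show ?thesis by (simp add: max_def)
  next
    case False
    then have "ln (norm (g z)) \<le> ln (exp (Re (poly p z)))" using gz
      by (subst ln_le_cancel_iff) (auto intro: order.strict_trans[of 0 1])
    then show ?thesis using False by (simp add: max_def)
  qed
  also have "\<dots> \<le> 3 * integral {0..1} (\<lambda>t. u (ucirc t)) + e"
    using fin i0 e by simp
  finally show "ln (max 1 (norm (g z))) \<le> 3 * integral {0..1} (\<lambda>t. ln (max 1 (norm (g (ucirc t))))) + e"
    by (simp add: u_def)
qed

section \<open>Hartogs' lemma on sequences of functions\<close>

text \<open>On the boundary circle the functions \<open>ln (max 1 (norm (g k z))) / k\<close> are
  bounded by ln M + ln A and tend to 0 pointwise, because each sequence g k z is bounded. Dominated
  convergence sends their means to 0, and Harnack turns small means into a uniform bound on the half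
  disc.\<close>

lemma hartogs_disc:
  fixes g :: "nat \<Rightarrow> complex \<Rightarrow> complex"
  assumes rho: "0 < \<rho>" and cont: "\<And>k. continuous_on (cball c \<rho>) (g k)"
    and hol: "\<And>k. g k holomorphic_on ball c \<rho>"
    and MA: "1 \<le> M" "1 \<le> A" and bd: "\<And>k z. z \<in> cball c \<rho> \<Longrightarrow> norm (g k z) \<le> M * A ^ k"
    and pw: "\<And>z. z \<in> cball c \<rho> \<Longrightarrow> \<exists>C. \<forall>k. norm (g k z) \<le> C"
    and delta: "0 < \<delta>"
  shows "\<exists>k0. \<forall>k\<ge>k0. \<forall>z\<in>cball c (\<rho> / 2). norm (g k z) \<le> exp (\<delta> * real k)"
proof -
  define B where "B = ln M + ln A"
  define v where "v = (\<lambda>k t. ln (max 1 (norm (g k (c + of_real \<rho> * ucirc t)))) / real k)"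
  have inc: "c + of_real \<rho> * ucirc t \<in> cball c \<rho>" for t
    using rho by (simp add: dist_norm norm_mult)
  have cv: "continuous_on {0..1} (v k)" for k
    unfolding v_def
    by (cases "k = 0") (auto intro!: continuous_intros continuous_on_compose2[OF cont] inc)
  have lim: "(\<lambda>k. integral {0..1} (v k)) \<longlonglongrightarrow> integral {0..1} (\<lambda>t::real. 0::real)"
  proof (rule dominated_convergence(2)[where h = "\<lambda>_. B"])
    fix k show "v k integrable_on {0..1}" using cv by (rule integrable_continuous_real)
  next
    fix k and t :: real assume t: "t \<in> {0..1}"
    let ?x = "norm (g k (c + of_real \<rho> * ucirc t))"
    show "norm (v k t) \<le> B"
    proof (cases "k = 0")
      case True then show ?thesis using MA by (simp add: v_def B_def)
    next
      case False
      have "1 \<le> M * A ^ k" using mult_mono[OF MA(1) one_le_power[OF MA(2)]] MA by simp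
      then have "max 1 ?x \<le> M * A ^ k" using bd[OF inc] by simp
      then have "ln (max 1 ?x) \<le> ln (M * A ^ k)" by simp
      also have "\<dots> = ln M + real k * ln A" using MA by (simp add: ln_mult ln_realpow)
      also have "\<dots> \<le> real k * ln M + real k * ln A" using MA False
        by (intro add_mono mult_right_le_one_le order_refl) (auto simp: mult_le_cancel_right1)
      finally have "ln (max 1 ?x) \<le> real k * B" by (simp add: B_def algebra_simps)
      then show ?thesis using False by (simp add: v_def field_simps)
    qed
  next
    show "(\<lambda>_::real. B) integrable_on {0..1}" by (rule integrable_const_ivl)
  next
    fix t :: real assume t: "t \<in> {0..1}"
    obtain C where C: "\<And>k. norm (g k (c + of_real \<rho> * ucirc t)) \<le> C" using pw[OF inc] by blast
    have "(\<lambda>k. ln (max 1 C) / real k) \<longlonglongrightarrow> 0" by (rule lim_const_over_n)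
    moreover have "norm (v k t) \<le> ln (max 1 C) / real k" for k
    proof -
      have "ln (max 1 (norm (g k (c + of_real \<rho> * ucirc t)))) \<le> ln (max 1 C)" using C[of k] by simp
      then show ?thesis by (simp add: v_def divide_right_mono)
    qed
    ultimately show "(\<lambda>k. v k t) \<longlonglongrightarrow> 0"
      by (intro Lim_null_comparison[of "\<lambda>k. v k t"] always_eventually) auto
  qed
  then have "(\<lambda>k. integral {0..1} (v k)) \<longlonglongrightarrow> 0" by simp
  then have "\<forall>\<^sub>F k in sequentially. integral {0..1} (v k) < \<delta> / 3"
    using delta by (intro order_tendstoD) auto
  then obtain k0 where k0: "\<And>k. k \<ge> k0 \<Longrightarrow> integral {0..1} (v k) < \<delta> / 3"
    by (auto simp: eventually_sequentially)
  show ?thesis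
  \<comment> \<open>The index k = 0 is excluded because \<open>v 0\<close> vanishes by division by
    zero and says nothing about g 0.\<close>
  proof (intro exI[of _ "max 1 k0"] allI impI ballI)
    fix k z assume k: "max 1 k0 \<le> k" and z: "z \<in> cball c (\<rho> / 2)"
    define G where "G = (\<lambda>w. g k (c + of_real \<rho> * w))"
    have im: "c + of_real \<rho> * w \<in> cball c \<rho>" if "w \<in> cball 0 1" for w
      using that rho by (simp add: dist_norm norm_mult)
    have im': "c + of_real \<rho> * w \<in> ball c \<rho>" if "w \<in> ball 0 1" for w
      using that rho by (simp add: dist_norm norm_mult)
    have "continuous_on (cball 0 1) G" unfolding G_def
      by (rule continuous_on_compose2[OF cont]) (use im in \<open>auto intro!: continuous_intros\<close>)
    moreover have "G holomorphic_on ball 0 1" unfolding G_def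
      by (rule holomorphic_on_compose_gen[of _ _ "g k", unfolded o_def, OF _ hol])
         (use im' in \<open>auto intro!: holomorphic_intros\<close>)
    moreover define w where "w = (z - c) / of_real \<rho>"
    have w: "norm w \<le> 1 / 2" using z rho by (simp add: w_def norm_divide dist_norm norm_minus_commute field_simps)
    ultimately have "ln (max 1 (norm (G w))) \<le> 3 * integral {0..1} (\<lambda>t. ln (max 1 (norm (G (ucirc t)))))"
      by (rule harnack_log_max)
    also have "(\<lambda>t. ln (max 1 (norm (G (ucirc t))))) = (\<lambda>t. real k * v k t)"
      using k by (simp add: v_def G_def)
    also have "integral {0..1} \<dots> = real k * integral {0..1} (v k)" by simp
    also have "3 * (real k * integral {0..1} (v k)) \<le> 3 * (real k * (\<delta> / 3))"
      using k k0[of k] by (intro mult_left_mono) auto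
    finally have "ln (max 1 (norm (G w))) \<le> \<delta> * real k" by (simp add: mult.commute)
    then have "exp (ln (max 1 (norm (G w)))) \<le> exp (\<delta> * real k)" by (simp only: exp_le_cancel_iff)
    moreover have "G w = g k z" using rho by (simp add: G_def w_def)
    ultimately show "norm (g k z) \<le> exp (\<delta> * real k)" by simp
  qed
qed

lemma hartogs_one_variable:
  fixes g :: "nat \<Rightarrow> complex \<Rightarrow> complex"
  assumes V: "open V" and hol: "\<And>k. g k holomorphic_on V"
    and bd: "\<And>L. compact L \<Longrightarrow> L \<subseteq> V \<Longrightarrow> \<exists>M\<ge>1. \<exists>A\<ge>1. \<forall>k. \<forall>z\<in>L. norm (g k z) \<le> M * A ^ k"
    and pw: "\<And>z. z \<in> V \<Longrightarrow> \<exists>C. \<forall>k. norm (g k z) \<le> C"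
    and K: "compact K" "K \<subseteq> V" and delta: "0 < \<delta>"
  shows "\<exists>k0. \<forall>k\<ge>k0. \<forall>z\<in>K. norm (g k z) \<le> exp (\<delta> * real k)"
proof -
  obtain \<rho> where rho: "0 < \<rho>" "\<And>c. c \<in> K \<Longrightarrow> cball c \<rho> \<subseteq> V"
    using compact_subset_open_imp_cball_epsilon_subset[OF K(1) V K(2)] by (metis UN_subset_iff)
  have loc: "\<exists>k0. \<forall>k\<ge>k0. \<forall>z\<in>cball c (\<rho> / 2). norm (g k z) \<le> exp (\<delta> * real k)" if c: "c \<in> K" for c
  proof -
    obtain M A where MA: "M \<ge> 1" "A \<ge> 1" "\<And>k z. z \<in> cball c \<rho> \<Longrightarrow> norm (g k z) \<le> M * A ^ k"
      using bd[OF compact_cball rho(2)[OF c]] by blast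
    show ?thesis
    proof (rule hartogs_disc[OF rho(1) _ _ MA _ delta])
      show "continuous_on (cball c \<rho>) (g k)" for k
        using hol rho(2)[OF c] by (meson holomorphic_on_imp_continuous_on holomorphic_on_subset)
      show "g k holomorphic_on ball c \<rho>" for k
        using hol rho(2)[OF c] ball_subset_cball by (meson holomorphic_on_subset order_trans)
    qed (use pw rho(2)[OF c] in auto)
  qed
  then obtain k0 where k0: "\<And>c k z. c \<in> K \<Longrightarrow> k \<ge> k0 c \<Longrightarrow> z \<in> cball c (\<rho> / 2) \<Longrightarrow> norm (g k z) \<le> exp (\<delta> * real k)"
    by metis
  have "K \<subseteq> (\<Union>c\<in>K. ball c (\<rho> / 2))" using rho(1) by auto
  then obtain T where T: "T \<subseteq> K" "finite T" "K \<subseteq> (\<Union>c\<in>T. ball c (\<rho> / 2))"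
    using compactE_image[OF K(1), of K "\<lambda>c. ball c (\<rho> / 2)"] by auto
  show ?thesis
  proof (intro exI[of _ "Max (insert 0 (k0 ` T))"] allI impI ballI)
    fix k z assume k: "Max (insert 0 (k0 ` T)) \<le> k" and z: "z \<in> K"
    obtain c where c: "c \<in> T" "z \<in> ball c (\<rho> / 2)" using T(3) z by auto
    have "k0 c \<le> k" using k c(1) T(2) by auto
    then show "norm (g k z) \<le> exp (\<delta> * real k)" using k0[of c k z] c T(1) by auto
  qed
qed

text \<open>Separate holomorphy on the n-fold product of V, with no continuity in several variables
  at once. The distinguished position is encoded by splitting the list around it.\<close>

definition sephol :: "complex set \<Rightarrow> nat \<Rightarrow> (complex list \<Rightarrow> complex) \<Rightarrow> bool" where
  "sephol V n F \<longleftrightarrow> (\<forall>xs ys. Suc (length xs + length ys) = n \<and> set xs \<subseteq> V \<and> set ys \<subseteq> V \<longrightarrow>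
     (\<lambda>z. F (xs @ z # ys)) holomorphic_on V)"

lemma sephol_Cons: "sephol V (Suc n) F \<Longrightarrow> z \<in> V \<Longrightarrow> sephol V n (\<lambda>w. F (z # w))"
  unfolding sephol_def
proof (intro allI impI)
  fix xs ys assume *: "\<forall>xs ys. Suc (length xs + length ys) = Suc n \<and> set xs \<subseteq> V \<and> set ys \<subseteq> V \<longrightarrow>
     (\<lambda>z. F (xs @ z # ys)) holomorphic_on V" and "z \<in> V" "Suc (length xs + length ys) = n \<and> set xs \<subseteq> V \<and> set ys \<subseteq> V"
  then show "(\<lambda>za. F (z # xs @ za # ys)) holomorphic_on V"
    using *[rule_format, of "z # xs" ys] by simp
qed

lemma sephol_head: "sephol V (Suc n) F \<Longrightarrow> length w = n \<Longrightarrow> set w \<subseteq> V \<Longrightarrow> (\<lambda>z. F (z # w)) holomorphic_on V"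
  unfolding sephol_def by (drule spec[of _ "[]"], drule spec[of _ w]) simp

lemma sephol_subset: "sephol V n F \<Longrightarrow> W \<subseteq> V \<Longrightarrow> sephol W n F"
  unfolding sephol_def by (blast intro: holomorphic_on_subset)

lemma sephol_cmult: "sephol V n F \<Longrightarrow> sephol V n (\<lambda>w. c * F w)"
  unfolding sephol_def by (auto intro!: holomorphic_intros)

text \<open>If the claim failed, points \<open>z # w k\<close> would violate it for infinitely many \<open>k\<close>; for each
  fixed \<open>z\<close> the induction hypothesis bounds \<open>g k (z # w k)\<close>, so the one-variable case applies.\<close>

lemma hartogs_several_variables:
  fixes g :: "nat \<Rightarrow> complex list \<Rightarrow> complex"
  assumes V: "open V" and hol: "\<And>k. sephol V n (g k)"
    and bd: "\<And>L. compact L \<Longrightarrow> L \<subseteq> V \<Longrightarrow>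
       \<exists>M\<ge>1. \<exists>A\<ge>1. \<forall>k w. length w = n \<and> set w \<subseteq> L \<longrightarrow> norm (g k w) \<le> M * A ^ k"
    and pw: "\<And>w. length w = n \<Longrightarrow> set w \<subseteq> V \<Longrightarrow> \<exists>C. \<forall>k. norm (g k w) \<le> C"
    and K: "compact K" "K \<subseteq> V" and delta: "0 < \<delta>"
  shows "\<exists>k0. \<forall>k\<ge>k0. \<forall>w. length w = n \<and> set w \<subseteq> K \<longrightarrow> norm (g k w) \<le> exp (\<delta> * real k)"
  using hol bd pw delta
proof (induction n arbitrary: g \<delta>)
  case 0
  obtain C where C: "\<And>k. norm (g k []) \<le> C" using "0.prems"(3)[of "[]"] by auto
  have "filterlim (\<lambda>k. \<delta> * real k) at_top sequentially"
    using \<open>0 < \<delta>\<close> by (intro filterlim_tendsto_pos_mult_at_top[OF tendsto_const _ filterlim_real_sequentially])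
  then have "\<forall>\<^sub>F k in sequentially. C \<le> \<delta> * real k" by (simp add: filterlim_at_top)
  then obtain k0 where "\<And>k. k \<ge> k0 \<Longrightarrow> C \<le> \<delta> * real k" by (auto simp: eventually_sequentially)
  then have "\<forall>k\<ge>k0. norm (g k []) \<le> exp (\<delta> * real k)"
    using C by (meson exp_ge_add_one_self add_increasing zero_le_one order_trans)
  then show ?case by auto
next
  case (Suc n)
  show ?case
  proof (cases "K = {}")
    case True then show ?thesis by auto
  next
    case False
    then obtain x0 where x0: "x0 \<in> K" by auto
    define P where "P = (\<lambda>k z w. z \<in> K \<and> length w = n \<and> set w \<subseteq> K \<and> exp (\<delta> * real k) < norm (g k (z # w)))"
    \<comment> \<open>A tail witnessing failure at index k if there is one, and otherwise a constant
      list in K, so that all \<open>w k\<close> are admissible and the k-th function of the first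
      variable is always defined by a point of K.\<close>
    define w where "w = (\<lambda>k. if \<exists>z w. P k z w then SOME w. \<exists>z. P k z w else replicate n x0)"
    have w1: "\<exists>z. P k z (w k)" if "\<exists>z w. P k z w" for k
    proof -
      have "\<exists>w z. P k z w" using that by blast
      from someI_ex[OF this] show ?thesis using that by (simp add: w_def)
    qed
    have w2: "length (w k) = n \<and> set (w k) \<subseteq> K" for k
    proof (cases "\<exists>z w. P k z w")
      case True then show ?thesis using w1[OF True] by (auto simp: P_def)
    qed (use x0 in \<open>auto simp: w_def\<close>)
    \<comment> \<open>The rate is spent in two halves: damping by exp (- d k) makes the values of
      \<open>G\<close> bounded at each fixed z, by the induction hypothesis with rate d, and the
      one-variable lemma loses another exp (d k).\<close>
    define d where "d = \<delta> / 2"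
    have d: "0 < d" using Suc.prems(4) by (simp add: d_def)
    define G where "G = (\<lambda>k z. of_real (exp (- d * real k)) * g k (z # w k))"
    have "\<exists>k0. \<forall>k\<ge>k0. \<forall>z\<in>K. norm (G k z) \<le> exp (d * real k)"
    proof (rule hartogs_one_variable[OF V _ _ _ K d])
      show "G k holomorphic_on V" for k unfolding G_def
        using w2[of k] K(2) by (intro holomorphic_intros sephol_head[OF Suc.prems(1)]) auto
    next
      fix L assume L: "compact L" "L \<subseteq> V"
      obtain M A where MA: "M \<ge> 1" "A \<ge> 1"
        "\<And>k w. length w = Suc n \<Longrightarrow> set w \<subseteq> L \<union> K \<Longrightarrow> norm (g k w) \<le> M * A ^ k"
        using Suc.prems(2)[of "L \<union> K"] L K by (auto simp: compact_Un)
      have "norm (G k z) \<le> M * A ^ k" if "z \<in> L" for k z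
      proof -
        have "norm (G k z) \<le> 1 * norm (g k (z # w k))" unfolding G_def norm_mult
          using d by (intro mult_right_mono) auto
        also have "\<dots> \<le> M * A ^ k" using MA(3)[of "z # w k" k] w2[of k] that by auto
        finally show ?thesis .
      qed
      then show "\<exists>M\<ge>1. \<exists>A\<ge>1. \<forall>k. \<forall>z\<in>L. norm (G k z) \<le> M * A ^ k" using MA(1,2) by blast
    next
      fix z assume z: "z \<in> V"
      have "\<exists>k0. \<forall>k\<ge>k0. \<forall>w. length w = n \<and> set w \<subseteq> K \<longrightarrow> norm (g k (z # w)) \<le> exp (d * real k)"
      proof (rule Suc.IH[OF sephol_Cons[OF Suc.prems(1) z] _ _ d])
        fix L assume L: "compact L" "L \<subseteq> V"
        have "compact (insert z L)" "insert z L \<subseteq> V" using L z by auto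
        from Suc.prems(2)[OF this] obtain M A where MA: "M \<ge> 1" "A \<ge> 1"
          "\<And>k w. length w = Suc n \<Longrightarrow> set w \<subseteq> insert z L \<Longrightarrow> norm (g k w) \<le> M * A ^ k" by blast
        have "\<forall>k w. length w = n \<and> set w \<subseteq> L \<longrightarrow> norm (g k (z # w)) \<le> M * A ^ k"
          using MA(3)[of "z # _"] by auto
        then show "\<exists>M\<ge>1. \<exists>A\<ge>1. \<forall>k w. length w = n \<and> set w \<subseteq> L \<longrightarrow> norm (g k (z # w)) \<le> M * A ^ k"
          using MA(1,2) by blast
      next
        fix w assume "length w = n" "set w \<subseteq> V"
        then show "\<exists>C. \<forall>k. norm (g k (z # w)) \<le> C" using Suc.prems(3)[of "z # w"] z by auto
      qed
      then obtain k0 where k0: "\<And>k. k \<ge> k0 \<Longrightarrow> norm (g k (z # w k)) \<le> exp (d * real k)" using w2 by blast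
      have b1: "norm (G k z) \<le> 1" if "k \<ge> k0" for k
      proof -
        have "norm (G k z) \<le> exp (- d * real k) * exp (d * real k)" unfolding G_def norm_mult
          using k0[OF that] by (intro mult_mono) auto
        then show ?thesis by (simp add: exp_minus)
      qed
      have "norm (G k z) \<le> Max (insert 1 ((\<lambda>k. norm (G k z)) ` {..<k0}))" for k
      proof (cases "k \<ge> k0")
        case True
        then show ?thesis using b1[OF True] by (intro order_trans[OF _ Max_ge]) auto
      qed auto
      then show "\<exists>C. \<forall>k. norm (G k z) \<le> C" by blast
    qed
    then obtain k0 where k0: "\<And>k z. k \<ge> k0 \<Longrightarrow> z \<in> K \<Longrightarrow> norm (G k z) \<le> exp (d * real k)" by blast
    have "\<not> P k z v" if k: "k \<ge> k0" for k z v
    proof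
      assume "P k z v"
      then obtain y where y: "P k y (w k)" using w1 by blast
      then have "exp (\<delta> * real k) < norm (g k (y # w k))" by (simp add: P_def)
      moreover have "norm (G k y) \<le> exp (d * real k)" using k0[OF k] y by (simp add: P_def)
      then have "exp (d * real k) * norm (G k y) \<le> exp (d * real k) * exp (d * real k)" by simp
      moreover have "exp (d * real k) * norm (G k y) = norm (g k (y # w k))"
        by (simp add: G_def norm_mult exp_minus norm_inverse del: of_real_exp)
      moreover have "exp (d * real k) * exp (d * real k) = exp (\<delta> * real k)"
        by (simp add: d_def flip: exp_add)
      ultimately show False by simp
    qed
    then have "\<forall>k\<ge>k0. \<forall>w. length w = Suc n \<and> set w \<subseteq> K \<longrightarrow> norm (g k w) \<le> exp (\<delta> * real k)"
      by (auto simp: P_def length_Suc_conv not_less)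
    then show ?thesis by blast
  qed
qed

section \<open>Holomorphic dependence on a parameter\<close>

text \<open>The constant depends on f only through the bound M, which makes the remainder uniform
  over a family. Cauchy's inequality is applied on discs of radius \<rho> about points of
  \<open>cball c \<rho>\<close>, which reach distance at most 2 \<rho> from c.\<close>

lemma holomorphic_taylor2:
  assumes hol: "f holomorphic_on ball c (3 * \<rho>)" and rho: "0 < \<rho>"
    and bd: "\<And>z. z \<in> ball c (3 * \<rho>) \<Longrightarrow> norm (f z) \<le> M" and z: "norm s \<le> \<rho>"
  shows "norm (f (c + s) - f c - deriv f c * s) \<le> 2 * M / \<rho>\<^sup>2 * (norm s)\<^sup>2"
proof -
  have B: "norm ((deriv ^^ 2) f x) \<le> 2 * M / \<rho>\<^sup>2" if x: "x \<in> cball c \<rho>" for x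
  proof -
    have sub: "cball x \<rho> \<subseteq> ball c (3 * \<rho>)"
    proof
      fix y assume "y \<in> cball x \<rho>"
      then have "dist c y \<le> 2 * \<rho>" using x dist_triangle[of c y x] by simp
      then show "y \<in> ball c (3 * \<rho>)" using rho by simp
    qed
    have "norm ((deriv ^^ 2) f x) \<le> fact 2 * M / \<rho> ^ 2"
    proof (rule Cauchy_inequality)
      show "f holomorphic_on ball x \<rho>" using hol sub ball_subset_cball by (meson holomorphic_on_subset order_trans)
      show "continuous_on (cball x \<rho>) f" using hol sub by (meson holomorphic_on_subset holomorphic_on_imp_continuous_on)
      show "norm (f y) \<le> M" if "norm (x - y) = \<rho>" for y
        using bd[of y] sub that by (auto simp: dist_norm)
    qed (use rho in auto)
    then show ?thesis by (simp add: numeral_2_eq_2)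
  qed
  have "cmod ((deriv ^^ 0) f (c + s) - (\<Sum>i\<le>1. (deriv ^^ i) f c * (c + s - c) ^ i / fact i))
     \<le> (2 * M / \<rho>\<^sup>2) * cmod (c + s - c) ^ Suc 1 / fact 1"
  proof (rule complex_Taylor[where S = "cball c \<rho>" and f = "\<lambda>i. (deriv ^^ i) f"])
    fix i :: nat and x assume x: "x \<in> cball c \<rho>"
    have "(deriv ^^ i) f holomorphic_on ball c (3 * \<rho>)" using hol by (intro holomorphic_higher_deriv) auto
    moreover have "x \<in> ball c (3 * \<rho>)" using x rho by auto
    ultimately have "((deriv ^^ i) f has_field_derivative deriv ((deriv ^^ i) f) x) (at x)"
      by (intro holomorphic_derivI[of _ "ball c (3 * \<rho>)"]) auto
    then show "((deriv ^^ i) f has_field_derivative (deriv ^^ Suc i) f x) (at x within cball c \<rho>)"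
      by (simp add: has_field_derivative_at_within)
  next
    show "\<And>x. x \<in> cball c \<rho> \<Longrightarrow> cmod ((deriv ^^ Suc 1) f x) \<le> 2 * M / \<rho>\<^sup>2" using B by (simp add: numeral_2_eq_2)
  qed (use rho z in \<open>auto simp: dist_norm\<close>)
  then show ?thesis by (simp add: power2_eq_square algebra_simps)
qed

lemma holomorphic_parametric_integral:
  fixes \<phi> :: "real \<Rightarrow> complex \<Rightarrow> complex"
  assumes W: "open W" and hol: "\<And>t. t \<in> {0..1} \<Longrightarrow> \<phi> t holomorphic_on W"
    and cont: "\<And>z. z \<in> W \<Longrightarrow> continuous_on {0..1} (\<lambda>t. \<phi> t z)"
    and bd: "\<And>t z. t \<in> {0..1} \<Longrightarrow> z \<in> W \<Longrightarrow> norm (\<phi> t z) \<le> M"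
  shows "(\<lambda>z. integral {0..1} (\<lambda>t. \<phi> t z)) holomorphic_on W"
proof -
  define I where "I = (\<lambda>z. integral {0..1} (\<lambda>t. \<phi> t z))"
  have "I field_differentiable (at c)" if c: "c \<in> W" for c
  proof -
    obtain \<epsilon> where eps: "0 < \<epsilon>" "ball c \<epsilon> \<subseteq> W" using W c open_contains_ball by blast
    define \<rho> where "\<rho> = \<epsilon> / 3"
    have rho: "0 < \<rho>" "ball c (3 * \<rho>) \<subseteq> W" using eps by (auto simp: \<rho>_def)
    define B where "B = 2 * M / \<rho>\<^sup>2"
    have "0 \<le> M" using bd[of 0 c] c by (meson atLeastAtMost_iff norm_ge_zero order_refl order_trans zero_le_one)
    then have B0: "0 \<le> B" by (simp add: B_def)
    have T: "norm (\<phi> t (c + s) - \<phi> t c - deriv (\<phi> t) c * s) \<le> B * (norm s)\<^sup>2" if "t \<in> {0..1}" "norm s \<le> \<rho>" for t s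
      unfolding B_def using hol[OF that(1)] rho bd[OF that(1)] that(2)
      by (intro holomorphic_taylor2) (auto intro: holomorphic_on_subset)
    have inW: "c + s \<in> W" if "norm s \<le> \<rho>" for s
      using that rho by (auto simp: subset_iff dist_norm)
    have cd: "continuous_on {0..1} (\<lambda>t. deriv (\<phi> t) c)"
    proof (rule uniform_limit_theorem[where F = "at_right (0::real)"])
      show "\<forall>\<^sub>F s in at_right 0. continuous_on {0..1} (\<lambda>t. (\<phi> t (c + of_real s) - \<phi> t c) / of_real s)"
        using eventually_at_right_real[OF rho(1)]
        by eventually_elim (auto intro!: continuous_intros cont inW c)
      show "uniform_limit {0..1} (\<lambda>s t. (\<phi> t (c + of_real s) - \<phi> t c) / of_real s) (\<lambda>t. deriv (\<phi> t) c) (at_right 0)"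
      proof (rule uniform_limitI)
        fix e :: real assume e: "0 < e"
        define \<eta> where "\<eta> = min \<rho> (e / (B + 1))"
        have "0 < \<eta>" using e rho B0 by (simp add: \<eta>_def)
        from eventually_at_right_real[OF this]
        show "\<forall>\<^sub>F s in at_right 0. \<forall>t\<in>{0..1}. dist ((\<phi> t (c + of_real s) - \<phi> t c) / of_real s) (deriv (\<phi> t) c) < e"
        proof eventually_elim
          case (elim s)
          show ?case
          proof
            fix t :: real assume t: "t \<in> {0..1}"
            have s: "0 < s" "s < \<rho>" "s < e / (B + 1)" using elim by (auto simp: \<eta>_def)
            have "norm (\<phi> t (c + of_real s) - \<phi> t c - deriv (\<phi> t) c * of_real s) \<le> B * s\<^sup>2"
              using T[OF t, of "of_real s"] s by simp
            moreover have "(\<phi> t (c + of_real s) - \<phi> t c) / of_real s - deriv (\<phi> t) c =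
               (\<phi> t (c + of_real s) - \<phi> t c - deriv (\<phi> t) c * of_real s) / of_real s"
              using s by (simp add: field_simps)
            ultimately have "dist ((\<phi> t (c + of_real s) - \<phi> t c) / of_real s) (deriv (\<phi> t) c) \<le> B * s\<^sup>2 / s"
              using s by (simp add: dist_norm norm_divide divide_right_mono)
            also have "\<dots> = B * s" using s by (simp add: power2_eq_square)
            also have "\<dots> \<le> (B + 1) * s" using s by simp
            also have "\<dots> < e" using s(3) B0 by (simp add: field_simps)
            finally show "dist ((\<phi> t (c + of_real s) - \<phi> t c) / of_real s) (deriv (\<phi> t) c) < e" .
          qed
        qed
      qed
    qed auto
    have i: "(\<lambda>t. \<phi> t z) integrable_on {0..1}" if "z \<in> W" for z
      using cont[OF that] by (rule integrable_continuous_real)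
    have id: "(\<lambda>t. deriv (\<phi> t) c) integrable_on {0..1}" using cd by (rule integrable_continuous_real)
    define D where "D = integral {0..1} (\<lambda>t. deriv (\<phi> t) c)"
    have est: "norm (I (c + s) - I c - D * s) \<le> B * (norm s)\<^sup>2" if s: "norm s \<le> \<rho>" for s
    proof -
      have ints: "(\<lambda>t. \<phi> t (c + s) - \<phi> t c - deriv (\<phi> t) c * s) integrable_on {0..1}"
        by (intro integrable_diff i integrable_on_mult_left id inW s c)
      have eq: "I (c + s) - I c - D * s = integral {0..1} (\<lambda>t. \<phi> t (c + s) - \<phi> t c - deriv (\<phi> t) c * s)"
        unfolding I_def D_def using i[OF inW[OF s]] i[OF c] id
        by (simp add: Henstock_Kurzweil_Integration.integral_diff integrable_diff integrable_on_mult_left)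
      have "norm (integral {0..1} (\<lambda>t. \<phi> t (c + s) - \<phi> t c - deriv (\<phi> t) c * s)) \<le> integral {0..1} (\<lambda>t::real. B * (norm s)\<^sup>2)"
        using T s by (intro integral_norm_bound_integral ints integrable_const_ivl) auto
      then show ?thesis using eq by simp
    qed
    have "((\<lambda>s. (I (c + s) - I c) / s) \<longlongrightarrow> D) (at 0)"
    proof (rule Lim_transform_within[OF _ rho(1)])
      show "((\<lambda>s. D + (I (c + s) - I c - D * s) / s) \<longlongrightarrow> D) (at 0)"
      proof -
        have "((\<lambda>s. (I (c + s) - I c - D * s) / s) \<longlongrightarrow> 0) (at 0)"
        proof (rule Lim_null_comparison)
          have "\<forall>\<^sub>F s in at (0::complex). norm s \<le> \<rho> \<and> s \<noteq> 0"
            using rho(1) by (auto simp: eventually_at intro!: exI[of _ \<rho>])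
          then show "\<forall>\<^sub>F s in at 0. norm ((I (c + s) - I c - D * s) / s) \<le> B * norm s"
          proof eventually_elim
            case (elim s)
            then have "norm ((I (c + s) - I c - D * s) / s) \<le> B * (norm s)\<^sup>2 / norm s"
              using est[of s] by (simp add: norm_divide divide_right_mono)
            then show ?case using elim by (simp add: power2_eq_square)
          qed
          show "((\<lambda>s. B * norm s) \<longlongrightarrow> 0) (at (0::complex))" by (auto intro!: tendsto_eq_intros)
        qed
        then show ?thesis using tendsto_add[OF tendsto_const[of D]] by fastforce
      qed
    qed (auto simp: field_simps)
    then have "(I has_field_derivative D) (at c)" by (simp add: DERIV_def)
    then show ?thesis by (auto simp: field_differentiable_def)
  qed
  then show ?thesis unfolding I_def[symmetric]
    by (meson W field_differentiable_at_within holomorphic_on_def)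
qed

section \<open>From separate holomorphy to local bounds\<close>

text \<open>If every E m had empty interior, the complements would be dense open sets, and their
  intersection, the complement of the ball, would be dense by Baire.\<close>

lemma baire_cball:
  fixes a :: complex
  assumes R: "0 < R" and cl: "\<And>m::nat. closed (E m)" and cov: "cball a R = (\<Union>m. E m)"
  shows "\<exists>m z0 e. 0 < e \<and> z0 \<in> ball a R \<and> cball z0 e \<subseteq> E m"
proof -
  have "\<exists>m. interior (E m) \<noteq> {}"
  proof (rule ccontr)
    assume "\<not> ?thesis"
    then have *: "interior (E m) = {}" for m by blast
    have "UNIV \<subseteq> closure (\<Inter>(range (\<lambda>m. - E m)))"
    proof (rule Baire)
      fix T assume "T \<in> range (\<lambda>m. - E m)"
      then obtain m where m: "T = - E m" by blast
      show "openin (top_of_set UNIV) T \<and> UNIV \<subseteq> closure T"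
        using cl[of m] *[of m] by (simp add: m open_Compl closure_complement)
    qed auto
    also have "\<Inter>(range (\<lambda>m. - E m)) = - cball a R" by (simp add: cov Compl_UN)
    finally have "a \<in> closure (- cball a R)" by (rule subsetD) (rule UNIV_I)
    then show False using R by (simp add: closure_complement)
  qed
  then obtain m z0 where "z0 \<in> interior (E m)" by blast
  then obtain e where e: "0 < e" "cball z0 e \<subseteq> interior (E m)"
    by (meson open_contains_cball open_interior)
  have "interior (E m) \<subseteq> interior (cball a R)" using cov by (intro interior_mono) auto
  then have "z0 \<in> ball a R" using \<open>z0 \<in> interior (E m)\<close> by auto
  then show ?thesis using e interior_subset by blast
qed

text \<open>Cauchy's formula over the circle of radius \<epsilon> writes the Taylor coefficient in
  the first variable as a parameter integral in the tail. Boundedness is required only for z in the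
  small disc, which is all that Baire's theorem delivers.\<close>

lemma sephol_taylor_coeff:
  assumes hol: "sephol V (Suc n) F" and V: "open V" and W: "open W" "W \<subseteq> V"
    and eps: "0 < \<epsilon>" "cball z0 \<epsilon> \<subseteq> V"
    and bd: "\<And>z w. z \<in> cball z0 \<epsilon> \<Longrightarrow> length w = n \<Longrightarrow> set w \<subseteq> W \<Longrightarrow> norm (F (z # w)) \<le> M"
  shows "sephol W n (\<lambda>w. (deriv ^^ k) (\<lambda>z. F (z # w)) z0 / fact k)"
  unfolding sephol_def
proof (intro allI impI)
  fix xs ys assume xy: "Suc (length xs + length ys) = n \<and> set xs \<subseteq> W \<and> set ys \<subseteq> W"
  define \<phi> where "\<phi> = (\<lambda>t \<zeta>. F ((z0 + of_real \<epsilon> * ucirc t) # xs @ \<zeta> # ys) *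
     (2 * pi * \<i> * of_real \<epsilon> * ucirc t / (of_real \<epsilon> * ucirc t) ^ Suc k))"
  have inc: "z0 + of_real \<epsilon> * ucirc t \<in> cball z0 \<epsilon>" for t
    using eps by (simp add: dist_norm norm_mult)
  have hz: "(\<lambda>z. F (z # xs @ \<zeta> # ys)) holomorphic_on V" if "\<zeta> \<in> W" for \<zeta>
    using xy that W by (intro sephol_head[OF hol]) auto
  have "(\<lambda>\<zeta>. integral {0..1} (\<lambda>t. \<phi> t \<zeta>)) holomorphic_on W"
  proof (rule holomorphic_parametric_integral[OF W(1)])
    fix t :: real
    have "(\<lambda>\<zeta>. F (((z0 + of_real \<epsilon> * ucirc t) # xs) @ \<zeta> # ys)) holomorphic_on V"
      using hol xy inc[of t] eps W unfolding sephol_def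
      by (elim allE[of _ "(z0 + of_real \<epsilon> * ucirc t) # xs"] allE[of _ ys]) auto
    then show "\<phi> t holomorphic_on W" unfolding \<phi>_def
      using W by (intro holomorphic_intros) (auto intro: holomorphic_on_subset)
  next
    fix \<zeta> assume z: "\<zeta> \<in> W"
    have "continuous_on V (\<lambda>z. F (z # xs @ \<zeta> # ys))" using hz[OF z] by (rule holomorphic_on_imp_continuous_on)
    then have "continuous_on {0..1} (\<lambda>t. F ((z0 + of_real \<epsilon> * ucirc t) # xs @ \<zeta> # ys))"
      by (rule continuous_on_compose2) (use inc eps in \<open>auto intro!: continuous_intros\<close>)
    then show "continuous_on {0..1} (\<lambda>t. \<phi> t \<zeta>)"
      unfolding \<phi>_def using eps by (intro continuous_intros) auto
  next
    fix t \<zeta> assume z: "\<zeta> \<in> W"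
    have "norm (\<phi> t \<zeta>) = norm (F ((z0 + of_real \<epsilon> * ucirc t) # xs @ \<zeta> # ys)) * (2 * pi * \<epsilon> / \<epsilon> ^ Suc k)"
      using eps by (simp add: \<phi>_def norm_mult norm_divide norm_power)
    also have "\<dots> \<le> M * (2 * pi * \<epsilon> / \<epsilon> ^ Suc k)"
      using eps xy z by (intro mult_right_mono bd inc) auto
    finally show "norm (\<phi> t \<zeta>) \<le> M * (2 * pi * \<epsilon> / \<epsilon> ^ Suc k)" .
  qed
  then have "(\<lambda>\<zeta>. integral {0..1} (\<lambda>t. \<phi> t \<zeta>) / (2 * pi * \<i>)) holomorphic_on W" by (intro holomorphic_intros) auto
  then show "(\<lambda>\<zeta>. (deriv ^^ k) (\<lambda>z. F (z # xs @ \<zeta> # ys)) z0 / fact k) holomorphic_on W"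
  proof (rule holomorphic_transform)
    fix \<zeta> assume z: "\<zeta> \<in> W"
    have "((\<lambda>u. F (u # xs @ \<zeta> # ys) / (u - z0) ^ Suc k) has_contour_integral
        (2 * pi * \<i>) / fact k * (deriv ^^ k) (\<lambda>z. F (z # xs @ \<zeta> # ys)) z0) (circlepath z0 \<epsilon>)"
    proof (rule Cauchy_has_contour_integral_higher_derivative_circlepath)
      show "continuous_on (cball z0 \<epsilon>) (\<lambda>u. F (u # xs @ \<zeta> # ys))"
        using hz[OF z] eps by (meson holomorphic_on_imp_continuous_on holomorphic_on_subset)
      show "(\<lambda>u. F (u # xs @ \<zeta> # ys)) holomorphic_on ball z0 \<epsilon>"
        using hz[OF z] eps ball_subset_cball by (meson holomorphic_on_subset order_trans)
    qed (use eps in auto)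
    note ci = this[unfolded has_contour_integral_circlepath_ucirc]
    have ph: "\<phi> t \<zeta> = F ((z0 + of_real \<epsilon> * ucirc t) # xs @ \<zeta> # ys) / (z0 + of_real \<epsilon> * ucirc t - z0) ^ Suc k
        * (2 * pi * \<i> * of_real \<epsilon> * ucirc t)" for t
      by (simp add: \<phi>_def)
    have "((\<lambda>t. \<phi> t \<zeta>) has_integral (2 * pi * \<i>) / fact k * (deriv ^^ k) (\<lambda>z. F (z # xs @ \<zeta> # ys)) z0) {0..1}"
      by (rule has_integral_eq[OF _ ci]) (simp only: ph)
    then have "integral {0..1} (\<lambda>t. \<phi> t \<zeta>) = (2 * pi * \<i>) / fact k * (deriv ^^ k) (\<lambda>z. F (z # xs @ \<zeta> # ys)) z0"
      by (intro integral_unique) blast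
    then show "integral {0..1} (\<lambda>t. \<phi> t \<zeta>) / (2 * pi * \<i>) = (deriv ^^ k) (\<lambda>z. F (z # xs @ \<zeta> # ys)) z0 / fact k"
      by simp
  qed
qed

lemma norm_taylor_coeff_le:
  assumes "f holomorphic_on V" "cball c \<rho> \<subseteq> V" "0 < \<rho>" "\<And>z. z \<in> cball c \<rho> \<Longrightarrow> norm (f z) \<le> M"
  shows "norm ((deriv ^^ k) f c / fact k) \<le> M / \<rho> ^ k"
proof -
  have "norm ((deriv ^^ k) f c) \<le> fact k * M / \<rho> ^ k"
  proof (rule Cauchy_inequality)
    show "f holomorphic_on ball c \<rho>"
      using assms ball_subset_cball by (meson holomorphic_on_subset order_trans)
    show "continuous_on (cball c \<rho>) f"
      using assms by (meson holomorphic_on_imp_continuous_on holomorphic_on_subset)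
    show "norm (f x) \<le> M" if "norm (c - x) = \<rho>" for x
      using assms(4)[of x] that by (auto simp: dist_norm)
  qed fact
  then show ?thesis by (simp add: norm_divide pos_divide_le_eq mult.commute)
qed

text \<open>Baire's theorem gives boundedness for \<open>z\<close> in a small disc; the Taylor coefficients in \<open>z\<close>
  about its centre then satisfy the hypotheses of Hartogs' lemma.\<close>

lemma hartogs_bounded_local:
  assumes V: "open V" and hol: "sephol V (Suc n) F"
    and IH: "\<And>z L. z \<in> V \<Longrightarrow> compact L \<Longrightarrow> L \<subseteq> V \<Longrightarrow>
       \<exists>M. \<forall>w. length w = n \<and> set w \<subseteq> L \<longrightarrow> norm (F (z # w)) \<le> M"
    and a: "a \<in> V" and L: "compact L" "L \<subseteq> V"
  shows "\<exists>R>0. \<exists>M. \<forall>z\<in>ball a R. \<forall>w. length w = n \<and> set w \<subseteq> L \<longrightarrow> norm (F (z # w)) \<le> M"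
proof -
  obtain e0 where e0: "0 < e0" "cball a e0 \<subseteq> V" using V a open_contains_cball by blast
  \<comment> \<open>Two points of \<open>ball a R\<close> are less than 2 R apart, and a disc of
    radius 3 R about such a point stays in \<open>cball a (4 * R)\<close>; the gap between 2 R and 3
    R makes the Taylor series at the new centre converge geometrically.\<close>
  define R where "R = e0 / 4"
  have R: "0 < R" "cball a (4 * R) \<subseteq> V" using e0 by (auto simp: R_def)
  have cR: "cball a R \<subseteq> V"
    using R(2) by (rule order_trans[rotated]) (use R(1) in auto)
  obtain \<eta> where eta: "0 < \<eta>" "(\<Union>x\<in>L. cball x \<eta>) \<subseteq> V"
    using compact_subset_open_imp_cball_epsilon_subset[OF L(1) V L(2)] .
  \<comment> \<open>Tails are enlarged from L: Hartogs' lemma needs an open set \<open>W\<close> of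
    tails around L, and boundedness from the induction hypothesis needs a compact set containing
    \<open>W\<close>.\<close>
  define L' where "L' = (\<Union>x\<in>L. cball x \<eta>)"
  define W where "W = (\<Union>x\<in>L. ball x \<eta>)"
  have L': "compact L'" "L' \<subseteq> V" using compact_minkowski_sum_cball[OF L(1)] eta by (auto simp: L'_def)
  have W: "open W" "W \<subseteq> L'" "L \<subseteq> W" "W \<subseteq> V"
  proof -
    show "W \<subseteq> L'" unfolding W_def L'_def by (intro UN_mono order_refl ball_subset_cball)
    then show "W \<subseteq> V" using L'(2) by blast
  qed (use eta in \<open>auto simp: W_def\<close>)
  have cont: "continuous_on (cball a R) (\<lambda>z. F (z # w))" if "length w = n" "set w \<subseteq> L'" for w
  proof -
    have "set w \<subseteq> V" using that(2) L'(2) by (rule order_trans)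
    from holomorphic_on_subset[OF sephol_head[OF hol that(1) this] cR] show ?thesis
      by (rule holomorphic_on_imp_continuous_on)
  qed
  \<comment> \<open>An intersection over tails of sets that are closed by continuity in z alone, so
    separate continuity is enough.\<close>
  define E where "E = (\<lambda>m::nat. {z \<in> cball a R. \<forall>w. length w = n \<and> set w \<subseteq> L' \<longrightarrow> norm (F (z # w)) \<le> real m})"
  have "E m = cball a R \<inter> (\<Inter>w\<in>{w. length w = n \<and> set w \<subseteq> L'}. {z \<in> cball a R. norm (F (z # w)) \<le> real m})" for m
    by (auto simp: E_def)
  then have clE: "closed (E m)" for m
    by (simp only:) (intro closed_Int closed_INT ballI continuous_on_closed_Collect_le continuous_intros cont closed_cball; auto)
  have covE: "cball a R = (\<Union>m. E m)"
  proof
    show "cball a R \<subseteq> (\<Union>m. E m)"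
    proof
      fix z assume z: "z \<in> cball a R"
      then have "z \<in> V" using cR by blast
      from IH[OF this L'] obtain M where M: "\<forall>w. length w = n \<and> set w \<subseteq> L' \<longrightarrow> norm (F (z # w)) \<le> M" by blast
      obtain m :: nat where "M \<le> real m" using real_arch_simple by blast
      then have "z \<in> E m" using z M by (force simp: E_def)
      then show "z \<in> (\<Union>m. E m)" by blast
    qed
  qed (auto simp: E_def)
  obtain m z0 \<epsilon> where z0: "0 < \<epsilon>" "z0 \<in> ball a R" "cball z0 \<epsilon> \<subseteq> E m"
    using baire_cball[of R E a, OF R(1) clE covE] by auto
  have c3: "cball z0 (3 * R) \<subseteq> V"
  proof -
    have "cball z0 (3 * R) \<subseteq> cball a (4 * R)" using z0(2) by (simp add: cball_subset_cball_iff dist_commute)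
    then show ?thesis using R(2) by (rule order_trans)
  qed
  have epsV: "cball z0 \<epsilon> \<subseteq> V" using z0(3) cR unfolding E_def by blast
  have bdE: "norm (F (z # w)) \<le> real m" if "z \<in> cball z0 \<epsilon>" "length w = n" "set w \<subseteq> L'" for z w
    using z0(3) that by (auto simp: E_def)
  define c where "c = (\<lambda>k w. (deriv ^^ k) (\<lambda>z. F (z # w)) z0 / fact k)"
  \<comment> \<open>For each fixed tail, Cauchy's inequality on the disc of radius 3 R bounds this
    sequence; the small disc of radius \<epsilon> gives the uniform exponential bound with base 3 R
    / \<epsilon>.\<close>
  define g where "g = (\<lambda>k w. of_real ((3 * R) ^ k) * c k w)"
  have cb: "norm (c k w) \<le> real m / \<epsilon> ^ k" if "length w = n" "set w \<subseteq> L'" for k w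
    unfolding c_def using that z0(1) epsV L' bdE
    by (intro norm_taylor_coeff_le[OF sephol_head[OF hol that(1)]]) auto
  \<comment> \<open>Any rate below ln (3/2) would do: with base 5/4 the terms at distance 2 R have
    ratio (5/4) * (2/3) = 5/6, and the geometric series with this ratio sums to the 6 in the final
    bound.\<close>
  obtain k0 where k0: "\<And>k w. k \<ge> k0 \<Longrightarrow> length w = n \<Longrightarrow> set w \<subseteq> L \<Longrightarrow> norm (g k w) \<le> exp (ln (5/4) * real k)"
  proof -
    have "\<exists>k0. \<forall>k\<ge>k0. \<forall>w. length w = n \<and> set w \<subseteq> L \<longrightarrow> norm (g k w) \<le> exp (ln (5/4) * real k)"
    proof (rule hartogs_several_variables[OF W(1) _ _ _ L(1) W(3)])
      show "sephol W n (g k)" for k unfolding g_def c_def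
        using bdE W by (intro sephol_cmult sephol_taylor_coeff[OF hol V W(1) W(4) z0(1) epsV, where M = "real m"]) auto
    next
      fix K assume K: "compact K" "K \<subseteq> W"
      have "norm (g k w) \<le> max 1 (real m) * max 1 (3 * R / \<epsilon>) ^ k" if "length w = n" "set w \<subseteq> K" for k w
      proof -
        have "norm (g k w) = (3 * R) ^ k * norm (c k w)" using R by (simp add: g_def norm_mult norm_power)
        also have "\<dots> \<le> (3 * R) ^ k * (real m / \<epsilon> ^ k)"
          using that K W R by (intro mult_left_mono cb) auto
        also have "\<dots> = real m * (3 * R / \<epsilon>) ^ k" by (simp add: power_divide)
        also have "\<dots> \<le> max 1 (real m) * max 1 (3 * R / \<epsilon>) ^ k"
          using R z0(1) by (intro mult_mono power_mono) auto
        finally show ?thesis .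
      qed
      then show "\<exists>M\<ge>1. \<exists>A\<ge>1. \<forall>k w. length w = n \<and> set w \<subseteq> K \<longrightarrow> norm (g k w) \<le> M * A ^ k"
        by (intro exI[of _ "max 1 (real m)"] conjI exI[of _ "max 1 (3 * R / \<epsilon>)"]) auto
    next
      fix w assume w: "length w = n" "set w \<subseteq> W"
      have hw: "(\<lambda>z. F (z # w)) holomorphic_on V" using w W by (intro sephol_head[OF hol]) auto
      have "compact ((\<lambda>z. F (z # w)) ` cball z0 (3 * R))"
        using hw c3 by (intro compact_continuous_image holomorphic_on_imp_continuous_on) (auto intro: holomorphic_on_subset)
      then obtain C where C: "\<And>z. z \<in> cball z0 (3 * R) \<Longrightarrow> norm (F (z # w)) \<le> C"
        by (meson bounded_iff compact_imp_bounded imageI)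
      have "norm (g k w) \<le> C" for k
      proof -
        have "norm (c k w) \<le> C / (3 * R) ^ k" unfolding c_def
          using R C by (intro norm_taylor_coeff_le[OF hw c3]) auto
        then show ?thesis using R by (simp add: g_def norm_mult norm_power field_simps)
      qed
      then show "\<exists>C. \<forall>k. norm (g k w) \<le> C" by blast
    qed auto
    then show thesis using that by blast
  qed
  have "norm (F (z # w)) \<le> (\<Sum>k<k0. real m / \<epsilon> ^ k * (2 * R) ^ k) + 6"
    if z: "z \<in> ball a R" and w: "length w = n" "set w \<subseteq> L" for z w
  proof -
    define b where "b = (\<lambda>k. (if k < k0 then real m / \<epsilon> ^ k * (2 * R) ^ k else 0) + (5/6) ^ k)"
    have dz: "norm (z - z0) \<le> 2 * R"
      using z z0(2) dist_triangle[of z z0 a] by (simp add: dist_norm norm_minus_commute)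
    have "z \<in> ball z0 (3 * R)" using dz R by (simp add: dist_norm norm_minus_commute)
    moreover have "(\<lambda>z. F (z # w)) holomorphic_on ball z0 (3 * R)"
      using sephol_head[OF hol w(1)] w(2) W c3 ball_subset_cball by (meson holomorphic_on_subset order_trans)
    ultimately have sm: "(\<lambda>k. c k w * (z - z0) ^ k) sums F (z # w)"
      unfolding c_def by (intro holomorphic_power_series)
    have "(\<lambda>k. if k < k0 then real m / \<epsilon> ^ k * (2 * R) ^ k else 0) sums (\<Sum>k<k0. real m / \<epsilon> ^ k * (2 * R) ^ k)"
      using sums_If_finite_set[of "{..<k0}" "\<lambda>k. real m / \<epsilon> ^ k * (2 * R) ^ k"] by simp
    moreover have "(\<lambda>k. (5/6::real) ^ k) sums 6" using geometric_sums[of "5/6::real"] by simp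
    ultimately have bs: "b sums ((\<Sum>k<k0. real m / \<epsilon> ^ k * (2 * R) ^ k) + 6)"
      unfolding b_def by (rule sums_add)
    have le: "norm (c k w * (z - z0) ^ k) \<le> b k" for k
    proof -
      have p: "norm (z - z0) ^ k \<le> (2 * R) ^ k" using dz by (intro power_mono) auto
      show ?thesis
      proof (cases "k < k0")
        case True
        have "norm (c k w * (z - z0) ^ k) \<le> real m / \<epsilon> ^ k * (2 * R) ^ k"
          unfolding norm_mult norm_power using w W z0(1) by (intro mult_mono p cb) auto
        then show ?thesis using True by (simp add: b_def add_increasing2)
      next
        case False
        have "norm (g k w) \<le> exp (ln (5/4) * real k)" using k0 False w by simp
        also have "\<dots> = (5/4) ^ k" by (simp add: exp_of_nat2_mult)
        finally have "(3 * R) ^ k * norm (c k w) \<le> (5/4) ^ k" using R by (simp add: g_def norm_mult norm_power)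
        then have "norm (c k w) \<le> (5/4) ^ k / (3 * R) ^ k" using R by (simp add: field_simps)
        then have "norm (c k w * (z - z0) ^ k) \<le> (5/4) ^ k / (3 * R) ^ k * (2 * R) ^ k"
          unfolding norm_mult norm_power using R by (intro mult_mono p) auto
        also have "\<dots> = ((5/4) / (3 * R) * (2 * R)) ^ k" by (simp only: power_mult_distrib power_divide)
        also have "(5/4) / (3 * R) * (2 * R) = 5/6" using R by simp
        finally show ?thesis using False by (simp add: b_def)
      qed
    qed
    have "norm (\<Sum>k. c k w * (z - z0) ^ k) \<le> (\<Sum>k. b k)"
      using le bs by (intro norm_suminf_le) (auto simp: sums_iff)
    then show ?thesis using sm bs by (simp add: sums_iff)
  qed
  then show ?thesis using R(1) by blast
qed

text \<open>Compactness is needed in the first variable only, since the local lemma already covers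
  all tails over L.\<close>

theorem hartogs_bounded:
  assumes V: "open V" and hol: "sephol V n F" and L: "compact L" "L \<subseteq> V"
  shows "\<exists>M. \<forall>w. length w = n \<and> set w \<subseteq> L \<longrightarrow> norm (F w) \<le> M"
  using hol L
proof (induction n arbitrary: F L)
  case 0
  show ?case by (rule exI[of _ "norm (F [])"]) auto
next
  case (Suc n)
  have "\<exists>R>0. \<exists>M. \<forall>z\<in>ball a R. \<forall>w. length w = n \<and> set w \<subseteq> L \<longrightarrow> norm (F (z # w)) \<le> M" if "a \<in> L" for a
    using that Suc.prems
    by (intro hartogs_bounded_local[OF V Suc.prems(1)] Suc.IH sephol_Cons[OF Suc.prems(1)]) auto
  then obtain R M where RM: "\<And>a. a \<in> L \<Longrightarrow> 0 < R a"
    "\<And>a z w. a \<in> L \<Longrightarrow> z \<in> ball a (R a) \<Longrightarrow> length w = n \<Longrightarrow> set w \<subseteq> L \<Longrightarrow> norm (F (z # w)) \<le> M a"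
    by metis
  have "L \<subseteq> (\<Union>a\<in>L. ball a (R a))" using RM(1) by auto
  then obtain T where T: "T \<subseteq> L" "finite T" "L \<subseteq> (\<Union>a\<in>T. ball a (R a))"
    using compactE_image[OF Suc.prems(2), of L "\<lambda>a. ball a (R a)"] by auto
  have "norm (F w) \<le> Max (insert 0 (M ` T))" if w: "length w = Suc n" "set w \<subseteq> L" for w
  proof -
    obtain z v where zv: "w = z # v" "length v = n" using w(1) by (auto simp: length_Suc_conv)
    obtain a where a: "a \<in> T" "z \<in> ball a (R a)" using T(3) w(2) zv by auto
    have "norm (F w) \<le> M a" using RM(2)[of a z v] a T(1) zv w(2) by auto
    also have "\<dots> \<le> Max (insert 0 (M ` T))" using a T(2) by auto
    finally show ?thesis .
  qed
  then show ?case by blast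
qed

section \<open>Laurent expansion in several variables\<close>

definition laurent_coeff :: "(complex \<Rightarrow> complex) \<Rightarrow> int \<Rightarrow> complex" where
  "laurent_coeff f m = integral {0..1} (\<lambda>t. f (ucirc t) * ucirc t powi (- m))"

text \<open>The linear homotopy between concentric circles passes through circles of intermediate
  radius, all inside the annulus, so Cauchy's theorem for homotopic loops applies.\<close>

lemma has_integral_circle_homotopic:
  assumes V: "open V" and f: "f holomorphic_on V" and q: "0 < q" "q \<le> \<rho>" "\<rho> \<le> 1 / q" "q < 1"
    and sub: "closed_annulus q \<subseteq> V"
  shows "integral {0..1} (\<lambda>t. f (of_real \<rho> * ucirc t) * (of_real \<rho> * ucirc t)) = integral {0..1} (\<lambda>t. f (ucirc t) * ucirc t)"
proof -
  have on: "z \<in> V" if "q \<le> norm z" "norm z \<le> 1 / q" for z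
    using sub that by (auto simp: closed_annulus_def)
  have q1: "q \<le> 1" "1 \<le> 1 / q" using q by auto
  have *: "contour_integral (circlepath 0 s) f = 2 * pi * \<i> * integral {0..1} (\<lambda>t. f (of_real s * ucirc t) * (of_real s * ucirc t))"
    if s: "q \<le> s" "s \<le> 1 / q" for s
  proof -
    have "continuous_on {0..1} (\<lambda>t. f (of_real s * ucirc t))"
      by (rule continuous_on_compose2[OF holomorphic_on_imp_continuous_on[OF f]])
         (use s q in \<open>auto intro!: continuous_intros on simp: norm_mult\<close>)
    then have "(\<lambda>t. f (of_real s * ucirc t) * (of_real s * ucirc t)) integrable_on {0..1}"
      by (intro integrable_continuous_real continuous_intros)
    then have "((\<lambda>t. 2 * pi * \<i> * (f (of_real s * ucirc t) * (of_real s * ucirc t))) has_integral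
       2 * pi * \<i> * integral {0..1} (\<lambda>t. f (of_real s * ucirc t) * (of_real s * ucirc t))) {0..1}"
      by (intro has_integral_mult_right integrable_integral)
    then have "(f has_contour_integral 2 * pi * \<i> * integral {0..1} (\<lambda>t. f (of_real s * ucirc t) * (of_real s * ucirc t))) (circlepath 0 s)"
      unfolding has_contour_integral_circlepath_ucirc by (simp add: mult_ac)
    then show ?thesis by (rule contour_integral_unique)
  qed
  have "contour_integral (circlepath 0 \<rho>) f = contour_integral (circlepath 0 1) f"
  proof (rule Cauchy_theorem_homotopic_loops[OF _ V f])
    show "homotopic_loops V (circlepath 0 \<rho>) (circlepath 0 1)"
    proof (rule homotopic_loops_linear)
      fix t :: real assume "t \<in> {0..1}"
      show "closed_segment (circlepath 0 \<rho> t) (circlepath 0 1 t) \<subseteq> V"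
      proof
        fix z assume "z \<in> closed_segment (circlepath 0 \<rho> t) (circlepath 0 1 t)"
        then obtain u where u: "0 \<le> u" "u \<le> 1" "z = (1 - u) *\<^sub>R circlepath 0 \<rho> t + u *\<^sub>R circlepath 0 1 t"
          by (auto simp: in_segment)
        then have "z = of_real ((1 - u) * \<rho> + u * 1) * ucirc t"
          by (simp add: circlepath_ucirc scaleR_conv_of_real algebra_simps)
        then have "norm z = \<bar>(1 - u) * \<rho> + u * 1\<bar>" by (simp only: norm_mult norm_of_real norm_ucirc mult_1_right)
        also have "\<dots> = (1 - u) * \<rho> + u * 1" using u q by simp
        finally have nz: "norm z = (1 - u) * \<rho> + u * 1" .
        have "(1 - u) * q + u * q \<le> norm z" unfolding nz using u q q1 by (intro add_mono mult_left_mono) auto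
        moreover have "norm z \<le> (1 - u) * (1 / q) + u * (1 / q)" unfolding nz using u q q1 by (intro add_mono mult_left_mono) auto
        ultimately show "z \<in> V" by (intro on) (simp_all add: algebra_simps diff_divide_distrib)
      qed
    qed auto
  qed auto
  then show ?thesis using *[of \<rho>] *[of 1] q q1 by simp
qed

lemma laurent_coeff_circle:
  assumes V: "open V" and f: "f holomorphic_on V" and q: "0 < q" "q \<le> \<rho>" "\<rho> \<le> 1 / q" "q < 1"
    and sub: "closed_annulus q \<subseteq> V"
  shows "laurent_coeff f m = integral {0..1} (\<lambda>t. f (of_real \<rho> * ucirc t) * (of_real \<rho> * ucirc t) powi (- m))"
proof -
  have "integral {0..1} (\<lambda>t. (\<lambda>z. f z * z powi (- m - 1)) (of_real \<rho> * ucirc t) * (of_real \<rho> * ucirc t))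
    = integral {0..1} (\<lambda>t. (\<lambda>z. f z * z powi (- m - 1)) (ucirc t) * ucirc t)"
  \<comment> \<open>V may contain the origin, where the power z^(- m - 1) can be singular.\<close>
  proof (rule has_integral_circle_homotopic[where V = "V - {0}"])
    show "(\<lambda>z. f z * z powi (- m - 1)) holomorphic_on V - {0}"
      using f by (intro holomorphic_intros) (auto intro: holomorphic_on_subset)
    show "closed_annulus q \<subseteq> V - {0}" using sub q by (auto simp: closed_annulus_def)
  qed (use V q in auto)
  moreover have "z powi (- m - 1) * z = z powi (- m)" if "z \<noteq> 0" for z :: complex
    using power_int_add[of z "- m - 1" 1] that by simp
  ultimately show ?thesis using q by (simp add: laurent_coeff_def mult.assoc)
qed

lemma norm_laurent_coeff_le:
  assumes V: "open V" and f: "f holomorphic_on V" and q: "0 < q" "q < 1"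
    and sub: "closed_annulus q \<subseteq> V" and bd: "\<And>z. z \<in> closed_annulus q \<Longrightarrow> norm (f z) \<le> M"
  shows "norm (laurent_coeff f m) \<le> M * q ^ nat \<bar>m\<bar>"
proof -
  \<comment> \<open>The radius is chosen by the sign of m so that \<rho>^(-m) is q^|m| in both
    cases.\<close>
  define \<rho> where "\<rho> = (if m \<ge> 0 then 1 / q else q)"
  have "q * q \<le> 1 * 1" using q by (intro mult_mono) auto
  then have rho: "q \<le> \<rho>" "\<rho> \<le> 1 / q" "0 < \<rho>" using q by (auto simp: \<rho>_def field_simps)
  have rm: "\<rho> powi (- m) = q ^ nat \<bar>m\<bar>"
    using q by (auto simp: \<rho>_def power_int_def power_divide field_simps)
  have an: "of_real \<rho> * ucirc t \<in> closed_annulus q" for t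
    using rho by (auto simp: closed_annulus_def norm_mult)
  have c: "continuous_on {0..1} (\<lambda>t. f (of_real \<rho> * ucirc t))"
    by (rule continuous_on_compose2[OF holomorphic_on_imp_continuous_on[OF f]])
       (use an sub in \<open>auto intro!: continuous_intros\<close>)
  have "norm (laurent_coeff f m) \<le> integral {0..1} (\<lambda>t::real. M * q ^ nat \<bar>m\<bar>)"
    unfolding laurent_coeff_circle[OF V f q(1) rho(1,2) q(2) sub]
  proof (rule integral_norm_bound_integral)
    show "(\<lambda>t. f (of_real \<rho> * ucirc t) * (of_real \<rho> * ucirc t) powi (- m)) integrable_on {0..1}"
      using rho by (intro integrable_continuous_real continuous_intros c) auto
    fix t :: real
    have "norm (f (of_real \<rho> * ucirc t) * (of_real \<rho> * ucirc t) powi (- m)) = norm (f (of_real \<rho> * ucirc t)) * q ^ nat \<bar>m\<bar>"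
      using rho(3) by (simp add: norm_mult norm_power_int power_int_mult_distrib flip: rm)
    also have "\<dots> \<le> M * q ^ nat \<bar>m\<bar>" using q an by (intro mult_right_mono bd) auto
    finally show "norm (f (of_real \<rho> * ucirc t) * (of_real \<rho> * ucirc t) powi (- m)) \<le> M * q ^ nat \<bar>m\<bar>" .
  qed (rule integrable_const_ivl)
  then show ?thesis by simp
qed

text \<open>The remainder after L terms is the integral of \<phi> * u^L / (1 - u), which is at most
  M * \<theta>^L / (1 - \<theta>).\<close>

lemma integral_geometric_sums:
  fixes \<phi> u :: "real \<Rightarrow> complex"
  assumes c: "continuous_on {0..1} \<phi>" "continuous_on {0..1} u" and \<theta>: "\<theta> < 1"
    and u: "\<And>t. t \<in> {0..1} \<Longrightarrow> norm (u t) \<le> \<theta>" and bd: "\<And>t. t \<in> {0..1} \<Longrightarrow> norm (\<phi> t) \<le> M"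
  shows "(\<lambda>m. integral {0..1} (\<lambda>t. \<phi> t * u t ^ m)) sums integral {0..1} (\<lambda>t. \<phi> t / (1 - u t))"
proof -
  have u1: "u t \<noteq> 1" if "t \<in> {0..1}" for t using u[OF that] \<theta> by auto
  have th0: "0 \<le> \<theta>" using u[of 0] by (meson atLeastAtMost_iff norm_ge_zero order_refl order_trans zero_le_one)
  have M0: "0 \<le> M" using bd[of 0] by (meson atLeastAtMost_iff norm_ge_zero order_refl order_trans zero_le_one)
  have i1: "(\<lambda>t. \<phi> t * u t ^ m) integrable_on {0..1}" for m
    by (intro integrable_continuous_real continuous_intros c)
  have i2: "(\<lambda>t. \<phi> t / (1 - u t)) integrable_on {0..1}"
    using u1 by (intro integrable_continuous_real continuous_intros c) auto
  have i3: "(\<lambda>t. \<phi> t * u t ^ L / (1 - u t)) integrable_on {0..1}" for L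
    using u1 by (intro integrable_continuous_real continuous_intros c) auto
  have bnd: "norm ((\<Sum>m<L. integral {0..1} (\<lambda>t. \<phi> t * u t ^ m)) - integral {0..1} (\<lambda>t. \<phi> t / (1 - u t))) \<le> M * \<theta> ^ L / (1 - \<theta>)" for L
  proof -
    have "(\<Sum>m<L. integral {0..1} (\<lambda>t. \<phi> t * u t ^ m)) - integral {0..1} (\<lambda>t. \<phi> t / (1 - u t))
      = integral {0..1} (\<lambda>t. \<Sum>m<L. \<phi> t * u t ^ m) - integral {0..1} (\<lambda>t. \<phi> t / (1 - u t))"
      using i1 by (subst Henstock_Kurzweil_Integration.integral_sum) auto
    also have "\<dots> = integral {0..1} (\<lambda>t. (\<Sum>m<L. \<phi> t * u t ^ m) - \<phi> t / (1 - u t))"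
      using i1 i2 by (subst Henstock_Kurzweil_Integration.integral_diff) (auto intro!: integrable_sum)
    also have "\<dots> = integral {0..1} (\<lambda>t. - (\<phi> t * u t ^ L / (1 - u t)))"
    proof (rule integral_cong)
      fix t :: real assume t: "t \<in> {0..1}"
      have eq: "(\<Sum>m<L. \<phi> t * u t ^ m) = \<phi> t * ((1 - u t ^ L) / (1 - u t))"
        using u1[OF t] by (simp add: sum_gp_strict flip: sum_distrib_left)
      show "(\<Sum>m<L. \<phi> t * u t ^ m) - \<phi> t / (1 - u t) = - (\<phi> t * u t ^ L / (1 - u t))"
        unfolding eq by (simp add: right_diff_distrib diff_divide_distrib)
    qed
    also have "norm \<dots> \<le> integral {0..1} (\<lambda>t::real. M * \<theta> ^ L / (1 - \<theta>))"
    proof (rule integral_norm_bound_integral)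
      fix t :: real assume t: "t \<in> {0..1}"
      have "1 - \<theta> \<le> norm (1 - u t)" using norm_triangle_ineq2[of 1 "u t"] u[OF t] by simp
      then show "norm (- (\<phi> t * u t ^ L / (1 - u t))) \<le> M * \<theta> ^ L / (1 - \<theta>)"
        unfolding norm_minus_cancel norm_divide norm_mult norm_power
        using \<theta> th0 M0 u[OF t] bd[OF t] by (intro frac_le mult_mono power_mono) auto
    qed (use i3 in \<open>auto intro!: integrable_neg integrable_const_ivl\<close>)
    finally show ?thesis by simp
  qed
  have "(\<lambda>L. M * \<theta> ^ L / (1 - \<theta>)) \<longlonglongrightarrow> 0"
    using \<theta> th0 by (auto intro!: tendsto_eq_intros LIMSEQ_realpow_zero)
  then have "(\<lambda>L. (\<Sum>m<L. integral {0..1} (\<lambda>t. \<phi> t * u t ^ m)) - integral {0..1} (\<lambda>t. \<phi> t / (1 - u t))) \<longlonglongrightarrow> 0"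
    by (rule Lim_null_comparison[OF always_eventually[OF allI[OF bnd]]])
  then show ?thesis unfolding sums_def by (rule LIM_zero_cancel)
qed

text \<open>The quotient (f w - f z) / (w - z) has a removable singularity at z, so its integrals
  over the two boundary circles agree. The term with f z contributes winding number 1 on the outer
  circle and 0 on the inner one.\<close>

lemma annulus_cauchy_formula:
  assumes V: "open V" and f: "f holomorphic_on V" and q: "0 < q" "q < 1"
    and sub: "closed_annulus q \<subseteq> V" and z: "q < norm z" "norm z < 1 / q"
  shows "f z = integral {0..1} (\<lambda>t. f (of_real (1/q) * ucirc t) / (1 - z / (of_real (1/q) * ucirc t)))
     - integral {0..1} (\<lambda>t. f (of_real q * ucirc t) * (of_real q * ucirc t) / (of_real q * ucirc t - z))"
proof -
  have qq: "q \<le> 1 / q"  "0 < 1 / q" using z q by auto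
  have zV: "z \<in> V" using sub z by (auto simp: closed_annulus_def)
  define g where "g = (\<lambda>w. if w = z then deriv f z else (f w - f z) / (w - z))"
  have g: "g holomorphic_on V" unfolding g_def
    using f zV V by (intro pole_lemma) (auto simp: interior_open)
  have an: "of_real s * ucirc t \<in> V" if "s = q \<or> s = 1 / q" for s t
    using sub qq q that by (auto simp: closed_annulus_def norm_mult norm_divide)
  have nez: "of_real s * ucirc t \<noteq> z" if "s = q \<or> s = 1 / q" for s t
    using that z q by (auto simp: norm_mult norm_divide)
  have cf: "continuous_on {0..1} (\<lambda>t. f (of_real s * ucirc t))" if "s = q \<or> s = 1 / q" for s
    by (rule continuous_on_compose2[OF holomorphic_on_imp_continuous_on[OF f]])
       (use an[OF that] in \<open>auto intro!: continuous_intros\<close>)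
  have split: "integral {0..1} (\<lambda>t. g (of_real s * ucirc t) * (of_real s * ucirc t)) =
     integral {0..1} (\<lambda>t. f (of_real s * ucirc t) * (of_real s * ucirc t) / (of_real s * ucirc t - z))
     - f z * integral {0..1} (\<lambda>t. (of_real s * ucirc t) / (of_real s * ucirc t - z))"
    if s: "s = q \<or> s = 1 / q" for s
  proof -
    have "integral {0..1} (\<lambda>t. g (of_real s * ucirc t) * (of_real s * ucirc t)) =
      integral {0..1} (\<lambda>t. f (of_real s * ucirc t) * (of_real s * ucirc t) / (of_real s * ucirc t - z)
         - f z * ((of_real s * ucirc t) / (of_real s * ucirc t - z)))"
      by (rule integral_cong) (use nez[OF s] in \<open>simp add: g_def left_diff_distrib diff_divide_distrib\<close>)
    also have "\<dots> = integral {0..1} (\<lambda>t. f (of_real s * ucirc t) * (of_real s * ucirc t) / (of_real s * ucirc t - z))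
         - integral {0..1} (\<lambda>t. f z * ((of_real s * ucirc t) / (of_real s * ucirc t - z)))"
      using nez[OF s] cf[OF s]
      by (intro Henstock_Kurzweil_Integration.integral_diff integrable_continuous_real continuous_intros) auto
    finally show ?thesis by (simp only: Henstock_Kurzweil_Integration.integral_mult_right)
  qed
  have outer: "integral {0..1} (\<lambda>t. (of_real (1/q) * ucirc t) / (of_real (1/q) * ucirc t - z)) = 1"
  proof -
    have "((\<lambda>u. 1 / (u - z)) has_contour_integral (2 * of_real pi * \<i> * 1)) (circlepath 0 (1/q))"
      using z by (intro Cauchy_integral_circlepath_simple[of "\<lambda>_. 1"]) auto
    then have "((\<lambda>t. 1 / (of_real (1/q) * ucirc t - z) * (2 * pi * \<i> * of_real (1/q) * ucirc t)) has_integral 2 * pi * \<i>) {0..1}"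
      unfolding has_contour_integral_circlepath_ucirc by simp
    from has_integral_mult_right[OF this, of "1 / (2 * pi * \<i>)"]
    have "((\<lambda>t. (of_real (1/q) * ucirc t) / (of_real (1/q) * ucirc t - z)) has_integral 1) {0..1}"
      by (simp add: mult_ac)
    then show ?thesis by (rule integral_unique)
  qed
  have inner: "integral {0..1} (\<lambda>t. (of_real q * ucirc t) / (of_real q * ucirc t - z)) = 0"
  proof -
    have "((\<lambda>u. 1 / (u - z)) has_contour_integral 0) (circlepath 0 q)"
    proof (rule Cauchy_theorem_disc_simple[of _ 0 "norm z"])
      show "(\<lambda>u. 1 / (u - z)) holomorphic_on ball 0 (norm z)" by (intro holomorphic_intros) auto
    qed (use q z in \<open>auto simp: path_image_circlepath\<close>)
    then have "((\<lambda>t. 1 / (of_real q * ucirc t - z) * (2 * pi * \<i> * of_real q * ucirc t)) has_integral 0) {0..1}"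
      unfolding has_contour_integral_circlepath_ucirc by simp
    from has_integral_mult_right[OF this, of "1 / (2 * pi * \<i>)"]
    have "((\<lambda>t. (of_real q * ucirc t) / (of_real q * ucirc t - z)) has_integral 0) {0..1}"
      by (simp add: mult_ac)
    then show ?thesis by (rule integral_unique)
  qed
  have "integral {0..1} (\<lambda>t. g (of_real (1/q) * ucirc t) * (of_real (1/q) * ucirc t)) = integral {0..1} (\<lambda>t. g (of_real q * ucirc t) * (of_real q * ucirc t))"
    using has_integral_circle_homotopic[OF V g q(1) _ _ q(2) sub, of "1/q"]
      has_integral_circle_homotopic[OF V g q(1) _ _ q(2) sub, of q] qq by simp
  then have "f z = integral {0..1} (\<lambda>t. f (of_real (1/q) * ucirc t) * (of_real (1/q) * ucirc t) / (of_real (1/q) * ucirc t - z))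
     - integral {0..1} (\<lambda>t. f (of_real q * ucirc t) * (of_real q * ucirc t) / (of_real q * ucirc t - z))"
    using split[of q] split[of "1/q"] inner outer by (simp only: simp_thms) (simp add: algebra_simps)
  also have "(\<lambda>t. f (of_real (1/q) * ucirc t) * (of_real (1/q) * ucirc t) / (of_real (1/q) * ucirc t - z)) =
     (\<lambda>t. f (of_real (1/q) * ucirc t) / (1 - z / (of_real (1/q) * ucirc t)))"
  proof
    fix t
    have "of_real (1/q) * ucirc t \<noteq> 0" using q by simp
    then show "f (of_real (1/q) * ucirc t) * (of_real (1/q) * ucirc t) / (of_real (1/q) * ucirc t - z) =
       f (of_real (1/q) * ucirc t) / (1 - z / (of_real (1/q) * ucirc t))"
      using nez[of "1/q" t] by (simp add: divide_simps del: of_real_divide)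
  qed
  finally show ?thesis .
qed

lemma has_sum_UNIV_int:
  fixes f :: "int \<Rightarrow> 'a :: topological_comm_monoid_add"
  assumes "((\<lambda>k. f (int k)) has_sum a) UNIV" "((\<lambda>k. f (- int (Suc k))) has_sum b) UNIV"
  shows "(f has_sum (a + b)) UNIV"
proof -
  have "(f has_sum (a + b)) (range int \<union> range (\<lambda>k. - int (Suc k)))"
    using assms by (intro has_sum_Un_disjoint) (auto simp: has_sum_reindex o_def inj_on_def)
  also have "range int \<union> range (\<lambda>m. - int (Suc m)) = UNIV"
  proof -
    have "x \<in> range int \<union> range (\<lambda>m. - int (Suc m))" for x
      by (cases x rule: int_cases) auto
    then show ?thesis by blast
  qed
  finally show ?thesis .
qed

lemma laurent_expansion:
  assumes V: "open V" and f: "f holomorphic_on V" and q: "0 < q" "q < 1"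
    and sub: "closed_annulus q \<subseteq> V" and bd: "\<And>z. z \<in> closed_annulus q \<Longrightarrow> norm (f z) \<le> M"
    and z: "q < norm z" "norm z < 1 / q"
  shows "((\<lambda>m. laurent_coeff f m * z powi m) has_sum f z) UNIV"
proof -
  have qq: "q \<le> 1 / q"  "0 < 1 / q" "z \<noteq> 0" using z q by auto
  have an: "of_real s * ucirc t \<in> closed_annulus q" if "s = q \<or> s = 1 / q" for s t
    using qq q that by (auto simp: closed_annulus_def norm_mult norm_divide)
  have cf: "continuous_on {0..1} (\<lambda>t. f (of_real s * ucirc t))" if "s = q \<or> s = 1 / q" for s
    by (rule continuous_on_compose2[OF holomorphic_on_imp_continuous_on[OF f]])
       (use an[OF that] sub in \<open>auto intro!: continuous_intros\<close>)
  \<comment> \<open>A common ratio for both expansions: |z / w| on the outer circle is q |z|, and |w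
    / z| on the inner circle is q / |z|.\<close>
  define \<theta> where "\<theta> = max (q * norm z) (q / norm z)"
  have "0 < norm z" using q z by linarith
  then have th: "0 \<le> \<theta>" "\<theta> < 1"
    using q z by (auto simp: \<theta>_def le_max_iff_disj pos_divide_less_eq field_simps)
  have M0: "0 \<le> M" using bd[OF an[of q 0]] by (meson norm_ge_zero order_trans)
  have nb: "norm (laurent_coeff f m * z powi m) \<le> M * \<theta> ^ nat \<bar>m\<bar>" for m
  proof -
    have "norm (laurent_coeff f m * z powi m) \<le> M * q ^ nat \<bar>m\<bar> * norm z powi m"
      unfolding norm_mult norm_power_int by (intro mult_right_mono norm_laurent_coeff_le[OF V f q sub bd]) auto
    also have "\<dots> = M * (q ^ nat \<bar>m\<bar> * norm z powi m)" by simp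
    also have "q ^ nat \<bar>m\<bar> * norm z powi m \<le> \<theta> ^ nat \<bar>m\<bar>"
    proof (cases "m \<ge> 0")
      case True
      then have "q ^ nat \<bar>m\<bar> * norm z powi m = (q * norm z) ^ nat \<bar>m\<bar>" by (simp add: power_int_def power_mult_distrib)
      also have "\<dots> \<le> \<theta> ^ nat \<bar>m\<bar>" using q by (intro power_mono) (auto simp: \<theta>_def)
      finally show ?thesis .
    next
      case False
      then have "q ^ nat \<bar>m\<bar> * norm z powi m = (q / norm z) ^ nat \<bar>m\<bar>" by (simp add: power_int_def power_divide field_simps)
      also have "\<dots> \<le> \<theta> ^ nat \<bar>m\<bar>" using q by (intro power_mono) (auto simp: \<theta>_def)
      finally show ?thesis .
    qed
    then have "M * (q ^ nat \<bar>m\<bar> * norm z powi m) \<le> M * \<theta> ^ nat \<bar>m\<bar>" using M0 by (intro mult_left_mono)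
    finally show ?thesis .
  qed
  have sg: "summable (\<lambda>n. M * \<theta> ^ n)" using th by (intro summable_mult summable_geometric) auto
  have pw1: "(z / w) ^ m = w powi (- int m) * z ^ m" for w :: complex and m
    by (simp only: power_int_minus power_int_of_nat power_mult_distrib power_inverse divide_inverse mult.commute)
  have pw2: "(w / z) * (w / z) ^ m = w powi (- (- int (Suc m))) * z powi (- int (Suc m))" for w :: complex and m
  proof -
    have "(w / z) * (w / z) ^ m = (w / z) ^ Suc m" by simp
    also have "\<dots> = w ^ Suc m * inverse (z ^ Suc m)" by (simp only: power_mult_distrib power_inverse divide_inverse)
    also have "\<dots> = w powi (- (- int (Suc m))) * z powi (- int (Suc m))"
      by (simp only: minus_minus power_int_minus power_int_of_nat)
    finally show ?thesis .
  qed
  define P where "P = integral {0..1} (\<lambda>t. f (of_real (1/q) * ucirc t) / (1 - z / (of_real (1/q) * ucirc t)))"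
  define Q where "Q = integral {0..1} (\<lambda>t. f (of_real q * ucirc t) * (of_real q * ucirc t) / (of_real q * ucirc t - z))"
  have "(\<lambda>m. integral {0..1} (\<lambda>t. f (of_real (1/q) * ucirc t) * (z / (of_real (1/q) * ucirc t)) ^ m)) sums P"
    unfolding P_def
    by (rule integral_geometric_sums[where \<theta> = \<theta> and M = M])
       (use q th bd an[of "1/q"] cf[of "1/q"] in \<open>auto intro!: continuous_intros simp: norm_divide norm_mult \<theta>_def mult.commute\<close>)
  moreover have "integral {0..1} (\<lambda>t. f (of_real (1/q) * ucirc t) * (z / (of_real (1/q) * ucirc t)) ^ m) = laurent_coeff f (int m) * z powi (int m)" for m
  proof -
    have "integral {0..1} (\<lambda>t. f (of_real (1/q) * ucirc t) * (z / (of_real (1/q) * ucirc t)) ^ m)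
      = integral {0..1} (\<lambda>t. f (of_real (1/q) * ucirc t) * (of_real (1/q) * ucirc t) powi (- int m) * z ^ m)"
      by (rule integral_cong) (simp only: pw1 mult.assoc)
    then show ?thesis using laurent_coeff_circle[OF V f q(1) _ _ q(2) sub, of "1/q" "int m"] qq by (simp del: of_real_divide)
  qed
  ultimately have "(\<lambda>m. laurent_coeff f (int m) * z powi (int m)) sums P" by simp
  then have h1: "((\<lambda>m. laurent_coeff f (int m) * z powi (int m)) has_sum P) UNIV"
    using nb[of "int _"] by (intro norm_summable_imp_has_sum summable_comparison_test'[OF sg, of 0]) auto
  \<comment> \<open>The extra factor w / z shifts the geometric series so that it starts at exponent
    -1, and its sum is the inner integral with the sign that Cauchy's formula requires.\<close>
  have "(\<lambda>m. integral {0..1} (\<lambda>t. f (of_real q * ucirc t) * (of_real q * ucirc t / z) * (of_real q * ucirc t / z) ^ m)) sums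
    integral {0..1} (\<lambda>t. f (of_real q * ucirc t) * (of_real q * ucirc t / z) / (1 - of_real q * ucirc t / z))"
  proof (rule integral_geometric_sums[where \<theta> = \<theta> and M = "M * \<theta>"])
    show "norm (f (of_real q * ucirc t) * (of_real q * ucirc t / z)) \<le> M * \<theta>" for t
      unfolding norm_mult[of "f _"] using M0 th q bd[OF an[of q t]]
      by (intro mult_mono) (auto simp: norm_divide norm_mult \<theta>_def)
  qed (use q qq th cf[of "q"] in \<open>auto intro!: continuous_intros simp: norm_divide norm_mult \<theta>_def\<close>)
  moreover have "integral {0..1} (\<lambda>t. f (of_real q * ucirc t) * (of_real q * ucirc t / z) / (1 - of_real q * ucirc t / z)) = - Q"
  proof -
    have "integral {0..1} (\<lambda>t. f (of_real q * ucirc t) * (of_real q * ucirc t / z) / (1 - of_real q * ucirc t / z))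
      = integral {0..1} (\<lambda>t. - (f (of_real q * ucirc t) * (of_real q * ucirc t) / (of_real q * ucirc t - z)))"
    proof (rule integral_cong)
      fix t :: real
      have "of_real q * ucirc t \<noteq> z" using z q by (auto simp: norm_mult)
      then show "f (of_real q * ucirc t) * (of_real q * ucirc t / z) / (1 - of_real q * ucirc t / z) =
        - (f (of_real q * ucirc t) * (of_real q * ucirc t) / (of_real q * ucirc t - z))"
        using qq(3) by (simp add: divide_simps) (simp add: algebra_simps)
    qed
    then show ?thesis by (simp add: Q_def)
  qed
  moreover have "integral {0..1} (\<lambda>t. f (of_real q * ucirc t) * (of_real q * ucirc t / z) * (of_real q * ucirc t / z) ^ m)
      = laurent_coeff f (- int (Suc m)) * z powi (- int (Suc m))" for m
  proof -
    have "integral {0..1} (\<lambda>t. f (of_real q * ucirc t) * (of_real q * ucirc t / z) * (of_real q * ucirc t / z) ^ m)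
      = integral {0..1} (\<lambda>t. f (of_real q * ucirc t) * (of_real q * ucirc t) powi (- (- int (Suc m))) * z powi (- int (Suc m)))"
      by (rule integral_cong) (simp only: pw2 mult.assoc)
    then show ?thesis using laurent_coeff_circle[OF V f q(1) _ _ q(2) sub, of "q" "- int (Suc m)"] qq by simp
  qed
  ultimately have "(\<lambda>m. laurent_coeff f (- int (Suc m)) * z powi (- int (Suc m))) sums (- Q)" by simp
  moreover have "summable (\<lambda>m. norm (laurent_coeff f (- int (Suc m)) * z powi (- int (Suc m))))"
  proof (rule summable_comparison_test'[of "\<lambda>m. M * \<theta> ^ Suc m" 0])
    show "summable (\<lambda>m. M * \<theta> ^ Suc m)" using sg by (subst summable_Suc_iff)
    show "norm (norm (laurent_coeff f (- int (Suc m)) * z powi (- int (Suc m)))) \<le> M * \<theta> ^ Suc m" for m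
      using nb[of "- int (Suc m)"] by (simp del: of_nat_Suc power_Suc)
  qed
  ultimately have "((\<lambda>m. laurent_coeff f (- int (Suc m)) * z powi (- int (Suc m))) has_sum (- Q)) UNIV"
    by (intro norm_summable_imp_has_sum)
  from has_sum_UNIV_int[OF h1 this] have "((\<lambda>m. laurent_coeff f m * z powi m) has_sum (P + - Q)) UNIV" .
  also have "P + - Q = f z"
    using annulus_cauchy_formula[OF V f q sub z] by (simp only: P_def Q_def diff_conv_add_uminus)
  finally show ?thesis .
qed

section \<open>Laurent series in several variables\<close>

definition zmon :: "complex list \<Rightarrow> int list \<Rightarrow> complex" where
  "zmon zs ms = prod_list (map2 (powi) zs ms)"

definition abssum :: "int list \<Rightarrow> nat" where
  "abssum ms = sum_list (map (\<lambda>m. nat \<bar>m\<bar>) ms)"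

lemma zmon_Nil [simp]: "zmon [] [] = 1"
  and zmon_Cons [simp]: "zmon (z # zs) (m # ms) = z powi m * zmon zs ms"
  by (simp_all add: zmon_def)

lemma abssum_Nil [simp]: "abssum [] = 0"
  and abssum_Cons [simp]: "abssum (m # ms) = nat \<bar>m\<bar> + abssum ms"
  by (simp_all add: abssum_def)

lemma abssum_cong_mset: "mset ms = mset ms' \<Longrightarrow> abssum ms = abssum ms'"
  unfolding abssum_def by (metis mset_map sum_mset_sum_list)

lemma zmon_permute_list:
  assumes "\<sigma> permutes {..<length ms}" "length zs = length ms"
  shows "zmon (permute_list \<sigma> zs) (permute_list \<sigma> ms) = zmon zs ms"
proof -
  have *: "zip (permute_list \<sigma> zs) (permute_list \<sigma> ms) = permute_list \<sigma> (zip zs ms)"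
    using assms by (intro permute_list_zip [symmetric]) auto
  have "mset (permute_list \<sigma> (zip zs ms)) = mset (zip zs ms)" using assms by (intro mset_permute_list) simp
  then show ?thesis unfolding zmon_def * by (metis mset_map prod_mset_prod_list)
qed

lemma summable_geometric_int:
  fixes s :: real
  assumes "0 \<le> s" "s < 1"
  shows "(\<lambda>m::int. s ^ nat \<bar>m\<bar>) summable_on UNIV"
proof -
  have "summable (\<lambda>k. s ^ k)" using assms by (intro summable_geometric) auto
  then have 1: "(\<lambda>k. s ^ k) summable_on UNIV" "(\<lambda>k. s ^ Suc k) summable_on UNIV"
    using assms by (auto intro!: norm_summable_imp_summable_on summable_mult)
  then have "((\<lambda>k. s ^ nat \<bar>int k\<bar>) has_sum infsum (\<lambda>k. s ^ k) UNIV) UNIV"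
     "((\<lambda>k. s ^ nat \<bar>- int (Suc k)\<bar>) has_sum infsum (\<lambda>k. s ^ Suc k) UNIV) UNIV"
    by (auto simp: nat_add_distrib simp del: power_Suc)
  from has_sum_UNIV_int[OF this] show ?thesis by (rule has_sum_imp_summable)
qed

lemma bij_betw_Cons_lists:
  "bij_betw (\<lambda>(a, m). a # m) (UNIV \<times> {m. length m = n}) {m. length m = Suc n}"
  by (rule bij_betwI[where g = "\<lambda>m. (hd m, tl m)"]) (auto simp: length_Suc_conv)

lemma summable_geometric_lists:
  fixes s :: real
  assumes "0 \<le> s" "s < 1"
  shows "(\<lambda>m. s ^ abssum m) summable_on {m. length m = n}"
proof (induction n)
  case 0
  have "{m :: int list. length m = 0} = {[]}" by auto
  then show ?case by simp
next
  case (Suc n)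
  define S where "S = infsum (\<lambda>m. s ^ abssum m) {m. length m = n}"
  have "(\<lambda>(a, m). s ^ abssum (a # m)) summable_on (SIGMA a:UNIV. {m. length m = n})"
  proof (rule summable_on_SigmaI)
    fix a :: int
    have "((\<lambda>m. s ^ nat \<bar>a\<bar> * s ^ abssum m) has_sum s ^ nat \<bar>a\<bar> * S) {m. length m = n}"
      unfolding S_def using Suc by (intro has_sum_cmult_right) simp
    then show "((\<lambda>m. case (a, m) of (a, m) \<Rightarrow> s ^ abssum (a # m)) has_sum s ^ nat \<bar>a\<bar> * S) {m. length m = n}"
      by (simp add: power_add)
  qed (use assms summable_geometric_int[OF assms] in \<open>auto intro: summable_on_cmult_left\<close>)
  then show ?case
    using summable_on_reindex_bij_betw[OF bij_betw_Cons_lists, of "\<lambda>m. s ^ abssum m" n]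
    by (simp add: case_prod_unfold)
qed

lemma norm_zmon_le:
  assumes "0 < r" "set zs \<subseteq> closed_annulus r" "length zs = length ms"
  shows "norm (zmon zs ms) \<le> (1 / r) ^ abssum ms"
  using assms(3,2)
proof (induction zs ms rule: list_induct2)
  case (Cons z zs m ms)
  have z: "r \<le> norm z" "norm z \<le> 1 / r" using Cons.prems by (auto simp: closed_annulus_def)
  have "norm (z powi m) \<le> (1 / r) ^ nat \<bar>m\<bar>"
  proof (cases "m \<ge> 0")
    case True
    then show ?thesis using z by (auto simp: power_int_def norm_power intro: power_mono)
  next
    case False
    have "inverse (norm z) \<le> 1 / r" using z assms(1) by (simp add: inverse_eq_divide frac_le)
    then show ?thesis using False assms(1) z
      by (auto simp: power_int_def norm_power norm_inverse simp flip: power_inverse intro!: power_mono)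
  qed
  then show ?case using Cons assms(1) by (auto simp: norm_mult power_add intro!: mult_mono)
qed simp

text \<open>Induction on the number of variables: the Laurent coefficients in the first variable are
  again separately holomorphic in the tail and smaller by q'^|a|, so the induction hypothesis
  applies with M * q'^|a|. The radius q' sits strictly between q, where F is bounded only on the
  open annulus, and r, where the iterated series must converge absolutely.\<close>

lemma has_sum_laurent_list:
  assumes q: "0 < q" "q < q'" "q' < r" "r < 1" and W: "W = {z. q < norm z \<and> norm z < 1 / q}"
    and hol: "sephol W n F" and M: "0 \<le> M"
    and bd: "\<And>w. length w = n \<Longrightarrow> set w \<subseteq> W \<Longrightarrow> norm (F w) \<le> M"
  shows "\<exists>c. (\<forall>m. length m = n \<longrightarrow> norm (c m) \<le> M * q' ^ abssum m) \<and>
     (\<forall>z. length z = n \<and> set z \<subseteq> closed_annulus r \<longrightarrow> ((\<lambda>m. c m * zmon z m) has_sum F z) {m. length m = n})"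
  using hol M bd
proof (induction n arbitrary: F M)
  case 0
  have "{m :: int list. length m = 0} = {[]}" by auto
  then show ?case using "0.prems"
    by (intro exI[of _ "\<lambda>_. F []"]) (auto intro!: has_sum_finiteI)
next
  case (Suc n)
  have oW: "open W"
  proof -
    have "W = ball 0 (1 / q) - cball 0 q" unfolding W by auto
    then show ?thesis by auto
  qed
  have q'1: "0 < q'" "q' < 1" "1 / q' < 1 / q" using q by (auto intro: divide_strict_left_mono)
  have sub: "closed_annulus q' \<subseteq> W" using q q'1 by (auto simp: closed_annulus_def W)
  have subr: "q' < norm z \<and> norm z < 1 / q'" if "z \<in> closed_annulus r" for z
  proof -
    have "1 / r < 1 / q'" using q by (auto intro: divide_strict_left_mono)
    then show ?thesis using that q by (auto simp: closed_annulus_def)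
  qed
  have uW: "ucirc t \<in> W" for t using q by (auto simp: W)
  define C where "C = (\<lambda>a w. laurent_coeff (\<lambda>z. F (z # w)) a)"
  have hh: "(\<lambda>z. F (z # w)) holomorphic_on W" if "length w = n" "set w \<subseteq> W" for w
    using sephol_head[OF Suc.prems(1) that] .
  have hC: "sephol W n (C a)" for a
    unfolding sephol_def C_def laurent_coeff_def
  proof (intro allI impI, rule holomorphic_parametric_integral[OF oW])
    fix xs ys t assume xy: "Suc (length xs + length ys) = n \<and> set xs \<subseteq> W \<and> set ys \<subseteq> W"
    have "(\<lambda>z. F ((ucirc t # xs) @ z # ys)) holomorphic_on W"
      using Suc.prems(1) xy uW unfolding sephol_def
      by (elim allE[of _ "ucirc t # xs"] allE[of _ ys]) auto
    then show "(\<lambda>z. F (ucirc t # xs @ z # ys) * ucirc t powi (- a)) holomorphic_on W"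
      by (intro holomorphic_intros) auto
  next
    fix xs ys z assume xy: "Suc (length xs + length ys) = n \<and> set xs \<subseteq> W \<and> set ys \<subseteq> W" and z: "z \<in> W"
    have "continuous_on {0..1} (\<lambda>t. F (ucirc t # xs @ z # ys))"
      by (rule continuous_on_compose2[OF holomorphic_on_imp_continuous_on[OF hh[of "xs @ z # ys"]]])
        (use xy z uW in \<open>auto intro: continuous_intros\<close>)
    then show "continuous_on {0..1} (\<lambda>t. F (ucirc t # xs @ z # ys) * ucirc t powi (- a))"
      by (intro continuous_intros) auto
  next
    fix xs ys z and t :: real assume xy: "Suc (length xs + length ys) = n \<and> set xs \<subseteq> W \<and> set ys \<subseteq> W" and z: "z \<in> W"
    have "norm (F (ucirc t # xs @ z # ys)) \<le> M" using xy z uW by (intro Suc.prems(3)) auto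
    then show "norm (F (ucirc t # xs @ z # ys) * ucirc t powi (- a)) \<le> M" by (simp add: norm_mult norm_power_int)
  qed
  have bC: "norm (C a w) \<le> M * q' ^ nat \<bar>a\<bar>" if "length w = n" "set w \<subseteq> W" for a w
    unfolding C_def using sub that by (intro norm_laurent_coeff_le[OF oW hh[OF that] q'1(1,2) sub] Suc.prems(3)) auto
  have "\<exists>c. (\<forall>m. length m = n \<longrightarrow> norm (c m) \<le> (M * q' ^ nat \<bar>a\<bar>) * q' ^ abssum m) \<and>
     (\<forall>z. length z = n \<and> set z \<subseteq> closed_annulus r \<longrightarrow> ((\<lambda>m. c m * zmon z m) has_sum C a z) {m. length m = n})" for a
    using q'1 Suc.prems(2) bC by (intro Suc.IH hC) auto
  then obtain D where D: "\<And>a m. length m = n \<Longrightarrow> norm (D a m) \<le> (M * q' ^ nat \<bar>a\<bar>) * q' ^ abssum m"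
    "\<And>a z. length z = n \<Longrightarrow> set z \<subseteq> closed_annulus r \<Longrightarrow> ((\<lambda>m. D a m * zmon z m) has_sum C a z) {m. length m = n}"
    by metis
  define c where "c = (\<lambda>m. D (hd m) (tl m))"
  have b: "norm (c m) \<le> M * q' ^ abssum m" if "length m = Suc n" for m
    using that D(1)[of "tl m" "hd m"] by (auto simp: c_def length_Suc_conv power_add mult_ac)
  have "((\<lambda>m. c m * zmon z m) has_sum F z) {m. length m = Suc n}"
    if zz: "length z = Suc n" "set z \<subseteq> closed_annulus r" for z
  proof -
    obtain y w where z: "z = y # w" "length w = n" using zz(1) by (auto simp: length_Suc_conv)
    have y: "y \<in> closed_annulus r" and w: "set w \<subseteq> closed_annulus r" using zz z by auto
    have rW: "closed_annulus r \<subseteq> W"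
    proof
      fix y assume "y \<in> closed_annulus r"
      from subr[OF this] show "y \<in> W" using q(2) q'1(3) by (simp add: W)
    qed
    define f where "f = (\<lambda>(a, m). c (a # m) * zmon z (a # m))"
    have "(f has_sum F z) (SIGMA a:UNIV. {m. length m = n})"
    proof (rule has_sum_SigmaI)
      fix a :: int
      have "((\<lambda>m. y powi a * (D a m * zmon w m)) has_sum y powi a * C a w) {m. length m = n}"
        by (intro has_sum_cmult_right D(2) z w)
      then show "((\<lambda>m. f (a, m)) has_sum C a w * y powi a) {m. length m = n}"
        by (simp add: f_def z c_def mult_ac)
    next
      show "((\<lambda>a. C a w * y powi a) has_sum F z) UNIV"
        unfolding C_def z(1)
        using subr[OF y] z w rW sub
        by (intro laurent_expansion[OF oW hh q'1(1,2) sub, where M = M] Suc.prems(3)) auto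
    next
      have S: "(\<lambda>m. M * (q' / r) ^ abssum m) summable_on {m. length m = Suc n}"
        using q by (intro summable_on_cmult_right summable_geometric_lists) auto
      have "(\<lambda>m. c m * zmon z m) summable_on {m. length m = Suc n}"
      proof (rule abs_summable_summable, rule Infinite_Sum.abs_summable_on_comparison_test'[OF S])
        fix m :: "int list" assume "m \<in> {m. length m = Suc n}"
        then have m: "length m = Suc n" by simp
        have "norm (c m * zmon z m) \<le> (M * q' ^ abssum m) * (1 / r) ^ abssum m"
          unfolding norm_mult using q q'1 zz m Suc.prems(2)
          by (intro mult_mono b norm_zmon_le) auto
        then show "norm (c m * zmon z m) \<le> M * (q' / r) ^ abssum m"
          by (simp add: power_divide)
      qed
      then show "f summable_on (SIGMA a:UNIV. {m. length m = n})"
        using summable_on_reindex_bij_betw[OF bij_betw_Cons_lists, of "\<lambda>m. c m * zmon z m" n]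
        by (simp add: case_prod_unfold f_def)
    qed
    then show ?thesis
      using has_sum_reindex_bij_betw[OF bij_betw_Cons_lists, of "\<lambda>m. c m * zmon z m" n]
      by (simp add: case_prod_unfold f_def)
  qed
  then show ?case using b by blast
qed

lemma closed_annulus_enlarge:
  assumes r: "0 < r" "r < 1" and V: "open V" "closed_annulus r \<subseteq> V"
  shows "\<exists>q. 0 < q \<and> q < r \<and> closed_annulus q \<subseteq> V"
proof -
  have "closed_annulus r = cball 0 (1 / r) - ball 0 r" by (auto simp: closed_annulus_def)
  then have "compact (closed_annulus r)" by (simp add: compact_diff)
  then obtain e where e: "0 < e" "(\<Union>x\<in>closed_annulus r. cball x e) \<subseteq> V"
    using compact_subset_open_imp_cball_epsilon_subset[OF _ V] by blast
  \<comment> \<open>The inner radius shrinks by at most e and the outer radius grows by at most e,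
    so each point is within e of its radial projection to the old annulus.\<close>
  define q where "q = max (r - e) (1 / (1 / r + e))"
  have pos: "0 < 1 / r + e" using r e by (simp add: add_pos_pos)
  have q: "0 < q" "q < r"
    using r e pos by (auto simp: q_def less_max_iff_disj field_simps)
  have rr: "r < 1 / r" using r by (metis less_divide_eq_1_pos less_trans)
  have qe: "r - q \<le> e" "1 / q \<le> 1 / r + e"
  proof -
    show "r - q \<le> e" by (simp add: q_def)
    have "1 / (1 / r + e) \<le> q" by (simp add: q_def)
    then have "1 / q \<le> 1 / (1 / (1 / r + e))" using pos q by (intro divide_left_mono) auto
    then show "1 / q \<le> 1 / r + e" by simp
  qed
  have "z \<in> V" if z: "z \<in> closed_annulus q" for z
  proof -
    have nz: "0 < norm z" using z q by (auto simp: closed_annulus_def intro: less_le_trans)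
    define s where "s = (if norm z < r then r else if norm z > 1 / r then 1 / r else norm z)"
    define x where "x = of_real (s / norm z) * z"
    have s: "r \<le> s" "s \<le> 1 / r" "\<bar>s - norm z\<bar> \<le> e"
      using z rr qe e by (auto simp: s_def closed_annulus_def)
    have "norm x = s" using nz s r by (simp add: x_def norm_mult norm_divide)
    then have x: "x \<in> closed_annulus r" using s by (simp add: closed_annulus_def)
    have "x - z = of_real ((s - norm z) / norm z) * z" using nz by (simp add: x_def field_simps)
    then have "norm (x - z) = \<bar>(s - norm z) / norm z\<bar> * norm z" by (simp only: norm_mult norm_of_real)
    also have "\<dots> \<le> e" using s nz by simp
    finally have "z \<in> cball x e" by (simp add: dist_norm)
    then show "z \<in> V" using e x by blast
  qed
  then show ?thesis using q by blast
qed

lemma has_sum_finite_sum: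
  fixes f :: "'a \<Rightarrow> 'b \<Rightarrow> 'c :: topological_comm_monoid_add"
  assumes "finite S" "\<And>s. s \<in> S \<Longrightarrow> (f s has_sum g s) A"
  shows "((\<lambda>x. \<Sum>s\<in>S. f s x) has_sum (\<Sum>s\<in>S. g s)) A"
  using assms by (induction S rule: finite_induct) (auto intro: has_sum_add)

text \<open>Hartogs provides the bound on a slightly larger annulus, hence decay with some q < r.
  Symmetry of the coefficients is obtained by averaging over permutations of the index, which
  preserves the bound, and also the sum because F is symmetric.\<close>

theorem symmetric_laurent_expansion:
  assumes r: "0 < r" "r < 1" and V: "open V" "closed_annulus r \<subseteq> V" and hol: "sephol V n F"
    and sym: "\<And>xs ys. length xs = n \<Longrightarrow> mset xs = mset ys \<Longrightarrow> F xs = F ys"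
  shows "\<exists>q M c. 0 < q \<and> q < r \<and> 0 \<le> M \<and>
     (\<forall>m. length m = n \<longrightarrow> norm (c m) \<le> M * q ^ abssum m) \<and>
     (\<forall>m m'. length m = n \<and> mset m = mset m' \<longrightarrow> c m = c m') \<and>
     (\<forall>z. length z = n \<and> set z \<subseteq> closed_annulus r \<longrightarrow> ((\<lambda>m. c m * zmon z m) has_sum F z) {m. length m = n})"
proof -
  obtain p where p: "0 < p" "p < r" "closed_annulus p \<subseteq> V"
    using closed_annulus_enlarge[OF r V] by blast
  have "closed_annulus p = cball 0 (1 / p) - ball 0 p" by (auto simp: closed_annulus_def)
  then have "compact (closed_annulus p)" by (simp add: compact_diff)
  from hartogs_bounded[OF V(1) hol this p(3)]
  obtain M0 where M0: "\<And>w. length w = n \<Longrightarrow> set w \<subseteq> closed_annulus p \<Longrightarrow> norm (F w) \<le> M0" by blast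
  define M where "M = max 0 M0"
  define W where "W = {z :: complex. p < norm z \<and> norm z < 1 / p}"
  have Wp: "W \<subseteq> closed_annulus p" by (auto simp: W_def closed_annulus_def)
  define q where "q = (p + r) / 2"
  have q: "p < q" "q < r" "0 < q" using p by (auto simp: q_def)
  have "\<exists>c. (\<forall>m. length m = n \<longrightarrow> norm (c m) \<le> M * q ^ abssum m) \<and>
     (\<forall>z. length z = n \<and> set z \<subseteq> closed_annulus r \<longrightarrow> ((\<lambda>m. c m * zmon z m) has_sum F z) {m. length m = n})"
  proof (rule has_sum_laurent_list[OF p(1) q(1,2) r(2) W_def])
    show "sephol W n F" by (rule sephol_subset[OF hol order_trans[OF Wp p(3)]])
    show "norm (F w) \<le> M" if "length w = n" "set w \<subseteq> W" for w
      using M0[OF that(1) order_trans[OF that(2) Wp]] by (simp add: M_def)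
  qed (auto simp: M_def)
  then obtain c where c: "\<And>m. length m = n \<Longrightarrow> norm (c m) \<le> M * q ^ abssum m"
     "\<And>z. length z = n \<Longrightarrow> set z \<subseteq> closed_annulus r \<Longrightarrow> ((\<lambda>m. c m * zmon z m) has_sum F z) {m. length m = n}"
    by blast
  define S where "S = {\<sigma>. \<sigma> permutes {..<n}}"
  have fS: "finite S" and cS: "card S = fact n"
    by (auto simp: S_def finite_permutations card_permutations)
  define d where "d = (\<lambda>m. (\<Sum>\<sigma>\<in>S. c (permute_list \<sigma> m)) / fact n)"
  have bd: "norm (d m) \<le> M * q ^ abssum m" if m: "length m = n" for m
  proof -
    have "norm (\<Sum>\<sigma>\<in>S. c (permute_list \<sigma> m)) \<le> (\<Sum>\<sigma>\<in>S. M * q ^ abssum m)"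
    proof (intro sum_norm_le)
      fix \<sigma> assume "\<sigma> \<in> S"
      then have "mset (permute_list \<sigma> m) = mset m" using m by (intro mset_permute_list) (auto simp: S_def)
      from abssum_cong_mset[OF this] show "norm (c (permute_list \<sigma> m)) \<le> M * q ^ abssum m"
        using c(1)[of "permute_list \<sigma> m"] m by simp
    qed
    also have "\<dots> = fact n * (M * q ^ abssum m)" by (simp add: cS)
    finally show ?thesis by (simp add: d_def norm_divide divide_le_eq mult.commute)
  qed
  have sd: "d m = d m'" if m: "length m = n" "mset m = mset m'" for m m'
  proof -
    have lm': "length m' = n" using m by (metis size_mset)
    obtain \<tau> where t: "\<tau> permutes {..<length m'}" "permute_list \<tau> m' = m" using mset_eq_permutation[OF m(2)] .
    have e1: "(\<Sum>\<sigma>\<in>S. c (permute_list \<sigma> m)) = (\<Sum>\<sigma>\<in>S. c (permute_list (\<tau> \<circ> \<sigma>) m'))"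
    proof (rule sum.cong)
      fix \<sigma> assume "\<sigma> \<in> S"
      then show "c (permute_list \<sigma> m) = c (permute_list (\<tau> \<circ> \<sigma>) m')"
        using permute_list_compose[of \<sigma> m' \<tau>] lm' t by (simp add: S_def)
    qed simp
    have e2: "(\<Sum>\<sigma>\<in>S. c (permute_list (\<tau> \<circ> \<sigma>) m')) = (\<Sum>\<sigma>\<in>S. c (permute_list \<sigma> m'))"
    proof (rule sum.reindex_bij_witness[of _ "\<lambda>\<sigma>. inv_into UNIV \<tau> \<circ> \<sigma>" "\<lambda>\<sigma>. \<tau> \<circ> \<sigma>"])
      note tn = t(1)[unfolded lm']
      fix \<sigma> assume s: "\<sigma> \<in> S"
      show "inv_into UNIV \<tau> \<circ> (\<tau> \<circ> \<sigma>) = \<sigma>" unfolding o_assoc permutes_inv_o(2)[OF tn] by simp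
      show "\<tau> \<circ> (inv_into UNIV \<tau> \<circ> \<sigma>) = \<sigma>" unfolding o_assoc permutes_inv_o(1)[OF tn] by simp
      show "\<tau> \<circ> \<sigma> \<in> S" using s permutes_compose[OF _ tn] by (simp add: S_def)
      show "inv_into UNIV \<tau> \<circ> \<sigma> \<in> S" using s permutes_compose[OF _ permutes_inv[OF tn]] by (simp add: S_def)
    qed (rule refl)
    show ?thesis unfolding d_def e1 e2 ..
  qed
  have hs: "((\<lambda>m. d m * zmon z m) has_sum F z) {m. length m = n}" if z: "length z = n" "set z \<subseteq> closed_annulus r" for z
  proof -
    have one: "((\<lambda>m. c (permute_list \<sigma> m) * zmon z m) has_sum F z) {m. length m = n}" if s: "\<sigma> \<in> S" for \<sigma>
    proof -
      have sp: "\<sigma> permutes {..<n}" using s by (simp add: S_def)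
      have bij: "bij_betw (permute_list \<sigma>) {m :: int list. length m = n} {m. length m = n}"
      proof (rule bij_betwI[where g = "permute_list (inv_into UNIV \<sigma>)"])
        fix m :: "int list" assume "m \<in> {m. length m = n}"
        then have m: "length m = n" by simp
        show "permute_list (inv_into UNIV \<sigma>) (permute_list \<sigma> m) = m"
          using permute_list_compose[of "inv_into UNIV \<sigma>" m \<sigma>] sp m by (simp add: permutes_inv permutes_inv_o)
        show "permute_list \<sigma> (permute_list (inv_into UNIV \<sigma>) m) = m"
          using permute_list_compose[of \<sigma> m "inv_into UNIV \<sigma>"] sp m by (simp add: permutes_inv permutes_inv_o)
      qed auto
      have ms: "mset (permute_list \<sigma> z) = mset z" using sp z by (intro mset_permute_list) simp
      have "((\<lambda>m. c m * zmon (permute_list \<sigma> z) m) has_sum F (permute_list \<sigma> z)) {m. length m = n}"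
        using z mset_eq_setD[OF ms] by (intro c(2)) auto
      then have "((\<lambda>m. c (permute_list \<sigma> m) * zmon (permute_list \<sigma> z) (permute_list \<sigma> m)) has_sum F (permute_list \<sigma> z)) {m. length m = n}"
        using has_sum_reindex_bij_betw[OF bij, of "\<lambda>m. c m * zmon (permute_list \<sigma> z) m"] by simp
      moreover have "F (permute_list \<sigma> z) = F z" using sym[of "permute_list \<sigma> z" z] ms z by simp
      ultimately show ?thesis
        using sp z by (subst has_sum_cong[where g = "\<lambda>m. c (permute_list \<sigma> m) * zmon (permute_list \<sigma> z) (permute_list \<sigma> m)"])
          (auto simp: zmon_permute_list)
    qed
    have "((\<lambda>m. \<Sum>\<sigma>\<in>S. c (permute_list \<sigma> m) * zmon z m) has_sum (\<Sum>\<sigma>\<in>S. F z)) {m. length m = n}"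
      using one fS by (intro has_sum_finite_sum) auto
    then have "((\<lambda>m. (1 / fact n) * (\<Sum>\<sigma>\<in>S. c (permute_list \<sigma> m) * zmon z m)) has_sum (1 / fact n) * (\<Sum>\<sigma>\<in>S. F z)) {m. length m = n}"
      by (rule has_sum_cmult_right)
    then show ?thesis by (simp add: cS d_def sum_distrib_right)
  qed
  show ?thesis
  proof (intro exI conjI allI impI)
    show "0 \<le> M" by (simp add: M_def)
    show "d m = d m'" if "length m = n \<and> mset m = mset m'" for m m' using that sd by blast
    show "((\<lambda>m. d m * zmon z m) has_sum F z) {m. length m = n}"
      if "length z = n \<and> set z \<subseteq> closed_annulus r" for z using that hs by blast
  qed (use q bd in auto)
qed

section \<open>Haar measure and the loop equations\<close>

lemma index_mat_adjoint:
  "i < dim_col A \<Longrightarrow> j < dim_row A \<Longrightarrow> mat_adjoint A $$ (i, j) = conjugate (A $$ (j, i))"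
  unfolding mat_adjoint_def by (simp add: mat_of_rows_index)

lemma index_mult_mat_sum:
  assumes "A \<in> carrier_mat N N" "B \<in> carrier_mat N N" "i < N" "j < N"
  shows "(A * B) $$ (i, j) = (\<Sum>l<N. A $$ (i, l) * B $$ (l, j))"
  using assms by (auto simp: scalar_prod_def atLeast0LessThan)

lemma mat_adjoint_carrier: "A \<in> carrier_mat N N \<Longrightarrow> mat_adjoint A \<in> carrier_mat N N"
  by (auto simp: mat_adjoint_def)

lemma unitary_group_iff:
  "g \<in> unitary_group N \<longleftrightarrow> g \<in> carrier_mat N N \<and>
     (\<forall>i<N. \<forall>j<N. (\<Sum>l<N. cnj (g $$ (l, i)) * g $$ (l, j)) = (if i = j then 1 else 0))"
proof (cases "g \<in> carrier_mat N N")
  case True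
  note c = mat_adjoint_carrier[OF True]
  have e: "(mat_adjoint g * g) $$ (i, j) = (\<Sum>l<N. cnj (g $$ (l, i)) * g $$ (l, j))" if "i < N" "j < N" for i j
    using that True unfolding index_mult_mat_sum[OF c True that]
    by (intro sum.cong refl) (simp add: index_mat_adjoint)
  show ?thesis
    using True c e by (auto simp: unitary_group_def mat_eq_iff)
qed (auto simp: unitary_group_def)

lemma unitary_group_rows:
  assumes g: "g \<in> unitary_group N" and ij: "i < N" "j < N"
  shows "(\<Sum>l<N. g $$ (i, l) * cnj (g $$ (j, l))) = (if i = j then 1 else 0)"
proof -
  have gc: "g \<in> carrier_mat N N" and u: "mat_adjoint g * g = 1\<^sub>m N" using g by (auto simp: unitary_group_def)
  have "g * mat_adjoint g = 1\<^sub>m N"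
    using mat_mult_left_right_inverse[OF mat_adjoint_carrier[OF gc] gc u] .
  moreover have "(g * mat_adjoint g) $$ (i, j) = (\<Sum>l<N. g $$ (i, l) * cnj (g $$ (j, l)))"
    using gc ij unfolding index_mult_mat_sum[OF gc mat_adjoint_carrier[OF gc] ij]
    by (intro sum.cong refl) (simp add: index_mat_adjoint)
  ultimately show ?thesis using ij by simp
qed

lemma unitary_group_mult:
  assumes "g \<in> unitary_group N" "h \<in> unitary_group N"
  shows "g * h \<in> unitary_group N"
proof -
  have c: "g \<in> carrier_mat N N" "h \<in> carrier_mat N N" using assms by (auto simp: unitary_group_def)
  have "(\<Sum>l<N. cnj ((g * h) $$ (l, i)) * (g * h) $$ (l, j)) = (if i = j then 1 else 0)" if ij: "i < N" "j < N" for i j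
  proof -
    have "(\<Sum>l<N. cnj ((g * h) $$ (l, i)) * (g * h) $$ (l, j)) =
      (\<Sum>l<N. (\<Sum>a<N. cnj (g $$ (l, a)) * cnj (h $$ (a, i))) * (\<Sum>b<N. g $$ (l, b) * h $$ (b, j)))"
      by (intro sum.cong refl) (simp add: index_mult_mat_sum[OF c] ij del: index_mult_mat)
    also have "\<dots> = (\<Sum>l<N. \<Sum>a<N. \<Sum>b<N. cnj (h $$ (a, i)) * h $$ (b, j) * (cnj (g $$ (l, a)) * g $$ (l, b)))"
      unfolding sum_product by (simp only: mult_ac)
    also have "\<dots> = (\<Sum>a<N. \<Sum>l<N. \<Sum>b<N. cnj (h $$ (a, i)) * h $$ (b, j) * (cnj (g $$ (l, a)) * g $$ (l, b)))"
      by (rule sum.swap)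
    also have "\<dots> = (\<Sum>a<N. \<Sum>b<N. \<Sum>l<N. cnj (h $$ (a, i)) * h $$ (b, j) * (cnj (g $$ (l, a)) * g $$ (l, b)))"
      by (intro sum.cong refl sum.swap)
    also have "\<dots> = (\<Sum>a<N. \<Sum>b<N. cnj (h $$ (a, i)) * h $$ (b, j) * (if a = b then 1 else 0))"
      using assms(1) by (intro sum.cong refl) (simp add: unitary_group_iff flip: sum_distrib_left)
    also have "\<dots> = (\<Sum>a<N. cnj (h $$ (a, i)) * h $$ (a, j))"
      by (intro sum.cong refl) (simp add: if_distrib[of "\<lambda>x. _ * x"] sum.delta cong: if_cong)
    also have "\<dots> = (if i = j then 1 else 0)" using assms(2) ij by (simp add: unitary_group_iff)
    finally show ?thesis .
  qed
  then show ?thesis using c by (auto simp: unitary_group_iff simp del: index_mult_mat)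
qed

lemma norm_unitary_entry_le:
  assumes "g \<in> unitary_group N" "i < N" "j < N"
  shows "norm (g $$ (i, j)) \<le> 1"
proof -
  have "of_real (\<Sum>l<N. (norm (g $$ (l, j)))\<^sup>2) = (\<Sum>l<N. cnj (g $$ (l, j)) * g $$ (l, j))"
    unfolding of_real_sum by (intro sum.cong refl) (metis complex_norm_square mult.commute)
  also have "\<dots> = of_real 1" using assms by (simp add: unitary_group_iff)
  finally have "(\<Sum>l<N. (norm (g $$ (l, j)))\<^sup>2) = 1" by (simp only: of_real_eq_iff)
  moreover have "(norm (g $$ (i, j)))\<^sup>2 \<le> (\<Sum>l<N. (norm (g $$ (l, j)))\<^sup>2)"
    using assms by (intro member_le_sum) auto
  ultimately show ?thesis by (simp add: abs_square_le_1)
qed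

text \<open>The one-parameter group generated by \<open>\<i>\<close> times the rank-one Hermitian matrix \<open>w w\<^sup>*\<close>.
  (Division by zero makes it trivial when \<open>w = 0\<close>.)\<close>

definition rank1_coeff :: "nat \<Rightarrow> (nat \<Rightarrow> complex) \<Rightarrow> real \<Rightarrow> complex" where
  "rank1_coeff N w e = (let s = (\<Sum>i<N. (norm (w i))\<^sup>2) in (cis (e * s) - 1) / of_real s)"

definition rank1_flow :: "nat \<Rightarrow> (nat \<Rightarrow> complex) \<Rightarrow> real \<Rightarrow> complex mat" where
  "rank1_flow N w e = mat N N (\<lambda>(i, j). (if i = j then 1 else 0) + rank1_coeff N w e * w i * cnj (w j))"

text \<open>This is unitarity of 1 + c P, where P = w w^H satisfies P P = s P: the coefficient of P
  in (1 + c P)^H (1 + c P) has to vanish.\<close>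

lemma rank1_coeff_identity:
  fixes w N e
  defines "s \<equiv> (\<Sum>i<N. (norm (w i))\<^sup>2)" and "c \<equiv> rank1_coeff N w e"
  shows "c + cnj c + c * cnj c * of_real s = 0"
proof (cases "s = 0")
  case True
  then show ?thesis by (simp add: c_def rank1_coeff_def s_def[symmetric])
next
  case False
  have c: "c = (cis (e * s) - 1) / of_real s" by (simp add: c_def rank1_coeff_def s_def Let_def)
  have u: "cis (e * s) * cnj (cis (e * s)) = 1" by (simp add: cis_cnj cis_mult)
  have "c + cnj c + c * cnj c * of_real s = (cis (e * s) * cnj (cis (e * s)) - 1) / of_real s"
    using False unfolding c by (simp add: field_simps)
  then show ?thesis by (simp only: u) simp
qed

lemma rank1_coeff_approx:
  "norm (rank1_coeff N w e - \<i> * of_real e) \<le> (\<Sum>i<N. (norm (w i))\<^sup>2) * e\<^sup>2" if "(\<Sum>i<N. (norm (w i))\<^sup>2) \<noteq> 0"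
proof -
  define s where "s = (\<Sum>i<N. (norm (w i))\<^sup>2)"
  have s: "s > 0" using that sum_nonneg[of "{..<N}" "\<lambda>i. (norm (w i))\<^sup>2"] by (simp add: s_def less_le)
  have "cmod (iexp (e * s) - (\<Sum>k\<le>1. (\<i> * of_real (e * s)) ^ k / fact k)) \<le> \<bar>e * s\<bar> ^ Suc 1 / fact (Suc 1)"
    by (rule iexp_approx1)
  then have "cmod (cis (e * s) - 1 - \<i> * of_real (e * s)) \<le> (e * s)\<^sup>2 / 2"
    by (simp add: cis_conv_exp power2_eq_square diff_diff_eq)
  also have "\<dots> \<le> (e * s)\<^sup>2" by simp
  finally have b: "cmod (cis (e * s) - 1 - \<i> * of_real (e * s)) \<le> (e * s)\<^sup>2" .
  have "rank1_coeff N w e - \<i> * of_real e = (cis (e * s) - 1 - \<i> * of_real (e * s)) / of_real s"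
    using s by (simp add: rank1_coeff_def Let_def field_simps flip: s_def)
  then have "norm (rank1_coeff N w e - \<i> * of_real e) = cmod (cis (e * s) - 1 - \<i> * of_real (e * s)) / s"
    using s by (simp add: norm_divide)
  also have "\<dots> \<le> (e * s)\<^sup>2 / s" using s b by (intro divide_right_mono) auto
  also have "\<dots> = s * e\<^sup>2" using s by (simp add: power2_eq_square)
  finally show ?thesis by (simp add: s_def)
qed

lemma rank1_flow_carrier: "rank1_flow N w e \<in> carrier_mat N N"
  by (simp add: rank1_flow_def)

lemma rank1_flow_unitary: "rank1_flow N w e \<in> unitary_group N"
proof -
  define c where "c = rank1_coeff N w e"
  define s where "s = (\<Sum>i<N. (norm (w i))\<^sup>2)"
  have "(\<Sum>l<N. cnj (rank1_flow N w e $$ (l, i)) * rank1_flow N w e $$ (l, j)) = (if i = j then 1 else 0)"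
    if ij: "i < N" "j < N" for i j
  proof -
    have ss: "(\<Sum>l<N. cnj (w l) * w l) = of_real s"
      unfolding s_def of_real_sum by (intro sum.cong refl) (metis complex_norm_square mult.commute)
    have "(\<Sum>l<N. cnj (rank1_flow N w e $$ (l, i)) * rank1_flow N w e $$ (l, j)) =
      (\<Sum>l<N. (if l = i then (if i = j then 1 else 0) else 0) + (if l = i then c * w i * cnj (w j) else 0)
        + (if l = j then cnj c * cnj (w j) * w i else 0) + c * cnj c * w i * cnj (w j) * (cnj (w l) * w l))"
      using ij by (intro sum.cong refl) (auto simp: rank1_flow_def c_def[symmetric] algebra_simps)
    also have "\<dots> = (if i = j then 1 else 0) + c * w i * cnj (w j) + cnj c * cnj (w j) * w i
       + c * cnj c * w i * cnj (w j) * of_real s"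
      unfolding sum.distrib using ij by (simp add: ss flip: sum_distrib_left)
    also have "\<dots> = (if i = j then 1 else 0) + w i * cnj (w j) * (c + cnj c + c * cnj c * of_real s)"
      by (simp add: algebra_simps)
    also have "c + cnj c + c * cnj c * of_real s = 0" unfolding c_def s_def by (rule rank1_coeff_identity)
    finally show ?thesis by simp
  qed
  then show ?thesis by (simp add: unitary_group_iff rank1_flow_carrier)
qed

lemma rank1_flow_mult:
  assumes g: "g \<in> carrier_mat N N" and ij: "i < N" "j < N"
  shows "(rank1_flow N w e * g) $$ (i, j) = g $$ (i, j) + rank1_coeff N w e * (\<Sum>l<N. w i * cnj (w l) * g $$ (l, j))"
proof -
  have "(rank1_flow N w e * g) $$ (i, j) = (\<Sum>l<N. rank1_flow N w e $$ (i, l) * g $$ (l, j))"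
    by (rule index_mult_mat_sum[OF rank1_flow_carrier g ij])
  also have "\<dots> = (\<Sum>l<N. (if l = i then g $$ (i, j) else 0) + rank1_coeff N w e * (w i * cnj (w l) * g $$ (l, j)))"
    using ij by (intro sum.cong refl) (auto simp: rank1_flow_def algebra_simps)
  also have "\<dots> = g $$ (i, j) + rank1_coeff N w e * (\<Sum>l<N. w i * cnj (w l) * g $$ (l, j))"
    unfolding sum.distrib using ij by (simp add: sum_distrib_left)
  finally show ?thesis .
qed

section \<open>Invariance of the Haar measure and differentiation\<close>

locale haar_measure =
  fixes N :: nat and M :: "complex mat measure"
  assumes haar: "normalized_haar N M"
begin

sublocale prob_space M
  using haar by (simp add: normalized_haar_def)

lemma space_M: "space M = unitary_group N"
  and sets_M: "sets M = sets (unitary_borel N)"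
  and invariant: "g \<in> unitary_group N \<Longrightarrow> distr M M (\<lambda>x. g * x) = M"
  using haar by (auto simp: normalized_haar_def)

lemma generators_Pow:
  "{{g \<in> unitary_group N. g $$ (i, j) \<in> B} | i j B. i < N \<and> j < N \<and> B \<in> sets (borel :: complex measure)} \<subseteq> Pow (unitary_group N)"
  by auto

lemma measurable_entry:
  assumes "i < N" "j < N"
  shows "(\<lambda>g. g $$ (i, j)) \<in> borel_measurable M"
proof (rule measurableI)
  fix B :: "complex set" assume B: "B \<in> sets borel"
  have "{g \<in> unitary_group N. g $$ (i, j) \<in> B} \<in> sets (unitary_borel N)"
    unfolding unitary_borel_def sets_measure_of[OF generators_Pow] using assms B by (intro sigma_sets.Basic) blast
  moreover have "(\<lambda>g. g $$ (i, j)) -` B \<inter> space M = {g \<in> unitary_group N. g $$ (i, j) \<in> B}"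
    by (auto simp: space_M)
  ultimately show "(\<lambda>g. g $$ (i, j)) -` B \<inter> space M \<in> sets M" by (simp add: sets_M)
qed simp

lemma measurable_translate:
  assumes h: "h \<in> unitary_group N"
  shows "(\<lambda>x. h * x) \<in> measurable M M"
proof -
  have "(\<lambda>x. h * x) \<in> measurable M (unitary_borel N)"
    unfolding unitary_borel_def
  proof (rule measurable_measure_of[OF generators_Pow])
    show "(\<lambda>x. h * x) \<in> space M \<rightarrow> unitary_group N" using unitary_group_mult[OF h] by (auto simp: space_M)
    fix y assume "y \<in> {{g \<in> unitary_group N. g $$ (i, j) \<in> B} | i j B. i < N \<and> j < N \<and> B \<in> sets (borel :: complex measure)}"
    then obtain i j and B :: "complex set" where y: "y = {g \<in> unitary_group N. g $$ (i, j) \<in> B}" "i < N" "j < N" "B \<in> sets borel"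
      by blast
    have "(\<lambda>x. \<Sum>l<N. h $$ (i, l) * x $$ (l, j)) \<in> borel_measurable M"
      using y by (intro borel_measurable_sum borel_measurable_times borel_measurable_const measurable_entry) auto
    then have "(\<lambda>x. \<Sum>l<N. h $$ (i, l) * x $$ (l, j)) -` B \<inter> space M \<in> sets M"
      using y(4) by (rule measurable_sets)
    moreover have "(\<lambda>x. h * x) -` y \<inter> space M = (\<lambda>x. \<Sum>l<N. h $$ (i, l) * x $$ (l, j)) -` B \<inter> space M"
    proof -
      have "h * x \<in> y \<longleftrightarrow> (\<Sum>l<N. h $$ (i, l) * x $$ (l, j)) \<in> B" if x: "x \<in> unitary_group N" for x
      proof -
        have "(h * x) $$ (i, j) = (\<Sum>l<N. h $$ (i, l) * x $$ (l, j))"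
          using h x y by (intro index_mult_mat_sum) (auto simp: unitary_group_def)
        then show ?thesis using unitary_group_mult[OF h x] by (simp add: y(1) del: index_mult_mat)
      qed
      then show ?thesis by (auto simp: space_M)
    qed
    ultimately show "(\<lambda>x. h * x) -` y \<inter> space M \<in> sets M" by simp
  qed
  then show ?thesis using measurable_cong_sets[OF refl sets_M] by blast
qed

lemma expectation_translate:
  fixes \<psi> :: "complex mat \<Rightarrow> complex"
  assumes h: "h \<in> unitary_group N" and \<psi>: "\<psi> \<in> borel_measurable M"
  shows "expectation (\<lambda>g. \<psi> (h * g)) = expectation \<psi>"
  using integral_distr[OF measurable_translate[OF h] \<psi>] by (simp add: invariant[OF h])

end

lemma sum_unit_vectors:
  fixes f :: "nat \<Rightarrow> 'a::comm_monoid_add"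
  assumes "a < N" "b < N" "a \<noteq> b" "\<And>i. i \<noteq> a \<Longrightarrow> i \<noteq> b \<Longrightarrow> f i = 0"
  shows "(\<Sum>i<N. f i) = f a + f b"
proof -
  have "(\<Sum>i<N. f i) = (\<Sum>i\<in>{a, b}. f i)" using assms by (intro sum.mono_neutral_right) auto
  then show ?thesis using assms by simp
qed

text \<open>Polarisation: the vectors e_a, e_a + e_b and e_a + i e_b determine every entry. This is
  how rank-one directions give information on all matrix units.\<close>

lemma sesquilinear_zero:
  fixes t :: "nat \<Rightarrow> nat \<Rightarrow> complex"
  assumes *: "\<And>w. (\<Sum>a<N. \<Sum>b<N. w a * cnj (w b) * t a b) = 0" and ab: "a < N" "b < N"
  shows "t a b = 0"
proof -
  have diag: "t a a = 0" if "a < N" for a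
    using *[of "\<lambda>i. if i = a then 1 else 0"] that
    by (simp add: if_distrib[of cnj] if_distrib[of "\<lambda>x. x * _"] if_distrib[of "\<lambda>x. _ * x"] sum.delta cong: if_cong)
  show ?thesis
  proof (cases "a = b")
    case True then show ?thesis using diag ab by simp
  next
    case False
    have q: "(\<Sum>i<N. \<Sum>j<N. w i * cnj (w j) * t i j) = w a * cnj (w b) * t a b + w b * cnj (w a) * t b a"
      if w: "\<And>i. i \<noteq> a \<Longrightarrow> i \<noteq> b \<Longrightarrow> w i = 0" for w
    proof -
      have inner: "(\<Sum>j<N. w i * cnj (w j) * t i j) = w i * cnj (w a) * t i a + w i * cnj (w b) * t i b" for i
        using ab False by (rule sum_unit_vectors) (simp add: w)
      have "(\<Sum>i<N. \<Sum>j<N. w i * cnj (w j) * t i j) = (\<Sum>j<N. w a * cnj (w j) * t a j) + (\<Sum>j<N. w b * cnj (w j) * t b j)"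
        using ab False by (rule sum_unit_vectors) (simp add: w)
      then show ?thesis unfolding inner by (simp add: diag[OF ab(1)] diag[OF ab(2)])
    qed
    have "t a b + t b a = 0"
      using *[of "\<lambda>i. if i = a \<or> i = b then 1 else 0"] False by (subst (asm) q) auto
    moreover have "- \<i> * t a b + \<i> * t b a = 0"
      using *[of "\<lambda>i. if i = a then 1 else if i = b then \<i> else 0"] False by (subst (asm) q) auto
    then have "t a b = t b a" by (simp add: algebra_simps)
    ultimately show ?thesis by simp
  qed
qed

context haar_measure
begin

text \<open>Since w w^H is the combination of the matrix units E_ab with coefficients w a * cnj (w
  b), this is the derivative in its direction; the factor i of the flow is kept outside.\<close>

definition dirder :: "(nat \<Rightarrow> complex) \<Rightarrow> (nat \<Rightarrow> nat \<Rightarrow> complex mat \<Rightarrow> complex) \<Rightarrow> complex mat \<Rightarrow> complex" where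
  "dirder w \<psi>' g = (\<Sum>a<N. \<Sum>b<N. w a * cnj (w b) * \<psi>' a b g)"

text \<open>\<open>Der \<psi> \<psi>'\<close>: the function \<open>\<psi>' a b\<close> is the derivative of \<open>\<psi>\<close> in the complexified direction
  \<open>E\<^sub>a\<^sub>b g\<close>. The uniform quadratic error bound allows differentiation under the integral.\<close>

definition Der :: "(complex mat \<Rightarrow> complex) \<Rightarrow> (nat \<Rightarrow> nat \<Rightarrow> complex mat \<Rightarrow> complex) \<Rightarrow> bool" where
  "Der \<psi> \<psi>' \<longleftrightarrow> \<psi> \<in> borel_measurable M \<and> (\<forall>a<N. \<forall>b<N. \<psi>' a b \<in> borel_measurable M) \<and>
    (\<exists>B. \<forall>g\<in>unitary_group N. norm (\<psi> g) \<le> B \<and> (\<forall>a<N. \<forall>b<N. norm (\<psi>' a b g) \<le> B)) \<and>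
    (\<forall>w. \<exists>C. \<forall>e. 0 < e \<and> e \<le> 1 \<longrightarrow> (\<forall>g\<in>unitary_group N.
        norm (\<psi> (rank1_flow N w e * g) - \<psi> g - \<i> * of_real e * dirder w \<psi>' g) \<le> C * e\<^sup>2))"

lemma Der_boundE:
  assumes "Der \<psi> \<psi>'"
  obtains B where "0 \<le> B" "\<And>g. g \<in> unitary_group N \<Longrightarrow> norm (\<psi> g) \<le> B"
    "\<And>g a b. g \<in> unitary_group N \<Longrightarrow> a < N \<Longrightarrow> b < N \<Longrightarrow> norm (\<psi>' a b g) \<le> B"
proof -
  obtain B where B: "\<And>g. g \<in> unitary_group N \<Longrightarrow> norm (\<psi> g) \<le> B"
    "\<And>g a b. g \<in> unitary_group N \<Longrightarrow> a < N \<Longrightarrow> b < N \<Longrightarrow> norm (\<psi>' a b g) \<le> B"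
    using assms unfolding Der_def by blast
  show thesis
  proof (rule that[of "\<bar>B\<bar>"])
    show "norm (\<psi> g) \<le> \<bar>B\<bar>" if "g \<in> unitary_group N" for g
      using B(1)[OF that] by linarith
    show "norm (\<psi>' a b g) \<le> \<bar>B\<bar>" if "g \<in> unitary_group N" "a < N" "b < N" for g a b
      using B(2)[OF that] by linarith
  qed simp
qed

lemma Der_errorE:
  assumes "Der \<psi> \<psi>'"
  obtains C where "0 \<le> C" "\<And>e g. 0 < e \<Longrightarrow> e \<le> 1 \<Longrightarrow> g \<in> unitary_group N \<Longrightarrow>
     norm (\<psi> (rank1_flow N w e * g) - \<psi> g - \<i> * of_real e * dirder w \<psi>' g) \<le> C * e\<^sup>2"
proof -
  have "\<forall>w. \<exists>C. \<forall>e. 0 < e \<and> e \<le> 1 \<longrightarrow> (\<forall>g\<in>unitary_group N.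
        norm (\<psi> (rank1_flow N w e * g) - \<psi> g - \<i> * of_real e * dirder w \<psi>' g) \<le> C * e\<^sup>2)"
    using assms unfolding Der_def by (elim conjE)
  from spec[OF this, of w] obtain C where C: "\<And>e g. 0 < e \<Longrightarrow> e \<le> 1 \<Longrightarrow> g \<in> unitary_group N \<Longrightarrow>
     norm (\<psi> (rank1_flow N w e * g) - \<psi> g - \<i> * of_real e * dirder w \<psi>' g) \<le> C * e\<^sup>2"
    by blast
  show thesis
  proof (rule that[of "\<bar>C\<bar>"])
    fix e g assume "0 < e" "e \<le> (1::real)" "g \<in> unitary_group N"
    from C[OF this] show "norm (\<psi> (rank1_flow N w e * g) - \<psi> g - \<i> * of_real e * dirder w \<psi>' g) \<le> \<bar>C\<bar> * e\<^sup>2"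
      by (rule order_trans) (intro mult_right_mono; simp)
  qed simp
qed

lemma norm_dirder_le:
  assumes "\<And>a b. a < N \<Longrightarrow> b < N \<Longrightarrow> norm (\<psi>' a b g) \<le> B" "0 \<le> B"
  shows "norm (dirder w \<psi>' g) \<le> (\<Sum>a<N. \<Sum>b<N. norm (w a) * norm (w b)) * B"
  unfolding dirder_def sum_distrib_right
  using assms by (intro sum_norm_le) (auto simp: norm_mult intro!: mult_left_mono)

lemma Der_measurable: "Der \<psi> \<psi>' \<Longrightarrow> \<psi> \<in> borel_measurable M"
  and Der_measurable': "Der \<psi> \<psi>' \<Longrightarrow> a < N \<Longrightarrow> b < N \<Longrightarrow> \<psi>' a b \<in> borel_measurable M"
  by (auto simp: Der_def)

lemma integrable_boundedI:
  fixes \<psi> :: "complex mat \<Rightarrow> complex"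
  assumes "\<psi> \<in> borel_measurable M" "\<And>g. g \<in> unitary_group N \<Longrightarrow> norm (\<psi> g) \<le> B"
  shows "integrable M \<psi>"
  using assms by (intro integrable_const_bound[where B = B]) (auto simp: space_M)

lemma Der_integrable: "Der \<psi> \<psi>' \<Longrightarrow> integrable M \<psi>"
proof -
  assume D: "Der \<psi> \<psi>'"
  obtain B where B: "0 \<le> B" "\<And>g. g \<in> unitary_group N \<Longrightarrow> norm (\<psi> g) \<le> B"
    "\<And>g a b. g \<in> unitary_group N \<Longrightarrow> a < N \<Longrightarrow> b < N \<Longrightarrow> norm (\<psi>' a b g) \<le> B"
    by (rule Der_boundE[OF D]) (rule that; blast)
  show ?thesis by (rule integrable_boundedI[OF Der_measurable[OF D] B(2)])
qed

lemma Der_integrable':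
  assumes "Der \<psi> \<psi>'" "a < N" "b < N"
  shows "integrable M (\<psi>' a b)"
proof -
  obtain B where B: "0 \<le> B" "\<And>g. g \<in> unitary_group N \<Longrightarrow> norm (\<psi> g) \<le> B"
    "\<And>g a b. g \<in> unitary_group N \<Longrightarrow> a < N \<Longrightarrow> b < N \<Longrightarrow> norm (\<psi>' a b g) \<le> B"
    by (rule Der_boundE[OF assms(1)]) (rule that; blast)
  show ?thesis by (rule integrable_boundedI[OF Der_measurable'[OF assms] B(3)[OF _ assms(2,3)]])
qed

text \<open>By invariance the expectation does not change along the flow, so the first-order term
  has expectation at most C e for every small e, hence 0 in each rank-one direction; polarisation
  then separates the indices.\<close>

lemma Der_expectation_zero:
  assumes D: "Der \<psi> \<psi>'" and ab: "a < N" "b < N"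
  shows "expectation (\<psi>' a b) = 0"
proof (rule sesquilinear_zero[OF _ ab])
  fix w
  obtain C where C: "0 \<le> C" "\<And>e g. 0 < e \<Longrightarrow> e \<le> 1 \<Longrightarrow> g \<in> unitary_group N \<Longrightarrow>
     norm (\<psi> (rank1_flow N w e * g) - \<psi> g - \<i> * of_real e * dirder w \<psi>' g) \<le> C * e\<^sup>2"
      by (rule Der_errorE[OF D, where w = w]) (rule that; blast)
  have id: "integrable M (dirder w \<psi>')"
    unfolding dirder_def[abs_def] using Der_integrable'[OF D]
    by (intro Bochner_Integration.integrable_sum integrable_mult_right) auto
  have ed: "expectation (dirder w \<psi>') = (\<Sum>a<N. \<Sum>b<N. w a * cnj (w b) * expectation (\<psi>' a b))"
  proof -
    have i: "integrable M (\<lambda>g. w a * cnj (w b) * \<psi>' a b g)" if "a < N" "b < N" for a b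
      using Der_integrable'[OF D that] by (rule integrable_mult_right)
    have "expectation (dirder w \<psi>') = (\<Sum>a<N. expectation (\<lambda>g. \<Sum>b<N. w a * cnj (w b) * \<psi>' a b g))"
      unfolding dirder_def[abs_def] using i
      by (intro Bochner_Integration.integral_sum Bochner_Integration.integrable_sum) auto
    also have "\<dots> = (\<Sum>a<N. \<Sum>b<N. expectation (\<lambda>g. w a * cnj (w b) * \<psi>' a b g))"
      using i by (intro sum.cong refl Bochner_Integration.integral_sum) auto
    finally show ?thesis by simp
  qed
  have i\<psi>: "integrable M \<psi>" using D by (rule Der_integrable)
  have bnd: "norm (expectation (dirder w \<psi>')) \<le> C * e" if e: "0 < e" "e \<le> 1" for e
  proof -
    have m: "(\<lambda>g. rank1_flow N w e * g) \<in> measurable M M" by (rule measurable_translate[OF rank1_flow_unitary])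
    have iT: "integrable M (\<lambda>g. \<psi> (rank1_flow N w e * g))"
    proof -
      obtain B where B: "0 \<le> B" "\<And>g. g \<in> unitary_group N \<Longrightarrow> norm (\<psi> g) \<le> B"
        "\<And>g a b. g \<in> unitary_group N \<Longrightarrow> a < N \<Longrightarrow> b < N \<Longrightarrow> norm (\<psi>' a b g) \<le> B"
      by (rule Der_boundE[OF D]) (rule that; blast)
      show ?thesis
        using measurable_compose[OF m Der_measurable[OF D]]
        by (rule integrable_boundedI[where B = B]) (intro B(2) unitary_group_mult rank1_flow_unitary)
    qed
    have "expectation (\<lambda>g. \<psi> (rank1_flow N w e * g) - \<psi> g - \<i> * of_real e * dirder w \<psi>' g)
      = expectation (\<lambda>g. \<psi> (rank1_flow N w e * g)) - expectation \<psi> - \<i> * of_real e * expectation (dirder w \<psi>')"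
      using iT i\<psi> id by simp
    also have "expectation (\<lambda>g. \<psi> (rank1_flow N w e * g)) = expectation \<psi>"
      by (rule expectation_translate[OF rank1_flow_unitary Der_measurable[OF D]])
    finally have "norm (\<i> * of_real e * expectation (dirder w \<psi>')) =
      norm (expectation (\<lambda>g. \<psi> (rank1_flow N w e * g) - \<psi> g - \<i> * of_real e * dirder w \<psi>' g))" by simp
    also have "\<dots> \<le> expectation (\<lambda>g. norm (\<psi> (rank1_flow N w e * g) - \<psi> g - \<i> * of_real e * dirder w \<psi>' g))"
      by (rule integral_norm_bound)
    also have "\<dots> \<le> expectation (\<lambda>g. C * e\<^sup>2)"
      using iT i\<psi> id C(2)[OF e] by (intro integral_mono integrable_norm Bochner_Integration.integrable_diff integrable_mult_right) (auto simp: space_M)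
    also have "\<dots> = C * e\<^sup>2" by (simp add: prob_space)
    finally have "e * norm (expectation (dirder w \<psi>')) \<le> e * (C * e)" using e by (simp add: norm_mult power2_eq_square mult_ac)
    then show ?thesis using e by simp
  qed
  have "norm (expectation (dirder w \<psi>')) \<le> 0"
  proof (rule field_le_epsilon)
    fix \<epsilon> :: real assume eps: "0 < \<epsilon>"
    define e where "e = min 1 (\<epsilon> / (C + 1))"
    have e: "0 < e" "e \<le> 1" "e \<le> \<epsilon> / (C + 1)" using eps C(1) by (auto simp: e_def)
    have "C * e \<le> C * (\<epsilon> / (C + 1))" using e C(1) by (intro mult_left_mono) auto
    also have "\<dots> \<le> \<epsilon>" using C(1) eps by (simp add: field_simps)
    finally show "norm (expectation (dirder w \<psi>')) \<le> 0 + \<epsilon>" using bnd[OF e(1,2)] by simp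
  qed
  then show "(\<Sum>a<N. \<Sum>b<N. w a * cnj (w b) * expectation (\<psi>' a b)) = 0" by (simp add: ed)
qed

lemma Der_const: "Der (\<lambda>g. c) (\<lambda>a b g. 0)"
  unfolding Der_def
proof (intro conjI allI impI)
  show "\<exists>B. \<forall>g\<in>unitary_group N. norm c \<le> B \<and> (\<forall>a<N. \<forall>b<N. norm (0 :: complex) \<le> B)"
    by (rule exI[of _ "norm c"]) simp
qed (auto simp: dirder_def intro!: exI[of _ "0::real"])

lemma Der_add:
  assumes D: "Der \<psi> \<psi>'" "Der \<phi> \<phi>'"
  shows "Der (\<lambda>g. \<psi> g + \<phi> g) (\<lambda>a b g. \<psi>' a b g + \<phi>' a b g)"
proof -
  obtain B1 where B1: "0 \<le> B1" "\<And>g. g \<in> unitary_group N \<Longrightarrow> norm (\<psi> g) \<le> B1"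
    "\<And>g a b. g \<in> unitary_group N \<Longrightarrow> a < N \<Longrightarrow> b < N \<Longrightarrow> norm (\<psi>' a b g) \<le> B1"
      by (rule Der_boundE[OF D(1)]) (rule that; blast)
  obtain B2 where B2: "0 \<le> B2" "\<And>g. g \<in> unitary_group N \<Longrightarrow> norm (\<phi> g) \<le> B2"
    "\<And>g a b. g \<in> unitary_group N \<Longrightarrow> a < N \<Longrightarrow> b < N \<Longrightarrow> norm (\<phi>' a b g) \<le> B2"
      by (rule Der_boundE[OF D(2)]) (rule that; blast)
  have dd: "dirder w (\<lambda>a b g. \<psi>' a b g + \<phi>' a b g) g = dirder w \<psi>' g + dirder w \<phi>' g" for w g
    by (simp add: dirder_def distrib_left sum.distrib)
  show ?thesis unfolding Der_def
  proof (intro conjI allI impI)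
    show "\<exists>B. \<forall>g\<in>unitary_group N. norm (\<psi> g + \<phi> g) \<le> B \<and> (\<forall>a<N. \<forall>b<N. norm (\<psi>' a b g + \<phi>' a b g) \<le> B)"
      by (intro exI[of _ "B1 + B2"]) (auto intro!: norm_triangle_mono B1 B2)
    fix w
    obtain C1 where C1: "0 \<le> C1" "\<And>e g. 0 < e \<Longrightarrow> e \<le> 1 \<Longrightarrow> g \<in> unitary_group N \<Longrightarrow>
     norm (\<psi> (rank1_flow N w e * g) - \<psi> g - \<i> * of_real e * dirder w \<psi>' g) \<le> C1 * e\<^sup>2"
      by (rule Der_errorE[OF D(1), where w = w]) (rule that; blast)
    obtain C2 where C2: "0 \<le> C2" "\<And>e g. 0 < e \<Longrightarrow> e \<le> 1 \<Longrightarrow> g \<in> unitary_group N \<Longrightarrow>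
     norm (\<phi> (rank1_flow N w e * g) - \<phi> g - \<i> * of_real e * dirder w \<phi>' g) \<le> C2 * e\<^sup>2"
      by (rule Der_errorE[OF D(2), where w = w]) (rule that; blast)
    show "\<exists>C. \<forall>e. 0 < e \<and> e \<le> 1 \<longrightarrow> (\<forall>g\<in>unitary_group N.
        norm (\<psi> (rank1_flow N w e * g) + \<phi> (rank1_flow N w e * g) - (\<psi> g + \<phi> g) - \<i> * of_real e * dirder w (\<lambda>a b g. \<psi>' a b g + \<phi>' a b g) g) \<le> C * e\<^sup>2)"
    proof (intro exI[of _ "C1 + C2"] allI impI ballI)
      fix e g assume e: "0 < e \<and> e \<le> (1::real)" and g: "g \<in> unitary_group N"
      have "\<psi> (rank1_flow N w e * g) + \<phi> (rank1_flow N w e * g) - (\<psi> g + \<phi> g) - \<i> * of_real e * dirder w (\<lambda>a b g. \<psi>' a b g + \<phi>' a b g) g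
        = (\<psi> (rank1_flow N w e * g) - \<psi> g - \<i> * of_real e * dirder w \<psi>' g) + (\<phi> (rank1_flow N w e * g) - \<phi> g - \<i> * of_real e * dirder w \<phi>' g)"
        unfolding dd by (simp add: algebra_simps)
      also have "norm \<dots> \<le> C1 * e\<^sup>2 + C2 * e\<^sup>2" using C1 C2 e g by (intro norm_triangle_mono) auto
      finally show "norm (\<psi> (rank1_flow N w e * g) + \<phi> (rank1_flow N w e * g) - (\<psi> g + \<phi> g) - \<i> * of_real e * dirder w (\<lambda>a b g. \<psi>' a b g + \<phi>' a b g) g) \<le> (C1 + C2) * e\<^sup>2"
        by (simp add: distrib_right)
    qed
  qed (auto intro!: borel_measurable_add borel_measurable_times Der_measurable[OF D(1)] Der_measurable[OF D(2)]
      Der_measurable'[OF D(1)] Der_measurable'[OF D(2)])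
qed

lemma Der_sum:
  assumes "finite S" "\<And>s. s \<in> S \<Longrightarrow> Der (\<psi> s) (\<psi>' s)"
  shows "Der (\<lambda>g. \<Sum>s\<in>S. \<psi> s g) (\<lambda>a b g. \<Sum>s\<in>S. \<psi>' s a b g)"
  using assms
proof (induction S rule: finite_induct)
  case empty
  show ?case using Der_const[of 0] by simp
next
  case (insert s S)
  then show ?case using Der_add[of "\<psi> s" "\<psi>' s"] by simp
qed

text \<open>Conjugation turns the factor i of the flow into -i and w a * cnj (w b) into w b * cnj (w
  a), whence the sign and the exchanged indices.\<close>

lemma Der_cnj:
  assumes D: "Der \<psi> \<psi>'"
  shows "Der (\<lambda>g. cnj (\<psi> g)) (\<lambda>a b g. - cnj (\<psi>' b a g))"
proof -
  obtain B where B: "0 \<le> B" "\<And>g. g \<in> unitary_group N \<Longrightarrow> norm (\<psi> g) \<le> B"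
    "\<And>g a b. g \<in> unitary_group N \<Longrightarrow> a < N \<Longrightarrow> b < N \<Longrightarrow> norm (\<psi>' a b g) \<le> B"
      by (rule Der_boundE[OF D]) (rule that; blast)
  have mc: "(\<lambda>g. cnj (f g)) \<in> borel_measurable M" if "f \<in> borel_measurable M" for f
    by (rule measurable_compose[OF that borel_measurable_continuous_onI]) (intro continuous_intros)
  have dd: "dirder w (\<lambda>a b g. - cnj (\<psi>' b a g)) g = - cnj (dirder w \<psi>' g)" for w g
  proof -
    have "dirder w (\<lambda>a b g. - cnj (\<psi>' b a g)) g = (\<Sum>b<N. \<Sum>a<N. w a * cnj (w b) * - cnj (\<psi>' b a g))"
      unfolding dirder_def by (rule sum.swap)
    also have "\<dots> = - cnj (dirder w \<psi>' g)" unfolding dirder_def by (simp add: sum_negf mult_ac)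
    finally show ?thesis .
  qed
  show ?thesis unfolding Der_def
  proof (intro conjI allI impI)
    show "(\<lambda>g. cnj (\<psi> g)) \<in> borel_measurable M" using Der_measurable[OF D] by (rule mc)
    show "(\<lambda>g. - cnj (\<psi>' b a g)) \<in> borel_measurable M" if "a < N" "b < N" for a b
      using mc[OF Der_measurable'[OF D that(2,1)]] by (rule borel_measurable_uminus)
    show "\<exists>B. \<forall>g\<in>unitary_group N. norm (cnj (\<psi> g)) \<le> B \<and> (\<forall>a<N. \<forall>b<N. norm (- cnj (\<psi>' b a g)) \<le> B)"
      using B by (intro exI[of _ B]) auto
    fix w
    obtain C where C: "0 \<le> C" "\<And>e g. 0 < e \<Longrightarrow> e \<le> 1 \<Longrightarrow> g \<in> unitary_group N \<Longrightarrow>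
     norm (\<psi> (rank1_flow N w e * g) - \<psi> g - \<i> * of_real e * dirder w \<psi>' g) \<le> C * e\<^sup>2"
      by (rule Der_errorE[OF D, where w = w]) (rule that; blast)
    show "\<exists>C. \<forall>e. 0 < e \<and> e \<le> 1 \<longrightarrow> (\<forall>g\<in>unitary_group N.
        norm (cnj (\<psi> (rank1_flow N w e * g)) - cnj (\<psi> g) - \<i> * of_real e * dirder w (\<lambda>a b g. - cnj (\<psi>' b a g)) g) \<le> C * e\<^sup>2)"
    proof (intro exI[of _ C] allI impI ballI)
      fix e g assume e: "0 < e \<and> e \<le> (1::real)" and g: "g \<in> unitary_group N"
      have "cnj (\<psi> (rank1_flow N w e * g)) - cnj (\<psi> g) - \<i> * of_real e * dirder w (\<lambda>a b g. - cnj (\<psi>' b a g)) g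
        = cnj (\<psi> (rank1_flow N w e * g) - \<psi> g - \<i> * of_real e * dirder w \<psi>' g)"
        by (simp add: dd)
      also have "norm \<dots> \<le> C * e\<^sup>2" unfolding complex_mod_cnj using C(2) e g by simp
      finally show "norm (cnj (\<psi> (rank1_flow N w e * g)) - cnj (\<psi> g) - \<i> * of_real e * dirder w (\<lambda>a b g. - cnj (\<psi>' b a g)) g) \<le> C * e\<^sup>2" .
    qed
  qed
qed

lemma Der_mult:
  assumes D: "Der \<psi> \<psi>'" "Der \<phi> \<phi>'"
  shows "Der (\<lambda>g. \<psi> g * \<phi> g) (\<lambda>a b g. \<psi>' a b g * \<phi> g + \<psi> g * \<phi>' a b g)"
proof -
  obtain B1 where B1: "0 \<le> B1" "\<And>g. g \<in> unitary_group N \<Longrightarrow> norm (\<psi> g) \<le> B1"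
    "\<And>g a b. g \<in> unitary_group N \<Longrightarrow> a < N \<Longrightarrow> b < N \<Longrightarrow> norm (\<psi>' a b g) \<le> B1"
      by (rule Der_boundE[OF D(1)]) (rule that; blast)
  obtain B2 where B2: "0 \<le> B2" "\<And>g. g \<in> unitary_group N \<Longrightarrow> norm (\<phi> g) \<le> B2"
    "\<And>g a b. g \<in> unitary_group N \<Longrightarrow> a < N \<Longrightarrow> b < N \<Longrightarrow> norm (\<phi>' a b g) \<le> B2"
      by (rule Der_boundE[OF D(2)]) (rule that; blast)
  have dd: "dirder w (\<lambda>a b g. \<psi>' a b g * \<phi> g + \<psi> g * \<phi>' a b g) g = dirder w \<psi>' g * \<phi> g + \<psi> g * dirder w \<phi>' g" for w g
    by (simp add: dirder_def distrib_left sum.distrib sum_distrib_left sum_distrib_right mult_ac)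
  show ?thesis unfolding Der_def
  proof (intro conjI allI impI)
    show "\<exists>B. \<forall>g\<in>unitary_group N. norm (\<psi> g * \<phi> g) \<le> B \<and> (\<forall>a<N. \<forall>b<N. norm (\<psi>' a b g * \<phi> g + \<psi> g * \<phi>' a b g) \<le> B)"
    proof (intro exI[of _ "B1 * B2 + B1 * B2"] ballI conjI allI impI)
      fix g assume g: "g \<in> unitary_group N"
      have "norm (\<psi> g * \<phi> g) \<le> B1 * B2" unfolding norm_mult using B1 B2 g by (intro mult_mono) auto
      then show "norm (\<psi> g * \<phi> g) \<le> B1 * B2 + B1 * B2" using mult_nonneg_nonneg[OF B1(1) B2(1)] by linarith
      fix a b assume ab: "a < N" "b < N"
      show "norm (\<psi>' a b g * \<phi> g + \<psi> g * \<phi>' a b g) \<le> B1 * B2 + B1 * B2"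
        using B1 B2 g ab by (intro norm_triangle_mono) (auto simp: norm_mult intro!: mult_mono)
    qed
    fix w
    obtain C1 where C1: "0 \<le> C1" "\<And>e g. 0 < e \<Longrightarrow> e \<le> 1 \<Longrightarrow> g \<in> unitary_group N \<Longrightarrow>
     norm (\<psi> (rank1_flow N w e * g) - \<psi> g - \<i> * of_real e * dirder w \<psi>' g) \<le> C1 * e\<^sup>2"
      by (rule Der_errorE[OF D(1), where w = w]) (rule that; blast)
    obtain C2 where C2: "0 \<le> C2" "\<And>e g. 0 < e \<Longrightarrow> e \<le> 1 \<Longrightarrow> g \<in> unitary_group N \<Longrightarrow>
     norm (\<phi> (rank1_flow N w e * g) - \<phi> g - \<i> * of_real e * dirder w \<phi>' g) \<le> C2 * e\<^sup>2"
      by (rule Der_errorE[OF D(2), where w = w]) (rule that; blast)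
    define K where "K = (\<Sum>a<N. \<Sum>b<N. norm (w a) * norm (w b))"
    have K0: "0 \<le> K" unfolding K_def by (intro sum_nonneg) auto
    show "\<exists>C. \<forall>e. 0 < e \<and> e \<le> 1 \<longrightarrow> (\<forall>g\<in>unitary_group N.
        norm (\<psi> (rank1_flow N w e * g) * \<phi> (rank1_flow N w e * g) - \<psi> g * \<phi> g - \<i> * of_real e * dirder w (\<lambda>a b g. \<psi>' a b g * \<phi> g + \<psi> g * \<phi>' a b g) g) \<le> C * e\<^sup>2)"
    proof (intro exI[of _ "C1 * B2 + B1 * C2 + K * B1 * (K * B2 + C2)"] allI impI ballI)
      fix e g assume e: "0 < e \<and> e \<le> (1::real)" and g: "g \<in> unitary_group N"
      define x where "x = \<psi> (rank1_flow N w e * g)"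
      define y where "y = \<phi> (rank1_flow N w e * g)"
      define u where "u = \<i> * of_real e * dirder w \<psi>' g"
      define v where "v = \<i> * of_real e * dirder w \<phi>' g"
      have hg: "rank1_flow N w e * g \<in> unitary_group N" by (intro unitary_group_mult rank1_flow_unitary g)
      have 1: "norm (x - \<psi> g - u) \<le> C1 * e\<^sup>2" unfolding x_def u_def using C1(2) e g by simp
      have 2: "norm (y - \<phi> g - v) \<le> C2 * e\<^sup>2" unfolding y_def v_def using C2(2) e g by simp
      have ny: "norm y \<le> B2" unfolding y_def by (rule B2(2)[OF hg])
      have nu: "norm u \<le> e * (K * B1)"
        using norm_dirder_le[of \<psi>' g B1 w] B1 g e by (simp add: u_def norm_mult K_def)
      have nv: "norm v \<le> e * (K * B2)"
        using norm_dirder_le[of \<phi>' g B2 w] B2 g e by (simp add: v_def norm_mult K_def)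
      have e2: "e\<^sup>2 \<le> e" using e by (simp add: power2_eq_square mult_left_le)
      have "norm (y - \<phi> g) \<le> norm (y - \<phi> g - v) + norm v"
        using norm_triangle_ineq[of "y - \<phi> g - v" v] by simp
      also have "\<dots> \<le> C2 * e + e * (K * B2)"
        using 2 nv mult_left_mono[OF e2 C2(1)] by linarith
      finally have nd: "norm (y - \<phi> g) \<le> e * (K * B2 + C2)" by (simp add: algebra_simps)
      \<comment> \<open>Two remainders multiplied by bounded factors, and a product of two
        first-order quantities: each is quadratic in e.\<close>
      have "x * y - \<psi> g * \<phi> g - \<i> * of_real e * dirder w (\<lambda>a b g. \<psi>' a b g * \<phi> g + \<psi> g * \<phi>' a b g) g
        = (x - \<psi> g - u) * y + \<psi> g * (y - \<phi> g - v) + u * (y - \<phi> g)"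
        unfolding dd by (simp add: u_def v_def algebra_simps)
      also have "norm \<dots> \<le> (C1 * e\<^sup>2) * B2 + B1 * (C2 * e\<^sup>2) + (e * (K * B1)) * (e * (K * B2 + C2))"
      proof (intro norm_triangle_mono)
        show "norm ((x - \<psi> g - u) * y) \<le> (C1 * e\<^sup>2) * B2" unfolding norm_mult using 1 ny C1(1) by (intro mult_mono) auto
        show "norm (\<psi> g * (y - \<phi> g - v)) \<le> B1 * (C2 * e\<^sup>2)" unfolding norm_mult using 2 B1 g by (intro mult_mono) auto
        show "norm (u * (y - \<phi> g)) \<le> (e * (K * B1)) * (e * (K * B2 + C2))"
          unfolding norm_mult using nu nd e K0 B1(1) by (intro mult_mono) auto
      qed
      also have "\<dots> = (C1 * B2 + B1 * C2 + K * B1 * (K * B2 + C2)) * e\<^sup>2" by (simp add: power2_eq_square algebra_simps)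
      finally show "norm (\<psi> (rank1_flow N w e * g) * \<phi> (rank1_flow N w e * g) - \<psi> g * \<phi> g - \<i> * of_real e * dirder w (\<lambda>a b g. \<psi>' a b g * \<phi> g + \<psi> g * \<phi>' a b g) g)
         \<le> (C1 * B2 + B1 * C2 + K * B1 * (K * B2 + C2)) * e\<^sup>2"
        by (simp add: x_def y_def)
    qed
  qed (auto intro!: borel_measurable_add borel_measurable_times Der_measurable[OF D(1)] Der_measurable[OF D(2)]
      Der_measurable'[OF D(1)] Der_measurable'[OF D(2)])
qed

lemma Der_cong:
  assumes D: "Der \<psi> \<psi>'" and eq: "\<And>g. g \<in> unitary_group N \<Longrightarrow> \<psi> g = \<phi> g"
    "\<And>g a b. g \<in> unitary_group N \<Longrightarrow> a < N \<Longrightarrow> b < N \<Longrightarrow> \<psi>' a b g = \<phi>' a b g"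
  shows "Der \<phi> \<phi>'"
proof -
  have m1: "\<phi> \<in> borel_measurable M"
    using Der_measurable[OF D] eq(1) by (subst measurable_cong[of M \<phi> \<psi>]) (auto simp: space_M)
  have m2: "\<phi>' a b \<in> borel_measurable M" if "a < N" "b < N" for a b
    using Der_measurable'[OF D that] eq(2) that by (subst measurable_cong[of M "\<phi>' a b" "\<psi>' a b"]) (auto simp: space_M)
  have dd: "dirder w \<phi>' g = dirder w \<psi>' g" if "g \<in> unitary_group N" for w g
    unfolding dirder_def using eq(2)[OF that] by (intro sum.cong refl) auto
  have hg: "rank1_flow N w e * g \<in> unitary_group N" if "g \<in> unitary_group N" for g w e
    by (intro unitary_group_mult rank1_flow_unitary that)
  show ?thesis using D m1 m2 unfolding Der_def by (simp add: dd eq hg)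
qed

text \<open>Row a of E_ab g is row b of g, and its other rows vanish.\<close>

lemma Der_entry:
  assumes ij: "i < N" "j < N"
  shows "Der (\<lambda>g. g $$ (i, j)) (\<lambda>a b g. if a = i then g $$ (b, j) else 0)"
proof -
  have dd: "dirder w (\<lambda>a b g. if a = i then g $$ (b, j) else 0) g = (\<Sum>l<N. w i * cnj (w l) * g $$ (l, j))" for w g
  proof -
    have "dirder w (\<lambda>a b g. if a = i then g $$ (b, j) else 0) g = (\<Sum>a<N. if a = i then (\<Sum>l<N. w i * cnj (w l) * g $$ (l, j)) else 0)"
      unfolding dirder_def by (intro sum.cong refl) auto
    then show ?thesis using ij by simp
  qed
  show ?thesis unfolding Der_def
  proof (intro conjI allI impI)
    show "(\<lambda>g. g $$ (i, j)) \<in> borel_measurable M" using ij by (rule measurable_entry)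
    show "(\<lambda>g. if a = i then g $$ (b, j) else 0) \<in> borel_measurable M" if "a < N" "b < N" for a b
      using measurable_entry[OF that(2) ij(2)] by (cases "a = i") auto
    show "\<exists>B. \<forall>g\<in>unitary_group N. norm (g $$ (i, j)) \<le> B \<and> (\<forall>a<N. \<forall>b<N. norm (if a = i then g $$ (b, j) else 0) \<le> B)"
      using ij by (intro exI[of _ 1]) (auto intro: norm_unitary_entry_le)
    fix w :: "nat \<Rightarrow> complex"
    define s where "s = (\<Sum>i<N. (norm (w i))\<^sup>2)"
    define K where "K = (\<Sum>l<N. norm (w i) * norm (w l))"
    have s0: "0 \<le> s" unfolding s_def by (intro sum_nonneg) auto
    show "\<exists>C. \<forall>e. 0 < e \<and> e \<le> 1 \<longrightarrow> (\<forall>g\<in>unitary_group N. norm ((rank1_flow N w e * g) $$ (i, j) - g $$ (i, j)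
        - \<i> * of_real e * dirder w (\<lambda>a b g. if a = i then g $$ (b, j) else 0) g) \<le> C * e\<^sup>2)"
    proof (intro exI[of _ "s * K"] allI impI ballI)
      fix e g assume g: "g \<in> unitary_group N"
      define S where "S = (\<Sum>l<N. w i * cnj (w l) * g $$ (l, j))"
      have "(rank1_flow N w e * g) $$ (i, j) = g $$ (i, j) + rank1_coeff N w e * S"
        unfolding S_def using g by (intro rank1_flow_mult ij) (simp add: unitary_group_def)
      then have "(rank1_flow N w e * g) $$ (i, j) - g $$ (i, j) - \<i> * of_real e * dirder w (\<lambda>a b g. if a = i then g $$ (b, j) else 0) g
        = (rank1_coeff N w e - \<i> * of_real e) * S"
        by (simp add: dd S_def algebra_simps del: index_mult_mat)
      moreover have "norm ((rank1_coeff N w e - \<i> * of_real e) * S) \<le> s * K * e\<^sup>2"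
      proof (cases "s = 0")
        \<comment> \<open>Here w = 0 on the relevant indices and the flow coefficient is 0 by
          division by zero; the factor \<open>S\<close> vanishes, so the quadratic estimate of the
          coefficient is not called upon.\<close>
        case True
        then have "w i = 0" using ij by (simp add: s_def sum_nonneg_eq_0_iff)
        then show ?thesis by (simp add: S_def True)
      next
        case False
        have "norm S \<le> K" unfolding S_def K_def
          using g ij by (intro sum_norm_le) (auto simp: norm_mult intro!: mult_left_le norm_unitary_entry_le)
        moreover have "norm (rank1_coeff N w e - \<i> * of_real e) \<le> s * e\<^sup>2"
          unfolding s_def using False by (intro rank1_coeff_approx) (simp add: s_def)
        ultimately have "norm ((rank1_coeff N w e - \<i> * of_real e) * S) \<le> s * e\<^sup>2 * K"
          unfolding norm_mult using s0 by (intro mult_mono) auto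
        then show ?thesis by (simp add: mult_ac)
      qed
      ultimately show "norm ((rank1_flow N w e * g) $$ (i, j) - g $$ (i, j)
        - \<i> * of_real e * dirder w (\<lambda>a b g. if a = i then g $$ (b, j) else 0) g) \<le> s * K * e\<^sup>2"
        by simp
    qed
  qed
qed

end

section \<open>Traces of powers and the loop equations\<close>

definition pw :: "nat \<Rightarrow> complex mat \<Rightarrow> nat \<Rightarrow> nat \<Rightarrow> complex" where
  "pw k g i j = (g ^\<^sub>m k) $$ (i, j)"

definition powtr :: "nat \<Rightarrow> nat \<Rightarrow> complex mat \<Rightarrow> complex" where
  "powtr N k g = (\<Sum>i<N. pw k g i i)"

definition powtr_prod :: "nat \<Rightarrow> nat multiset \<Rightarrow> complex mat \<Rightarrow> complex" where
  "powtr_prod N P g = (\<Prod>i\<in>#P. powtr N i g)"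

lemma pw_0: "g \<in> carrier_mat N N \<Longrightarrow> i < N \<Longrightarrow> j < N \<Longrightarrow> pw 0 g i j = (if i = j then 1 else 0)"
  by (auto simp: pw_def)

lemma pw_Suc: "g \<in> carrier_mat N N \<Longrightarrow> i < N \<Longrightarrow> j < N \<Longrightarrow> pw (Suc k) g i j = (\<Sum>l<N. pw k g i l * g $$ (l, j))"
  unfolding pw_def pow_mat.simps by (intro index_mult_mat_sum) auto

lemma pw_1: "g \<in> carrier_mat N N \<Longrightarrow> i < N \<Longrightarrow> j < N \<Longrightarrow> pw (Suc 0) g i j = g $$ (i, j)"
  by (simp add: pw_def)

lemma pow_mat_add_exp:
  fixes g :: "'a :: semiring_1 mat"
  assumes g: "g \<in> carrier_mat N N"
  shows "g ^\<^sub>m (k + l) = g ^\<^sub>m k * g ^\<^sub>m l"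
proof (induction l)
  case 0
  show ?case using pow_carrier_mat[OF g, of k] g by simp
next
  case (Suc l)
  have "g ^\<^sub>m (k + Suc l) = g ^\<^sub>m k * g ^\<^sub>m l * g" using Suc by simp
  also have "\<dots> = g ^\<^sub>m k * (g ^\<^sub>m l * g)"
    using pow_carrier_mat[OF g] g by (intro assoc_mult_mat) auto
  finally show ?case by simp
qed

lemma pw_add:
  assumes "g \<in> carrier_mat N N" "i < N" "j < N"
  shows "pw (k + l) g i j = (\<Sum>a<N. pw k g i a * pw l g a j)"
  unfolding pw_def pow_mat_add_exp[OF assms(1)] using assms by (intro index_mult_mat_sum) auto

lemma pow_mat_unitary: "g \<in> unitary_group N \<Longrightarrow> g ^\<^sub>m k \<in> unitary_group N"
proof (induction k)
  case 0
  then have "g ^\<^sub>m 0 = 1\<^sub>m N" by (auto simp: unitary_group_def)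
  moreover have "(\<Sum>l<N. cnj ((1\<^sub>m N) $$ (l, i)) * (1\<^sub>m N) $$ (l, j)) = (if i = j then 1 else 0 :: complex)"
    if "i < N" "j < N" for i j
  proof -
    have "(\<Sum>l<N. cnj ((1\<^sub>m N) $$ (l, i)) * (1\<^sub>m N) $$ (l, j)) = (\<Sum>l<N. if l = i then (if i = j then 1 else 0 :: complex) else 0)"
      using that by (intro sum.cong refl) auto
    then show ?thesis using that by simp
  qed
  ultimately show ?case by (simp add: unitary_group_iff)
next
  case (Suc k)
  then show ?case by (simp add: unitary_group_mult)
qed

lemma powtr_0: "g \<in> carrier_mat N N \<Longrightarrow> powtr N 0 g = of_nat N"
  by (simp add: powtr_def pw_0)

lemma sum_pw_mult:
  assumes "g \<in> carrier_mat N N"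
  shows "(\<Sum>a<N. \<Sum>b<N. pw k g a b * pw m g b a) = powtr N (k + m) g"
  unfolding powtr_def using assms by (intro sum.cong refl) (simp add: pw_add)

text \<open>Factor g^k = g^(k - j) g^j and use that the rows of the unitary matrix g^j are
  orthonormal.\<close>

lemma sum_pw_cnj_ge:
  assumes g: "g \<in> unitary_group N" and jk: "j \<le> k"
  shows "(\<Sum>a<N. \<Sum>b<N. pw k g a b * cnj (pw j g a b)) = powtr N (k - j) g"
proof -
  have c: "g \<in> carrier_mat N N" using g by (simp add: unitary_group_def)
  have "(\<Sum>b<N. pw k g a b * cnj (pw j g a b)) = pw (k - j) g a a" if a: "a < N" for a
  proof -
    have "(\<Sum>b<N. pw k g a b * cnj (pw j g a b)) = (\<Sum>b<N. (\<Sum>c<N. pw (k - j) g a c * pw j g c b) * cnj (pw j g a b))"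
      using pw_add[OF c a, of _ "k - j" j] jk by (intro sum.cong refl) simp
    also have "\<dots> = (\<Sum>b<N. \<Sum>c<N. pw (k - j) g a c * (pw j g c b * cnj (pw j g a b)))"
      by (simp add: sum_distrib_right mult.assoc)
    also have "\<dots> = (\<Sum>c<N. \<Sum>b<N. pw (k - j) g a c * (pw j g c b * cnj (pw j g a b)))"
      by (rule sum.swap)
    also have "\<dots> = (\<Sum>c<N. pw (k - j) g a c * (if c = a then 1 else 0))"
      unfolding sum_distrib_left [symmetric] pw_def[of j]
      using unitary_group_rows[OF pow_mat_unitary[OF g, of j] _ a] by (intro sum.cong refl) auto
    also have "\<dots> = (\<Sum>c<N. if c = a then pw (k - j) g a a else 0)" by (intro sum.cong refl) auto
    also have "\<dots> = pw (k - j) g a a" using a by simp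
    finally show ?thesis .
  qed
  then show ?thesis by (simp add: powtr_def)
qed

lemma sum_pw_cnj:
  assumes g: "g \<in> unitary_group N"
  shows "(\<Sum>a<N. \<Sum>b<N. pw k g a b * cnj (pw j g a b)) =
     (if j \<le> k then powtr N (k - j) g else cnj (powtr N (j - k) g))"
proof (cases "j \<le> k")
  case False
  have "(\<Sum>a<N. \<Sum>b<N. pw k g a b * cnj (pw j g a b)) = cnj (\<Sum>a<N. \<Sum>b<N. pw j g a b * cnj (pw k g a b))"
    by (simp add: mult.commute)
  also have "\<dots> = cnj (powtr N (j - k) g)" using False by (subst sum_pw_cnj_ge[OF g]) auto
  finally show ?thesis using False by simp
qed (simp add: sum_pw_cnj_ge[OF g])

lemma sum_sum_mset_swap:
  fixes f :: "'a \<Rightarrow> 'b \<Rightarrow> 'c :: comm_monoid_add"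
  shows "(\<Sum>a\<in>A. \<Sum>m\<in>#P. f a m) = (\<Sum>m\<in>#P. \<Sum>a\<in>A. f a m)"
  by (induction P) (auto simp: sum.distrib)

lemma powtr_prod_empty [simp]: "powtr_prod N {#} g = 1"
  and powtr_prod_add [simp]: "powtr_prod N (add_mset x P) g = powtr N x g * powtr_prod N P g"
  by (simp_all add: powtr_prod_def)

lemma cnj_sum_mset: "cnj (\<Sum>m\<in>#P. f m) = (\<Sum>m\<in>#P. cnj (f m))"
  by (induction P) auto

lemma sum_mset_mult_left: "c * (\<Sum>m\<in>#P. f m) = (\<Sum>m\<in>#P. c * (f m :: complex))"
  by (induction P) (auto simp: distrib_left)

lemma sum_mset_mult_right: "(\<Sum>m\<in>#P. f m) * c = (\<Sum>m\<in>#P. (f m :: complex) * c)"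
  by (induction P) (auto simp: distrib_right)

context haar_measure
begin

lemma unitary_carrier: "g \<in> unitary_group N \<Longrightarrow> g \<in> carrier_mat N N"
  by (simp add: unitary_group_def)

text \<open>Leibniz rule: each of the k factors g is replaced in turn by E_ab g, giving the entries
  of g^p E_ab g^(k - p) for p < k.\<close>

lemma Der_pw:
  assumes ij: "i < N" "j < N"
  shows "Der (\<lambda>g. pw k g i j) (\<lambda>a b g. \<Sum>p<k. pw p g i a * pw (k - p) g b j)"
  using ij
proof (induction k arbitrary: j)
  case 0
  then show ?case using pw_0[OF unitary_carrier] by (intro Der_cong[OF Der_const[of "if i = j then 1 else 0"]]) auto
next
  case (Suc k)
  have "Der (\<lambda>g. \<Sum>l<N. pw k g i l * g $$ (l, j))
     (\<lambda>a b g. \<Sum>l<N. (\<Sum>p<k. pw p g i a * pw (k - p) g b l) * g $$ (l, j) + pw k g i l * (if a = l then g $$ (b, j) else 0))"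
    using Suc by (intro Der_sum Der_mult Der_entry Suc.IH) auto
  then show ?case
  proof (rule Der_cong)
    fix g assume g: "g \<in> unitary_group N"
    show "(\<Sum>l<N. pw k g i l * g $$ (l, j)) = pw (Suc k) g i j"
      using Suc.prems by (simp add: pw_Suc[OF unitary_carrier[OF g]])
    fix a b assume ab: "a < N" "b < N"
    have "(\<Sum>l<N. (\<Sum>p<k. pw p g i a * pw (k - p) g b l) * g $$ (l, j) + pw k g i l * (if a = l then g $$ (b, j) else 0))
      = (\<Sum>l<N. \<Sum>p<k. pw p g i a * (pw (k - p) g b l * g $$ (l, j))) + (\<Sum>l<N. if l = a then pw k g i a * g $$ (b, j) else 0)"
      unfolding sum.distrib sum_distrib_right mult.assoc by (intro arg_cong2[of _ _ _ _ "(+)"] refl sum.cong) auto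
    also have "(\<Sum>l<N. if l = a then pw k g i a * g $$ (b, j) else 0) = pw k g i a * pw (Suc k - k) g b j"
      using ab Suc.prems by (simp add: pw_1[OF unitary_carrier[OF g]])
    also have "(\<Sum>l<N. \<Sum>p<k. pw p g i a * (pw (k - p) g b l * g $$ (l, j))) = (\<Sum>p<k. pw p g i a * pw (Suc k - p) g b j)"
    proof -
      have "(\<Sum>l<N. \<Sum>p<k. pw p g i a * (pw (k - p) g b l * g $$ (l, j))) = (\<Sum>p<k. \<Sum>l<N. pw p g i a * (pw (k - p) g b l * g $$ (l, j)))"
        by (rule sum.swap)
      also have "\<dots> = (\<Sum>p<k. pw p g i a * pw (Suc k - p) g b j)"
        using ab Suc.prems
        by (intro sum.cong refl) (simp add: pw_Suc[OF unitary_carrier[OF g]] Suc_diff_le flip: sum_distrib_left)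
      finally show ?thesis .
    qed
    finally show "(\<Sum>l<N. (\<Sum>p<k. pw p g i a * pw (k - p) g b l) * g $$ (l, j) + pw k g i l * (if a = l then g $$ (b, j) else 0))
      = (\<Sum>p<Suc k. pw p g i a * pw (Suc k - p) g b j)" by simp
  qed
qed

text \<open>All k insertions g^p E_ab g^(k - p) have the same trace (g^k)_ba.\<close>

lemma Der_powtr: "Der (powtr N k) (\<lambda>a b g. of_nat k * pw k g b a)"
proof -
  have "Der (\<lambda>g. \<Sum>i<N. pw k g i i) (\<lambda>a b g. \<Sum>i<N. \<Sum>p<k. pw p g i a * pw (k - p) g b i)"
    by (intro Der_sum Der_pw) auto
  then show ?thesis
  proof (rule Der_cong)
    fix g a b assume g: "g \<in> unitary_group N" and ab: "a < N" "b < N"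
    have "(\<Sum>i<N. \<Sum>p<k. pw p g i a * pw (k - p) g b i) = (\<Sum>p<k. \<Sum>i<N. pw (k - p) g b i * pw p g i a)"
      by (subst sum.swap) (simp add: mult.commute)
    also have "\<dots> = (\<Sum>p<k. pw k g b a)"
      using pw_add[OF unitary_carrier[OF g] ab(2,1)] by (intro sum.cong refl) (metis le_add_diff_inverse2 lessThan_iff less_imp_le)
    finally show "(\<Sum>i<N. \<Sum>p<k. pw p g i a * pw (k - p) g b i) = of_nat k * pw k g b a" by simp
  qed (simp add: powtr_def)
qed

lemma Der_powtr_prod:
  "Der (powtr_prod N P) (\<lambda>a b g. \<Sum>m\<in>#P. of_nat m * pw m g b a * powtr_prod N (P - {#m#}) g)"
proof (induction P)
  case empty
  show ?case using Der_const[of 1] by (rule Der_cong) auto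
next
  case (add x P)
  from Der_mult[OF Der_powtr add, of x] show ?case
  proof (rule Der_cong)
    fix g a b
    have "(\<Sum>m\<in>#P. of_nat m * pw m g b a * powtr_prod N (add_mset x P - {#m#}) g)
      = (\<Sum>m\<in>#P. powtr N x g * (of_nat m * pw m g b a * powtr_prod N (P - {#m#}) g))"
      by (intro arg_cong[where f = sum_mset] image_mset_cong) (auto simp: add_mset_remove_trivial_If diff_union_swap2 mult_ac simp flip: insert_DiffM)
    then show "of_nat x * pw x g b a * powtr_prod N P g + powtr N x g * (\<Sum>m\<in>#P. of_nat m * pw m g b a * powtr_prod N (P - {#m#}) g)
      = (\<Sum>m\<in>#add_mset x P. of_nat m * pw m g b a * powtr_prod N (add_mset x P - {#m#}) g)"
      by (simp only: image_mset_add_mset sum_mset.add_mset add_mset_remove_trivial sum_mset_mult_left)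
  qed simp
qed

text \<open>A Schwinger-Dyson equation: differentiate (g^k)_ab * powtr_prod P * cnj (powtr_prod Q)
  in direction E_ab and sum over a and b. Differentiating g^k splits its trace into two, a factor of
  P is merged with it, and a factor of Q is contracted against it by unitarity, with a minus sign
  from the conjugation.\<close>

theorem loop_equation:
  assumes k: "0 < k"
  shows "expectation (\<lambda>g. (\<Sum>p<k. powtr N p g * powtr N (k - p) g * (powtr_prod N P g * cnj (powtr_prod N Q g)))
     + (\<Sum>m\<in>#P. of_nat m * (powtr N (k + m) g * powtr_prod N (P - {#m#}) g * cnj (powtr_prod N Q g)))
     - (\<Sum>j\<in>#Q. of_nat j * ((if j \<le> k then powtr N (k - j) g else cnj (powtr N (j - k) g))
            * (powtr_prod N P g * cnj (powtr_prod N (Q - {#j#}) g))))) = 0"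
    (is "expectation ?G = 0")
proof -
  define \<Psi> where "\<Psi> = (\<lambda>i j a b g. (\<Sum>p<k. pw p g i a * pw (k - p) g b j) * (powtr_prod N P g * cnj (powtr_prod N Q g)) +
       pw k g i j * ((\<Sum>m\<in>#P. of_nat m * pw m g b a * powtr_prod N (P - {#m#}) g) * cnj (powtr_prod N Q g)
          + powtr_prod N P g * - cnj (\<Sum>m\<in>#Q. of_nat m * pw m g a b * powtr_prod N (Q - {#m#}) g)))"
  have D: "Der (\<lambda>g. pw k g i j * (powtr_prod N P g * cnj (powtr_prod N Q g))) (\<Psi> i j)" if "i < N" "j < N" for i j
    unfolding \<Psi>_def by (intro Der_mult Der_pw that Der_powtr_prod Der_cnj[OF Der_powtr_prod])
  have "expectation (\<lambda>g. \<Sum>a<N. \<Sum>b<N. \<Psi> a b a b g) = (\<Sum>a<N. expectation (\<lambda>g. \<Sum>b<N. \<Psi> a b a b g))"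
    by (intro Bochner_Integration.integral_sum Bochner_Integration.integrable_sum Der_integrable'[OF D]) auto
  also have "\<dots> = (\<Sum>a<N. \<Sum>b<N. expectation (\<Psi> a b a b))"
    by (intro sum.cong refl Bochner_Integration.integral_sum Der_integrable'[OF D]) auto
  also have "\<dots> = 0" by (intro sum.neutral ballI Der_expectation_zero[OF D]) auto
  finally have z: "expectation (\<lambda>g. \<Sum>a<N. \<Sum>b<N. \<Psi> a b a b g) = 0" .
  have "(\<Sum>a<N. \<Sum>b<N. \<Psi> a b a b g) = ?G g" if "g \<in> space M" for g
  proof -
    have g: "g \<in> unitary_group N" and c: "g \<in> carrier_mat N N"
      using that by (auto simp: space_M unitary_group_def)
    have 1: "(\<Sum>a<N. \<Sum>b<N. (\<Sum>p<k. pw p g a a * pw (k - p) g b b)) = (\<Sum>p<k. powtr N p g * powtr N (k - p) g)"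
    proof -
      have "(\<Sum>a<N. \<Sum>b<N. (\<Sum>p<k. pw p g a a * pw (k - p) g b b)) = (\<Sum>a<N. \<Sum>p<k. \<Sum>b<N. pw p g a a * pw (k - p) g b b)"
        by (intro sum.cong refl sum.swap)
      also have "\<dots> = (\<Sum>p<k. \<Sum>a<N. \<Sum>b<N. pw p g a a * pw (k - p) g b b)" by (rule sum.swap)
      finally show ?thesis by (simp add: powtr_def sum_product)
    qed
    have 2: "(\<Sum>a<N. \<Sum>b<N. pw k g a b * (\<Sum>m\<in>#P. of_nat m * pw m g b a * powtr_prod N (P - {#m#}) g))
       = (\<Sum>m\<in>#P. of_nat m * (powtr N (k + m) g * powtr_prod N (P - {#m#}) g))"
      unfolding sum_mset_mult_left sum_sum_mset_swap
      by (intro arg_cong[where f = sum_mset] image_mset_cong)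
        (simp add: sum_pw_mult[OF c, symmetric] sum_distrib_left sum_distrib_right mult_ac)
    have 3: "(\<Sum>a<N. \<Sum>b<N. pw k g a b * cnj (\<Sum>m\<in>#Q. of_nat m * pw m g a b * powtr_prod N (Q - {#m#}) g))
       = (\<Sum>j\<in>#Q. of_nat j * ((if j \<le> k then powtr N (k - j) g else cnj (powtr N (j - k) g)) * cnj (powtr_prod N (Q - {#j#}) g)))"
      unfolding cnj_sum_mset sum_mset_mult_left sum_sum_mset_swap
      by (intro arg_cong[where f = sum_mset] image_mset_cong)
        (simp only: sum_pw_cnj[OF g, symmetric] sum_distrib_left sum_distrib_right complex_cnj_mult complex_cnj_of_nat mult_ac)
    define X where "X = powtr_prod N P g"
    define Y where "Y = cnj (powtr_prod N Q g)"
    define U where "U = (\<lambda>b a. \<Sum>m\<in>#P. of_nat m * pw m g b a * powtr_prod N (P - {#m#}) g)"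
    define V where "V = (\<lambda>a b. cnj (\<Sum>m\<in>#Q. of_nat m * pw m g a b * powtr_prod N (Q - {#m#}) g))"
    define R where "R = (\<lambda>a b. \<Sum>p<k. pw p g a a * pw (k - p) g b b)"
    have "\<Psi> a b a b g = R a b * (X * Y) + pw k g a b * U b a * Y - X * (pw k g a b * V a b)" for a b
    proof -
      have "\<Psi> a b a b g = R a b * (X * Y) + pw k g a b * (U b a * Y + X * - V a b)"
        by (simp only: \<Psi>_def U_def V_def R_def X_def Y_def)
      then show ?thesis by (simp add: algebra_simps)
    qed
    then have "(\<Sum>a<N. \<Sum>b<N. \<Psi> a b a b g) = (\<Sum>a<N. \<Sum>b<N. R a b) * (X * Y)
      + (\<Sum>a<N. \<Sum>b<N. pw k g a b * U b a) * Y - X * (\<Sum>a<N. \<Sum>b<N. pw k g a b * V a b)"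
      by (simp add: sum.distrib sum_distrib_left sum_distrib_right sum_subtractf)
    also have "\<dots> = ?G g"
      unfolding R_def U_def V_def 1 2 3
      by (simp only: X_def[symmetric] Y_def[symmetric] sum_distrib_right sum_distrib_left sum_mset_mult_left sum_mset_mult_right mult_ac)
    finally show ?thesis .
  qed
  then show ?thesis using z by (simp cong: Bochner_Integration.integral_cong)
qed

end

section \<open>Moments of power sums of the eigenvalues\<close>

lemma sum_mset_swap:
  fixes f :: "'a \<Rightarrow> 'b \<Rightarrow> 'c :: comm_monoid_add"
  shows "(\<Sum>i\<in>#A. \<Sum>j\<in>#B. f i j) = (\<Sum>j\<in>#B. \<Sum>i\<in>#A. f i j)"
  by (induction A) (auto simp: sum_mset.distrib)

lemma norm_sum_mset_le:
  fixes f :: "'a \<Rightarrow> 'b :: real_normed_vector"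
  assumes "\<And>x. x \<in># A \<Longrightarrow> norm (f x) \<le> g x"
  shows "norm (\<Sum>x\<in>#A. f x) \<le> (\<Sum>x\<in>#A. g x)"
  using assms by (induction A) (auto intro!: norm_triangle_mono)

lemma sum_mset_if_eq:
  fixes c :: "'b :: semiring_1"
  shows "(\<Sum>b\<in>#Q. if b = k then c else 0) = of_nat (count Q k) * c"
  by (induction Q) (auto simp: distrib_right)

lemma zee_superset:
  assumes "finite A" "set_mset l \<subseteq> A"
  shows "zee l = (\<Prod>i\<in>A. i ^ count l i * fact (count l i))"
  unfolding zee_def using assms
  by (intro prod.mono_neutral_left) (auto simp: not_in_iff)

lemma zee_add_mset: "zee (add_mset k l) = k * Suc (count l k) * zee l"
proof -
  define A where "A = insert k (set_mset l)"
  have 1: "zee (add_mset k l) = (\<Prod>i\<in>A. i ^ count (add_mset k l) i * fact (count (add_mset k l) i))"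
    by (rule zee_superset) (auto simp: A_def)
  have 2: "zee l = (\<Prod>i\<in>A. i ^ count l i * fact (count l i))"
    by (rule zee_superset) (auto simp: A_def)
  have k: "finite A" "k \<in> A" by (auto simp: A_def)
  have "(\<Prod>i\<in>A - {k}. i ^ count (add_mset k l) i * fact (count (add_mset k l) i)) = (\<Prod>i\<in>A - {k}. i ^ count l i * fact (count l i))"
    by (intro prod.cong) auto
  then show ?thesis unfolding 1 2 prod.remove[OF k] by (simp add: algebra_simps)
qed

text \<open>The Hall inner product of the power-sum symmetric functions indexed by P and Q.\<close>

definition hall_inner :: "nat multiset \<Rightarrow> nat multiset \<Rightarrow> complex" where
  "hall_inner P Q = (if P = Q then of_nat (zee P) else 0)"

lemma hall_inner_commute: "hall_inner P Q = hall_inner Q P"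
  by (auto simp: hall_inner_def)

text \<open>Multiplication by the power sum p_k is adjoint to k times the derivative with respect to
  p_k; the derivative appears as a sum over the parts of Q equal to k.\<close>

lemma hall_inner_add_mset:
  "hall_inner (add_mset k P) Q = (\<Sum>b\<in>#Q. if b = k then of_nat k * hall_inner P (Q - {#b#}) else 0)"
proof -
  have "(\<Sum>b\<in>#Q. if b = k then of_nat k * hall_inner P (Q - {#b#}) else 0)
    = (\<Sum>b\<in>#Q. if b = k then of_nat k * hall_inner P (Q - {#k#}) else 0)"
    by (intro arg_cong[where f = sum_mset] image_mset_cong) auto
  also have "\<dots> = of_nat (count Q k) * (of_nat k * hall_inner P (Q - {#k#}))"
    by (rule sum_mset_if_eq)
  also have "\<dots> = hall_inner (add_mset k P) Q"
  proof (cases "k \<in># Q")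
    case True
    from multi_member_split[OF this] obtain R where R: "Q = add_mset k R" by blast
    show ?thesis unfolding R by (auto simp: hall_inner_def zee_add_mset algebra_simps)
  next
    case False
    then have "add_mset k P \<noteq> Q" by auto
    then show ?thesis using False by (simp add: hall_inner_def not_in_iff)
  qed
  finally show ?thesis ..
qed

text \<open>The contraction of g^k with a conjugated factor of index j. The case j = k is separate
  because the trace of g^0 is N, so that the arguments of T never contain a part 0.\<close>

definition loop_rhs :: "nat \<Rightarrow> (nat multiset \<Rightarrow> nat multiset \<Rightarrow> complex) \<Rightarrow> nat \<Rightarrow> nat multiset \<Rightarrow> nat multiset \<Rightarrow> nat \<Rightarrow> complex" where
  "loop_rhs N T k P Q j = (if j < k then T (add_mset (k - j) P) (Q - {#j#})
      else if j = k then of_nat N * T P (Q - {#j#}) else T P (add_mset (j - k) (Q - {#j#})))"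

text \<open>The loop equations for an abstract family T. The splitting term p = 0 equals N * T
  (add_mset k P) Q and is taken out of the sum: it is the diagonal of the system.\<close>

definition loop_system :: "nat \<Rightarrow> (nat multiset \<Rightarrow> nat multiset \<Rightarrow> complex) \<Rightarrow> bool" where
  "loop_system N T \<longleftrightarrow> (\<forall>k P Q. 0 < k \<and> 0 \<notin># P \<and> 0 \<notin># Q \<longrightarrow>
     of_nat N * T (add_mset k P) Q + (\<Sum>p\<in>{1..<k}. T (add_mset p (add_mset (k - p) P)) Q)
       + (\<Sum>m\<in>#P. of_nat m * T (add_mset (k + m) (P - {#m#})) Q)
     = (\<Sum>j\<in>#Q. of_nat j * loop_rhs N T k P Q j))"

text \<open>By adjointness the three terms on the left match the three cases on the right: the term
  with N gives j = k, splitting gives j < k, and merging gives j > k.\<close>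

lemma loop_system_hall_inner: "loop_system N hall_inner"
  unfolding loop_system_def
proof (intro allI impI, elim conjE)
  fix k :: nat and P Q :: "nat multiset" assume k: "0 < k" and P: "0 \<notin># P" and Q: "0 \<notin># Q"
  have 1: "of_nat N * hall_inner (add_mset k P) Q = (\<Sum>j\<in>#Q. if j = k then of_nat j * (of_nat N * hall_inner P (Q - {#j#})) else 0)"
    unfolding hall_inner_add_mset sum_mset_mult_left
    by (intro arg_cong[where f = sum_mset] image_mset_cong) auto
  have 2: "(\<Sum>p\<in>{1..<k}. hall_inner (add_mset p (add_mset (k - p) P)) Q)
     = (\<Sum>j\<in>#Q. if j < k then of_nat j * hall_inner (add_mset (k - j) P) (Q - {#j#}) else 0)"
    unfolding hall_inner_add_mset[of _ "add_mset _ P"] sum_sum_mset_swap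
  proof (intro arg_cong[where f = sum_mset] image_mset_cong)
    fix j assume "j \<in># Q"
    then have j: "0 < j" using Q by (metis neq0_conv)
    have "(\<Sum>p\<in>{1..<k}. if j = p then of_nat p * hall_inner (add_mset (k - p) P) (Q - {#j#}) else 0)
      = (\<Sum>p\<in>{1..<k}. if j = p then of_nat j * hall_inner (add_mset (k - j) P) (Q - {#j#}) else 0)"
      by (intro sum.cong) auto
    also have "\<dots> = (if j < k then of_nat j * hall_inner (add_mset (k - j) P) (Q - {#j#}) else 0)"
      using j by (auto simp: sum.delta')
    finally show "(\<Sum>p\<in>{1..<k}. if j = p then of_nat p * hall_inner (add_mset (k - p) P) (Q - {#j#}) else 0)
      = (if j < k then of_nat j * hall_inner (add_mset (k - j) P) (Q - {#j#}) else 0)" .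
  qed
  have 3: "(\<Sum>m\<in>#P. of_nat m * hall_inner (add_mset (k + m) (P - {#m#})) Q)
     = (\<Sum>j\<in>#Q. if k < j then of_nat j * hall_inner P (add_mset (j - k) (Q - {#j#})) else 0)"
  proof -
    have "(\<Sum>m\<in>#P. of_nat m * hall_inner (add_mset (k + m) (P - {#m#})) Q)
      = (\<Sum>m\<in>#P. \<Sum>j\<in>#Q. of_nat m * (if j = k + m then of_nat (k + m) * hall_inner (P - {#m#}) (Q - {#j#}) else 0))"
      unfolding hall_inner_add_mset sum_mset_mult_left ..
    also have "\<dots> = (\<Sum>j\<in>#Q. \<Sum>m\<in>#P. of_nat m * (if j = k + m then of_nat (k + m) * hall_inner (P - {#m#}) (Q - {#j#}) else 0))"
      by (rule sum_mset_swap)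
    also have "\<dots> = (\<Sum>j\<in>#Q. if k < j then of_nat j * hall_inner P (add_mset (j - k) (Q - {#j#})) else 0)"
    proof (intro arg_cong[where f = sum_mset] image_mset_cong)
      fix j assume "j \<in># Q"
      show "(\<Sum>m\<in>#P. of_nat m * (if j = k + m then of_nat (k + m) * hall_inner (P - {#m#}) (Q - {#j#}) else 0))
        = (if k < j then of_nat j * hall_inner P (add_mset (j - k) (Q - {#j#})) else 0)"
      proof (cases "k < j")
        case True
        have "of_nat j * hall_inner P (add_mset (j - k) (Q - {#j#}))
          = (\<Sum>m\<in>#P. of_nat j * (if m = j - k then of_nat (j - k) * hall_inner (Q - {#j#}) (P - {#m#}) else 0))"
          unfolding hall_inner_commute[of P] hall_inner_add_mset sum_mset_mult_left ..
        also have "\<dots> = (\<Sum>m\<in>#P. of_nat m * (if j = k + m then of_nat (k + m) * hall_inner (P - {#m#}) (Q - {#j#}) else 0))"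
          using True by (intro arg_cong[where f = sum_mset] image_mset_cong) (auto simp: hall_inner_commute[of "Q - _"])
        finally show ?thesis using True by simp
      next
        case False
        have "m \<in># P \<Longrightarrow> j \<noteq> k + m" for m using False P by (metis le_add1 less_add_same_cancel1 neq0_conv)
        then have "(\<Sum>m\<in>#P. of_nat m * (if j = k + m then of_nat (k + m) * hall_inner (P - {#m#}) (Q - {#j#}) else 0)) = (\<Sum>m\<in>#P. 0)"
          by (intro arg_cong[where f = sum_mset] image_mset_cong) auto
        then show ?thesis using False by simp
      qed
    qed
    finally show ?thesis .
  qed
  show "of_nat N * hall_inner (add_mset k P) Q + (\<Sum>p\<in>{1..<k}. hall_inner (add_mset p (add_mset (k - p) P)) Q)
       + (\<Sum>m\<in>#P. of_nat m * hall_inner (add_mset (k + m) (P - {#m#})) Q)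
     = (\<Sum>j\<in>#Q. of_nat j * loop_rhs N hall_inner k P Q j)"
    unfolding 1 2 3 sum_mset.distrib[symmetric]
    by (intro arg_cong[where f = sum_mset] image_mset_cong) (auto simp: loop_rhs_def)
qed

lemma loop_system_diff:
  assumes "loop_system N S" "loop_system N T"
  shows "loop_system N (\<lambda>P Q. S P Q - T P Q)"
  unfolding loop_system_def
proof (intro allI impI)
  fix k :: nat and P Q :: "nat multiset" assume *: "0 < k \<and> 0 \<notin># P \<and> 0 \<notin># Q"
  have r: "loop_rhs N (\<lambda>P Q. S P Q - T P Q) k P Q j = loop_rhs N S k P Q j - loop_rhs N T k P Q j" for j
    by (simp add: loop_rhs_def right_diff_distrib)
  have d: "(\<Sum>m\<in>#A. f m - g m) = (\<Sum>m\<in>#A. f m) - (\<Sum>m\<in>#A. (g m :: complex))" for A :: "nat multiset" and f g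
    by (induction A) auto
  have s: "of_nat N * S (add_mset k P) Q + (\<Sum>p\<in>{1..<k}. S (add_mset p (add_mset (k - p) P)) Q)
       + (\<Sum>m\<in>#P. of_nat m * S (add_mset (k + m) (P - {#m#})) Q)
     = (\<Sum>j\<in>#Q. of_nat j * loop_rhs N S k P Q j)" using assms(1) * unfolding loop_system_def by blast
  have t: "of_nat N * T (add_mset k P) Q + (\<Sum>p\<in>{1..<k}. T (add_mset p (add_mset (k - p) P)) Q)
       + (\<Sum>m\<in>#P. of_nat m * T (add_mset (k + m) (P - {#m#})) Q)
     = (\<Sum>j\<in>#Q. of_nat j * loop_rhs N T k P Q j)" using assms(2) * unfolding loop_system_def by blast
  show "of_nat N * (S (add_mset k P) Q - T (add_mset k P) Q) + (\<Sum>p\<in>{1..<k}. S (add_mset p (add_mset (k - p) P)) Q - T (add_mset p (add_mset (k - p) P)) Q)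
       + (\<Sum>m\<in>#P. of_nat m * (S (add_mset (k + m) (P - {#m#})) Q - T (add_mset (k + m) (P - {#m#})) Q))
     = (\<Sum>j\<in>#Q. of_nat j * loop_rhs N (\<lambda>P Q. S P Q - T P Q) k P Q j)"
    unfolding r right_diff_distrib d sum_subtractf s[symmetric] t[symmetric] by (simp add: algebra_simps)
qed

lemma size_le_sum_mset: "0 \<notin># P \<Longrightarrow> size P \<le> sum_mset (P :: nat multiset)"
  by (induction P) auto

lemma finite_partitions_of: "finite {P :: nat multiset. 0 \<notin># P \<and> sum_mset P = K}"
proof (rule finite_subset)
  show "finite (mset ` {xs. set xs \<subseteq> {..K} \<and> length xs \<le> K})"
    by (intro finite_imageI finite_lists_length_le) auto
  show "{P. 0 \<notin># P \<and> sum_mset P = K} \<subseteq> mset ` {xs. set xs \<subseteq> {..K} \<and> length xs \<le> K}"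
  proof
    fix P assume "P \<in> {P. 0 \<notin># P \<and> sum_mset P = K}"
    then have P: "0 \<notin># P" "sum_mset P = K" by auto
    obtain xs where xs: "mset xs = P" using ex_mset by blast
    have "x \<le> K" if "x \<in> set xs" for x
    proof -
      have "x \<in># P" using that xs by auto
      from multi_member_split[OF this] obtain R where "P = add_mset x R" by blast
      then show ?thesis using P(2) by auto
    qed
    moreover have "length xs \<le> K" using size_le_sum_mset[OF P(1)] P(2) xs by auto
    ultimately show "P \<in> mset ` {xs. set xs \<subseteq> {..K} \<and> length xs \<le> K}" using xs by auto
  qed
qed

text \<open>For partitions of \<open>K \<le> N\<close> the system is strictly diagonally dominant: the off-diagonal
  coefficients add up to \<open>K - 1 < N\<close>.\<close>

lemma loop_system_unique:
  assumes loop: "loop_system N d" and base: "\<And>Q. 0 \<notin># Q \<Longrightarrow> d {#} Q = 0"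
  shows "0 \<notin># P \<Longrightarrow> 0 \<notin># Q \<Longrightarrow> sum_mset P \<le> N \<Longrightarrow> d P Q = 0"
proof (induction "sum_mset P" arbitrary: P Q rule: less_induct)
  case less
  define K where "K = sum_mset P"
  define PP where "PP = {R :: nat multiset. 0 \<notin># R \<and> sum_mset R = K}"
  have fin: "finite PP" unfolding PP_def by (rule finite_partitions_of)
  have P: "P \<in> PP" using less.prems by (simp add: PP_def K_def)
  define S where "S = Max ((\<lambda>R. norm (d R Q)) ` PP)"
  have le: "norm (d R Q) \<le> S" if "R \<in> PP" for R unfolding S_def using fin that by auto
  have "S \<in> (\<lambda>R. norm (d R Q)) ` PP" unfolding S_def using fin P by (intro Max_in) auto
  then obtain R where R: "R \<in> PP" "S = norm (d R Q)" by blast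
  have "S = 0"
  proof (cases "R = {#}")
    case True
    then show ?thesis using R base less.prems by simp
  next
    case False
    then obtain k where kR: "k \<in># R" by blast
    define B where "B = R - {#k#}"
    have RB: "R = add_mset k B" using kR by (simp add: B_def)
    have k: "0 < k" "0 \<notin># B" "k + sum_mset B = K" using R RB by (auto simp: PP_def)
    have KN: "K \<le> N" using less.prems by (simp add: K_def)
    have S0: "0 \<le> S" using R by simp
    \<comment> \<open>In all three cases the first argument has degree below K, so the right-hand
      side vanishes by induction and a homogeneous system within degree K remains.\<close>
    have rhs: "loop_rhs N d k B Q j = 0" if "j \<in># Q" for j
    proof -
      have j: "0 < j" using that less.prems by (metis neq0_conv)
      have Qj: "0 \<notin># Q - {#j#}" using less.prems by (meson in_diffD)
      have IH: "d X Y = 0" if "0 \<notin># X" "0 \<notin># Y" "sum_mset X < K" for X Y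
        using less.hyps[of X Y] that less.prems by (auto simp: K_def)
      show ?thesis unfolding loop_rhs_def using j k Qj by (auto intro!: IH)
    qed
    have "(\<Sum>j\<in>#Q. of_nat j * loop_rhs N d k B Q j) = (\<Sum>j\<in>#Q. 0)"
      by (intro arg_cong[where f = sum_mset] image_mset_cong) (simp add: rhs)
    then have "of_nat N * d R Q + (\<Sum>p\<in>{1..<k}. d (add_mset p (add_mset (k - p) B)) Q)
       + (\<Sum>m\<in>#B. of_nat m * d (add_mset (k + m) (B - {#m#})) Q) = 0"
      using loop k less.prems unfolding loop_system_def RB by simp
    then have "of_nat N * d R Q = - ((\<Sum>p\<in>{1..<k}. d (add_mset p (add_mset (k - p) B)) Q)
       + (\<Sum>m\<in>#B. of_nat m * d (add_mset (k + m) (B - {#m#})) Q))"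
      by (simp only: eq_neg_iff_add_eq_0 add.assoc)
    from arg_cong[OF this, of norm] have "real N * S = norm ((\<Sum>p\<in>{1..<k}. d (add_mset p (add_mset (k - p) B)) Q)
       + (\<Sum>m\<in>#B. of_nat m * d (add_mset (k + m) (B - {#m#})) Q))"
      unfolding R(2) by (simp only: norm_minus_cancel norm_mult norm_of_nat)
    also have "\<dots> \<le> (\<Sum>p\<in>{1..<k}. S) + (\<Sum>m\<in>#B. real m * S)"
    proof (intro norm_triangle_mono sum_norm_le norm_sum_mset_le)
      fix p assume "p \<in> {1..<k}"
      then show "norm (d (add_mset p (add_mset (k - p) B)) Q) \<le> S" using k by (intro le) (auto simp: PP_def)
    next
      fix m assume m: "m \<in># B"
      have "sum_mset B = m + sum_mset (B - {#m#})" using m by (subst insert_DiffM[OF m, symmetric]) (rule sum_mset.add_mset)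
      then have "norm (d (add_mset (k + m) (B - {#m#})) Q) \<le> S" using k m
        by (intro le) (auto simp: PP_def dest: in_diffD)
      then show "norm (of_nat m * d (add_mset (k + m) (B - {#m#})) Q) \<le> real m * S"
        by (simp add: norm_mult mult_left_mono)
    qed
    also have "(\<Sum>m\<in>#B. real m * S) = real (sum_mset B) * S"
      by (induction B) (auto simp: algebra_simps)
    also have "(\<Sum>p\<in>{1..<k}. S) + real (sum_mset B) * S = (real K - 1) * S"
      using k by (simp add: algebra_simps of_nat_diff flip: k(3))
    also have "\<dots> \<le> (real N - 1) * S" using KN S0 by (intro mult_right_mono) auto
    finally show ?thesis using S0 by (simp add: algebra_simps)
  qed
  then show ?case using le[OF P] by simp
qed

section \<open>Haar moments of products of traces\<close>

context haar_measure
begin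

definition powtr_moment :: "nat multiset \<Rightarrow> nat multiset \<Rightarrow> complex" where
  "powtr_moment P Q = expectation (\<lambda>g. powtr_prod N P g * cnj (powtr_prod N Q g))"

lemma integrable_powtr_prod: "integrable M (\<lambda>g. powtr_prod N P g * cnj (powtr_prod N Q g))"
  by (rule Der_integrable[OF Der_mult[OF Der_powtr_prod Der_cnj[OF Der_powtr_prod]]])

lemma integral_sum_mset:
  fixes f :: "'b \<Rightarrow> complex mat \<Rightarrow> complex"
  assumes "\<And>x. integrable M (f x)"
  shows "integrable M (\<lambda>g. \<Sum>x\<in>#A. f x g)" "expectation (\<lambda>g. \<Sum>x\<in>#A. f x g) = (\<Sum>x\<in>#A. expectation (f x))"
  using assms by (induction A) auto

lemma powtr_moment_0:
  "powtr_moment (add_mset 0 P) Q = of_nat N * powtr_moment P Q"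
proof -
  have "powtr_moment (add_mset 0 P) Q = expectation (\<lambda>g. of_nat N * (powtr_prod N P g * cnj (powtr_prod N Q g)))"
    unfolding powtr_moment_def
    by (intro Bochner_Integration.integral_cong refl) (auto simp: space_M powtr_0[OF unitary_carrier])
  then show ?thesis by (simp add: powtr_moment_def)
qed

lemma loop_system_powtr_moment: "loop_system N powtr_moment"
  unfolding loop_system_def
proof (intro allI impI, elim conjE)
  fix k :: nat and P Q :: "nat multiset" assume k: "0 < k" and P: "0 \<notin># P" and Q: "0 \<notin># Q"
  define f1 where "f1 = (\<lambda>p g. powtr_prod N (add_mset p (add_mset (k - p) P)) g * cnj (powtr_prod N Q g))"
  define f2 where "f2 = (\<lambda>m g. of_nat m * (powtr_prod N (add_mset (k + m) (P - {#m#})) g * cnj (powtr_prod N Q g)))"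
  define f3 where "f3 = (\<lambda>j g. of_nat j * (if j \<le> k then powtr_prod N (add_mset (k - j) P) g * cnj (powtr_prod N (Q - {#j#}) g)
     else powtr_prod N P g * cnj (powtr_prod N (add_mset (j - k) (Q - {#j#})) g)))"
  have i1: "integrable M (f1 p)" for p unfolding f1_def by (rule integrable_powtr_prod)
  have i2: "integrable M (f2 p)" for p unfolding f2_def by (intro integrable_mult_right integrable_powtr_prod)
  have i3: "integrable M (f3 p)" for p unfolding f3_def
    by (cases "p \<le> k") (simp_all add: integrable_powtr_prod del: powtr_prod_add)
  have "0 = expectation (\<lambda>g. (\<Sum>p<k. f1 p g) + (\<Sum>m\<in>#P. f2 m g) - (\<Sum>j\<in>#Q. f3 j g))"
    unfolding loop_equation[OF k, of P Q, symmetric]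
    by (intro Bochner_Integration.integral_cong refl arg_cong2[of _ _ _ _ "(-)"] arg_cong2[of _ _ _ _ "(+)"] sum.cong
          arg_cong[where f = sum_mset] image_mset_cong)
       (auto simp: f1_def f2_def f3_def mult_ac)
  also have "\<dots> = expectation (\<lambda>g. (\<Sum>p<k. f1 p g)) + expectation (\<lambda>g. (\<Sum>m\<in>#P. f2 m g)) - expectation (\<lambda>g. (\<Sum>j\<in>#Q. f3 j g))"
    using i1 i2 i3 by (simp add: integral_sum_mset)
  also have "expectation (\<lambda>g. (\<Sum>p<k. f1 p g)) = (\<Sum>p<k. powtr_moment (add_mset p (add_mset (k - p) P)) Q)"
    using i1 unfolding powtr_moment_def f1_def by (intro Bochner_Integration.integral_sum) auto
  also have "\<dots> = of_nat N * powtr_moment (add_mset k P) Q + (\<Sum>p\<in>{1..<k}. powtr_moment (add_mset p (add_mset (k - p) P)) Q)"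
  proof -
    have "{..<k} = insert 0 {1..<k}" using k by auto
    then show ?thesis by (simp add: powtr_moment_0)
  qed
  also have "expectation (\<lambda>g. (\<Sum>m\<in>#P. f2 m g)) = (\<Sum>m\<in>#P. of_nat m * powtr_moment (add_mset (k + m) (P - {#m#})) Q)"
    unfolding integral_sum_mset(2)[OF i2] by (simp add: f2_def powtr_moment_def del: powtr_prod_add)
  also have "expectation (\<lambda>g. (\<Sum>j\<in>#Q. f3 j g)) = (\<Sum>j\<in>#Q. of_nat j * loop_rhs N powtr_moment k P Q j)"
    unfolding integral_sum_mset(2)[OF i3]
  proof (intro arg_cong[where f = sum_mset] image_mset_cong)
    fix j
    have "j \<le> k \<Longrightarrow> expectation (f3 j) = of_nat j * powtr_moment (add_mset (k - j) P) (Q - {#j#})"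
      by (simp add: f3_def powtr_moment_def del: powtr_prod_add)
    moreover have "\<not> j \<le> k \<Longrightarrow> expectation (f3 j) = of_nat j * powtr_moment P (add_mset (j - k) (Q - {#j#}))"
      by (simp add: f3_def powtr_moment_def del: powtr_prod_add)
    ultimately show "expectation (f3 j) = of_nat j * loop_rhs N powtr_moment k P Q j"
      by (cases j k rule: linorder_cases) (auto simp: loop_rhs_def powtr_moment_0)
  qed
  finally show "of_nat N * powtr_moment (add_mset k P) Q + (\<Sum>p\<in>{1..<k}. powtr_moment (add_mset p (add_mset (k - p) P)) Q)
       + (\<Sum>m\<in>#P. of_nat m * powtr_moment (add_mset (k + m) (P - {#m#})) Q)
     = (\<Sum>j\<in>#Q. of_nat j * loop_rhs N powtr_moment k P Q j)"
    by (simp add: algebra_simps)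
qed

text \<open>Translation by the scalar matrix cis \<theta> multiplies the moment by cis ((|P| - |Q|)
  \<theta>), with |P| and |Q| the sums of parts; \<theta> is chosen so that this factor is cis pi =
  -1.\<close>

lemma powtr_moment_eq_0:
  assumes "sum_mset P \<noteq> sum_mset Q"
  shows "powtr_moment P Q = 0"
proof -
  define \<theta> where "\<theta> = pi / (real (sum_mset P) - real (sum_mset Q))"
  define c where "c = cis \<theta>"
  define h where "h = mat N N (\<lambda>(i, j). if i = j then c else 0)"
  have hc: "h \<in> carrier_mat N N" by (simp add: h_def)
  have cc: "cnj c * c = 1" by (simp add: c_def cis_cnj cis_mult)
  have hu: "h \<in> unitary_group N"
  proof -
    have "(\<Sum>l<N. cnj (h $$ (l, i)) * h $$ (l, j)) = (if i = j then 1 else 0)" if ij: "i < N" "j < N" for i j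
    proof -
      have "(\<Sum>l<N. cnj (h $$ (l, i)) * h $$ (l, j)) = (\<Sum>l<N. if l = i then (if i = j then 1 else 0) else 0)"
        using ij cc by (intro sum.cong refl) (auto simp: h_def)
      then show ?thesis using ij by simp
    qed
    then show ?thesis using hc by (simp add: unitary_group_iff)
  qed
  have entry: "(h * g) $$ (i, j) = c * g $$ (i, j)" if "g \<in> carrier_mat N N" "i < N" "j < N" for g i j
  proof -
    have "(h * g) $$ (i, j) = (\<Sum>l<N. h $$ (i, l) * g $$ (l, j))" by (rule index_mult_mat_sum[OF hc that])
    also have "\<dots> = (\<Sum>l<N. if l = i then c * g $$ (i, j) else 0)" using that by (intro sum.cong refl) (auto simp: h_def)
    finally show ?thesis using that by simp
  qed
  have pwh: "pw k (h * g) i j = c ^ k * pw k g i j" if g: "g \<in> carrier_mat N N" and "i < N" "j < N" for g k i j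
    using that(2,3)
  proof (induction k arbitrary: j)
    case 0
    then show ?case using pw_0[OF g] pw_0[of "h * g" N] hc g by auto
  next
    case (Suc k)
    have hg: "h * g \<in> carrier_mat N N" using hc g by auto
    show ?case unfolding pw_Suc[OF hg Suc.prems] pw_Suc[OF g Suc.prems] sum_distrib_left
      using Suc entry[OF g] by (intro sum.cong refl) (auto simp del: index_mult_mat)
  qed
  have tr: "powtr N k (h * g) = c ^ k * powtr N k g" if "g \<in> carrier_mat N N" for k g
    unfolding powtr_def sum_distrib_left using pwh[OF that] by (intro sum.cong refl) auto
  have pp: "powtr_prod N R (h * g) = c ^ sum_mset R * powtr_prod N R g" if "g \<in> carrier_mat N N" for R g
    by (induction R) (auto simp: tr[OF that] power_add)
  have "powtr_moment P Q = expectation (\<lambda>g. powtr_prod N P (h * g) * cnj (powtr_prod N Q (h * g)))"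
    unfolding powtr_moment_def
    by (rule expectation_translate[OF hu Der_measurable[OF Der_mult[OF Der_powtr_prod Der_cnj[OF Der_powtr_prod]]], symmetric])
  also have "\<dots> = expectation (\<lambda>g. (c ^ sum_mset P * cnj (c ^ sum_mset Q)) * (powtr_prod N P g * cnj (powtr_prod N Q g)))"
    by (intro Bochner_Integration.integral_cong refl) (auto simp: space_M pp unitary_carrier)
  also have "\<dots> = (c ^ sum_mset P * cnj (c ^ sum_mset Q)) * powtr_moment P Q" by (simp add: powtr_moment_def)
  also have "c ^ sum_mset P * cnj (c ^ sum_mset Q) = cis (real (sum_mset P) * \<theta> - real (sum_mset Q) * \<theta>)"
    by (simp add: c_def Complex.DeMoivre cis_cnj cis_mult)
  also have "real (sum_mset P) * \<theta> - real (sum_mset Q) * \<theta> = pi"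
  proof -
    have "a * (pi / (a - b)) - b * (pi / (a - b)) = pi" if "a \<noteq> b" for a b :: real
      using that by (simp flip: left_diff_distrib diff_divide_distrib)
    then show ?thesis using assms by (simp only: \<theta>_def of_nat_eq_iff not_False_eq_True)
  qed
  finally show ?thesis by simp
qed

theorem powtr_moment_eq_hall_inner:
  assumes "0 \<notin># P" "0 \<notin># Q" "sum_mset P \<le> N"
  shows "powtr_moment P Q = hall_inner P Q"
proof -
  have "powtr_moment P Q - hall_inner P Q = 0"
  proof (rule loop_system_unique[OF loop_system_diff[OF loop_system_powtr_moment loop_system_hall_inner] _ assms])
    fix Q :: "nat multiset" assume Q: "0 \<notin># Q"
    show "powtr_moment {#} Q - hall_inner {#} Q = 0"
    proof (cases "Q = {#}")
      case True
      then show ?thesis by (simp add: powtr_moment_def hall_inner_def zee_def prob_space)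
    next
      case False
      then have "0 < size Q" by (simp add: nonempty_has_size [symmetric])
      then have "sum_mset {#} \<noteq> sum_mset Q" using size_le_sum_mset[OF Q] by (simp only: sum_mset.empty)
      then have "powtr_moment {#} Q = 0" by (rule powtr_moment_eq_0)
      then show ?thesis using False by (simp add: hall_inner_def)
    qed
  qed
  then show ?thesis by simp
qed

end

section \<open>Eigenvalues, and integration of expansions\<close>

text \<open>The radial segment through z is connected and has more than one point because r < 1 / r.
  The result makes limits along the annulus unique, also at its boundary.\<close>

lemma annulus_islimpt:
  assumes r: "0 < r" "r < 1" and z: "z \<in> closed_annulus r"
  shows "z islimpt closed_annulus r"
proof -
  have nz: "0 < norm z" using z r by (auto simp: closed_annulus_def)
  define u where "u = z / of_real (norm z)"
  have nu: "norm u = 1" using nz by (simp add: u_def norm_divide)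
  define S where "S = (\<lambda>t. of_real t * u) ` {r..1/r}"
  have r1: "r \<le> 1 / r" using r by (simp add: pos_le_divide_eq mult_le_one)
  have "connected S" unfolding S_def by (intro connected_continuous_image continuous_intros) auto
  moreover have "of_real r * u \<in> S" "of_real (1/r) * u \<in> S" unfolding S_def by (rule imageI, use r1 in simp)+
  moreover have "of_real r * u \<noteq> of_real (1/r) * u"
  proof
    assume "of_real r * u = of_real (1/r) * u"
    then have "norm (of_real r * u) = norm (of_real (1/r) * u)" by simp
    then have "r = 1 / r" using r nu by (simp add: norm_mult norm_divide)
    then have "r * r = 1" using r by (simp add: field_simps)
    moreover have "r * r < 1 * 1" using r by (intro mult_strict_mono) auto
    ultimately show False by simp
  qed
  moreover have "z \<in> S" unfolding S_def
  proof (rule image_eqI[of _ _ "norm z"])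
    show "z = of_real (norm z) * u" using nz by (simp add: u_def)
    show "norm z \<in> {r..1/r}" using z by (simp add: closed_annulus_def)
  qed
  ultimately have "z islimpt S" by (intro connected_imp_perfect) auto
  moreover have "S \<subseteq> closed_annulus r" using r nu by (auto simp: S_def closed_annulus_def norm_mult)
  ultimately show ?thesis by (rule islimpt_subset)
qed

text \<open>A pole is excluded, and the value at a boundary point agrees with the limit, because the
  function is continuous along the annulus.\<close>

lemma meromorphic_imp_analytic_annulus:
  assumes r: "0 < r" "r < 1" and mero: "h meromorphic_on cball 0 (1 / r)" and hol: "h holomorphic_on closed_annulus r"
  shows "h analytic_on closed_annulus r"
proof -
  have "h analytic_on {z}" if z: "z \<in> closed_annulus r" for z
  proof (rule meromorphic_at_isCont_imp_analytic)
    have zb: "z \<in> cball 0 (1 / r)" using z by (simp add: closed_annulus_def)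
    then show m: "h meromorphic_on {z}" by (intro meromorphic_on_subset[OF mero]) auto
    have ne: "not_essential h z"
      using mero zb by (elim meromorphic_onE) auto
    have cont: "(h \<longlongrightarrow> h z) (at z within closed_annulus r)"
      using holomorphic_on_imp_continuous_on[OF hol] z by (auto simp: continuous_on_def)
    have nt: "at z within closed_annulus r \<noteq> bot"
      using annulus_islimpt[OF r z] by (simp add: trivial_limit_within)
    have le: "at z within closed_annulus r \<le> at z" by (rule at_le) simp
    show "isCont h z"
    proof (cases "is_pole h z")
      case True
      then have "filterlim h at_infinity (at z within closed_annulus r)"
        unfolding is_pole_def using le by (meson filterlim_mono order_refl)
      then show ?thesis using cont nt not_tendsto_and_filterlim_at_infinity by blast
    next
      case False
      then obtain L where L: "(h \<longlongrightarrow> L) (at z)" using ne by (auto simp: not_essential_def)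
      then have "(h \<longlongrightarrow> L) (at z within closed_annulus r)" using le by (meson filterlim_mono order_refl)
      then have "L = h z" using cont nt tendsto_unique by blast
      then show ?thesis using L by (simp add: isCont_def)
    qed
  qed
  then show ?thesis by (meson analytic_on_analytic_at)
qed

text \<open>Symmetry of f moves the active variable to the head of the list.\<close>

lemma sephol_prod_list_times:
  fixes f :: "complex list \<Rightarrow> complex"
  assumes h: "h holomorphic_on V"
    and f: "\<And>zs. length zs = n - 1 \<Longrightarrow> set zs \<subseteq> V \<Longrightarrow> (\<lambda>z. f (z # zs)) holomorphic_on V"
    and sym: "\<And>xs ys. length xs = n \<Longrightarrow> mset xs = mset ys \<Longrightarrow> f xs = f ys"
  shows "sephol V n (\<lambda>zs. (\<Prod>z\<leftarrow>zs. h z) * f zs)"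
  unfolding sephol_def
proof (intro allI impI)
  fix xs ys assume xy: "Suc (length xs + length ys) = n \<and> set xs \<subseteq> V \<and> set ys \<subseteq> V"
  have e: "f (xs @ z # ys) = f (z # (xs @ ys))" for z using xy by (intro sym) auto
  have "(\<lambda>z. f (z # (xs @ ys))) holomorphic_on V" using xy by (intro f) auto
  then have "(\<lambda>z. f (xs @ z # ys)) holomorphic_on V" by (simp add: e)
  then show "(\<lambda>z. (\<Prod>z\<leftarrow>xs @ z # ys. h z) * f (xs @ z # ys)) holomorphic_on V"
    using h by (auto intro!: holomorphic_intros)
qed

section \<open>Eigenvalues of unitary matrices\<close>

lemma sum_diag_mult_commute:
  fixes A B :: "complex mat"
  assumes "A \<in> carrier_mat N N" "B \<in> carrier_mat N N"
  shows "(\<Sum>i<N. (A * B) $$ (i, i)) = (\<Sum>i<N. (B * A) $$ (i, i))"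
proof -
  have "(\<Sum>i<N. (A * B) $$ (i, i)) = (\<Sum>i<N. \<Sum>l<N. A $$ (i, l) * B $$ (l, i))"
    by (intro sum.cong refl index_mult_mat_sum[OF assms]) auto
  also have "\<dots> = (\<Sum>l<N. \<Sum>i<N. B $$ (l, i) * A $$ (i, l))" by (subst sum.swap) (simp add: mult.commute)
  also have "\<dots> = (\<Sum>i<N. (B * A) $$ (i, i))"
    by (intro sum.cong refl index_mult_mat_sum[OF assms(2,1), symmetric]) auto
  finally show ?thesis .
qed

lemma upper_triangular_pow:
  fixes B :: "complex mat"
  assumes B: "B \<in> carrier_mat N N" and u: "upper_triangular B"
  shows "i < N \<Longrightarrow> j \<le> i \<Longrightarrow> (B ^\<^sub>m k) $$ (i, j) = (if i = j then (B $$ (i, i)) ^ k else 0)"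
proof (induction k arbitrary: i j)
  case 0
  then show ?case using B by auto
next
  case (Suc k)
  have c: "B ^\<^sub>m k \<in> carrier_mat N N" using B by (rule pow_carrier_mat)
  have low: "B $$ (l, j) = 0" if "l < N" "j < l" for l j using u B that by (auto simp: upper_triangular_def)
  have "(B ^\<^sub>m Suc k) $$ (i, j) = (\<Sum>l<N. (B ^\<^sub>m k) $$ (i, l) * B $$ (l, j))"
    unfolding pow_mat.simps using Suc.prems by (intro index_mult_mat_sum[OF c B]) auto
  also have "\<dots> = (\<Sum>l<N. if l = i then (if i = j then (B $$ (i, i)) ^ Suc k else 0) else 0)"
  proof (intro sum.cong refl)
    fix l assume "l \<in> {..<N}"
    then have l: "l < N" by simp
    show "(B ^\<^sub>m k) $$ (i, l) * B $$ (l, j) = (if l = i then (if i = j then (B $$ (i, i)) ^ Suc k else 0) else 0)"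
    proof (cases l i rule: linorder_cases)
      case less
      then show ?thesis using Suc.IH[of i l] Suc.prems by simp
    next
      case equal
      then show ?thesis using Suc.IH[of i i] Suc.prems low[of i j] by (cases "i = j") auto
    next
      case greater
      then show ?thesis using low[of l j] l Suc.prems by simp
    qed
  qed
  also have "\<dots> = (if i = j then (B $$ (i, i)) ^ Suc k else 0)" using Suc.prems by simp
  finally show ?case .
qed

lemma eigvals_factorization:
  assumes A: "A \<in> carrier_mat N N"
  shows "char_poly A = (\<Prod>e\<leftarrow>eigvals A. [:- e, 1:])" "length (eigvals A) = N"
proof -
  obtain as where as: "char_poly A = (\<Prod>a\<leftarrow>as. [:- a, 1:])" "length as = N"
    using char_poly_factorized[OF A] by blast
  have "proots (\<Prod>a\<leftarrow>as. [:- a, 1:]) = mset as"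
  proof (induction as)
    case (Cons a as)
    have "(\<Prod>a\<leftarrow>as. [:- a, 1:]) \<noteq> (0 :: complex poly)" by (auto simp: prod_list_zero_iff)
    then show ?case using Cons by (simp add: proots_mult proots_linear_factor del: mult_pCons_left)
  qed simp
  then have m: "mset (eigvals A) = mset as" by (simp add: mset_eigvals as)
  then show "length (eigvals A) = N" using as(2) by (metis size_mset)
  have "(\<Prod>e\<leftarrow>eigvals A. [:- e, 1:]) = (\<Prod>e\<in>#mset (eigvals A). [:- e, 1:])" by (metis mset_map prod_mset_prod_list)
  also have "\<dots> = (\<Prod>e\<leftarrow>as. [:- e, 1:])" unfolding m by (metis mset_map prod_mset_prod_list)
  finally show "char_poly A = (\<Prod>e\<leftarrow>eigvals A. [:- e, 1:])" by (simp add: as)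
qed

text \<open>Schur triangularisation with the prescribed order of eigenvalues: traces of powers are
  invariant under conjugation, and powers of a triangular matrix have the powers of its diagonal
  entries on the diagonal.\<close>

lemma sum_eigvals_power:
  assumes A: "A \<in> carrier_mat N N"
  shows "(\<Sum>j<N. (eigvals A ! j) ^ k) = powtr N k A"
proof -
  obtain B P Q where BPQ: "schur_decomposition A (eigvals A) = (B, P, Q)" by (metis prod_cases3)
  note sd = schur_decomposition[OF A eigvals_factorization(1)[OF A] BPQ]
  then have w: "similar_mat_wit A B P Q" and u: "upper_triangular B" and d: "diag_mat B = eigvals A" by auto
  have c: "B \<in> carrier_mat N N" "P \<in> carrier_mat N N" "Q \<in> carrier_mat N N" and QP: "Q * P = 1\<^sub>m N"
    using w A by (auto simp: similar_mat_wit_def Let_def)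
  have Bk: "B ^\<^sub>m k \<in> carrier_mat N N" using c(1) by (rule pow_carrier_mat)
  have "powtr N k A = (\<Sum>i<N. (P * B ^\<^sub>m k * Q) $$ (i, i))"
    unfolding powtr_def pw_def similar_mat_wit_pow_id[OF w] ..
  also have "\<dots> = (\<Sum>i<N. (Q * (P * B ^\<^sub>m k)) $$ (i, i))"
    using c Bk by (intro sum_diag_mult_commute) auto
  also have "Q * (P * B ^\<^sub>m k) = B ^\<^sub>m k"
    unfolding assoc_mult_mat[OF c(3,2) Bk, symmetric] QP by (rule left_mult_one_mat[OF Bk])
  also have "(\<Sum>i<N. (B ^\<^sub>m k) $$ (i, i)) = (\<Sum>i<N. (eigvals A ! i) ^ k)"
  proof (intro sum.cong refl)
    fix i assume "i \<in> {..<N}"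
    then show "(B ^\<^sub>m k) $$ (i, i) = (eigvals A ! i) ^ k"
      using upper_triangular_pow[OF c(1) u, of i i k] c(1) by (simp add: d[symmetric] diag_mat_def)
  qed
  finally show ?thesis ..
qed

lemma norm_eigvals_unitary:
  assumes g: "g \<in> unitary_group N" and j: "j < N"
  shows "norm (eigvals g ! j) = 1"
proof -
  have c: "g \<in> carrier_mat N N" using g by (simp add: unitary_group_def)
  define \<rho> where "\<rho> = eigvals g ! j"
  have "\<rho> \<in> set (eigvals g)" using j eigvals_factorization(2)[OF c] by (simp add: \<rho>_def)
  then have "poly (char_poly g) \<rho> = 0"
    unfolding eigvals_factorization(1)[OF c] by (auto simp: poly_prod_list prod_list_zero_iff image_iff)
  then have "eigenvalue g \<rho>" using eigenvalue_root_char_poly[OF c] by simp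
  then obtain v where v: "v \<in> carrier_vec N" "v \<noteq> 0\<^sub>v N" "g *\<^sub>v v = \<rho> \<cdot>\<^sub>v v"
    using c by (auto simp: eigenvalue_def eigenvector_def)
  have gv: "(\<Sum>l<N. g $$ (i, l) * v $ l) = \<rho> * v $ i" if "i < N" for i
  proof -
    have "(g *\<^sub>v v) $ i = (\<Sum>l<N. g $$ (i, l) * v $ l)"
      using that c v(1) by (auto simp: scalar_prod_def atLeast0LessThan)
    then show ?thesis using that v by simp
  qed
  define S where "S = (\<Sum>i<N. (norm (v $ i))\<^sup>2)"
  have cS: "of_real S = (\<Sum>i<N. cnj (v $ i) * v $ i)"
    unfolding S_def of_real_sum by (intro sum.cong refl) (metis complex_norm_square mult.commute)
  have "of_real ((norm \<rho>)\<^sup>2 * S) = (\<Sum>i<N. cnj (\<rho> * v $ i) * (\<rho> * v $ i))"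
    unfolding of_real_mult cS complex_norm_square sum_distrib_left by (intro sum.cong refl) simp
  also have "\<dots> = (\<Sum>i<N. (\<Sum>a<N. cnj (g $$ (i, a)) * cnj (v $ a)) * (\<Sum>b<N. g $$ (i, b) * v $ b))"
    by (intro sum.cong refl) (simp flip: gv)
  also have "\<dots> = (\<Sum>i<N. \<Sum>a<N. \<Sum>b<N. cnj (v $ a) * v $ b * (cnj (g $$ (i, a)) * g $$ (i, b)))"
    unfolding sum_product by (simp only: mult_ac)
  also have "\<dots> = (\<Sum>a<N. \<Sum>i<N. \<Sum>b<N. cnj (v $ a) * v $ b * (cnj (g $$ (i, a)) * g $$ (i, b)))"
    by (rule sum.swap)
  also have "\<dots> = (\<Sum>a<N. \<Sum>b<N. \<Sum>i<N. cnj (v $ a) * v $ b * (cnj (g $$ (i, a)) * g $$ (i, b)))"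
    by (intro sum.cong refl sum.swap)
  also have "\<dots> = (\<Sum>a<N. \<Sum>b<N. if b = a then cnj (v $ a) * v $ a else 0)"
    using g by (intro sum.cong refl) (auto simp: unitary_group_iff simp flip: sum_distrib_left)
  also have "\<dots> = of_real S" by (simp add: cS)
  finally have "(norm \<rho>)\<^sup>2 * S = S" by (simp only: of_real_eq_iff)
  moreover have "S \<noteq> 0"
  proof
    assume "S = 0"
    then have "v $ i = 0" if "i < N" for i using that by (simp add: S_def sum_nonneg_eq_0_iff)
    then have "v = 0\<^sub>v N" using v(1) by (intro eq_vecI) auto
    then show False using v(2) by simp
  qed
  ultimately have "(norm \<rho>)\<^sup>2 = 1" by simp
  then show ?thesis by (simp add: \<rho>_def power2_eq_1_iff) (metis norm_ge_zero not_one_le_zero neg_0_le_iff_le zero_le_one order_trans)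
qed

section \<open>Exchanging sums and integrals\<close>

text \<open>\<open>has_sum\<close> is a limit along all finite subsets, whereas dominated
  convergence needs a sequence; an enumeration supplies one that is cofinal.\<close>

lemma filterlim_finite_subsets_exhaustion:
  assumes "countable A" "A \<noteq> {}"
  shows "filterlim (\<lambda>L::nat. from_nat_into A ` {..L}) (finite_subsets_at_top A) sequentially"
  unfolding filterlim_iff
proof (intro allI impI)
  fix P assume "eventually P (finite_subsets_at_top A)"
  then obtain X where X: "finite X" "X \<subseteq> A" "\<And>Y. finite Y \<Longrightarrow> X \<subseteq> Y \<Longrightarrow> Y \<subseteq> A \<Longrightarrow> P Y"
    by (auto simp: eventually_finite_subsets_at_top)
  define L0 where "L0 = Max (insert 0 (to_nat_on A ` X))"
  show "\<forall>\<^sub>F L in sequentially. P (from_nat_into A ` {..L})"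
  proof (rule eventually_sequentiallyI[of L0])
    fix L assume L: "L0 \<le> L"
    have "X \<subseteq> from_nat_into A ` {..L}"
    proof
      fix x assume x: "x \<in> X"
      then have "to_nat_on A x \<le> L0" unfolding L0_def using X(1) by (intro Max_ge) auto
      then show "x \<in> from_nat_into A ` {..L}"
        using x X(2) L assms(1) by (intro image_eqI[of _ _ "to_nat_on A x"]) auto
    qed
    then show "P (from_nat_into A ` {..L})" using assms(2) by (intro X(3)) (auto intro: from_nat_into)
  qed
qed

text \<open>Dominated convergence along an exhaustion gives the value, and absolute summability of
  the integrals makes the unconditional sum exist, so the two limits agree. The weight w allows
  infinite measures such as Lebesgue measure with the indicator of a box.\<close>

lemma has_sum_integral_dominated:
  fixes f :: "'i \<Rightarrow> 'a \<Rightarrow> complex"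
  assumes A: "countable A" and meas: "\<And>m. m \<in> A \<Longrightarrow> f m \<in> borel_measurable M"
    and b: "b summable_on A" "\<And>m. m \<in> A \<Longrightarrow> 0 \<le> b m"
    and w: "integrable M w" "\<And>x. x \<in> space M \<Longrightarrow> 0 \<le> w x"
    and bd: "\<And>m x. m \<in> A \<Longrightarrow> x \<in> space M \<Longrightarrow> norm (f m x) \<le> b m * w x"
    and hs: "\<And>x. x \<in> space M \<Longrightarrow> ((\<lambda>m. f m x) has_sum F x) A"
  shows "integrable M F" "((\<lambda>m. integral\<^sup>L M (f m)) has_sum integral\<^sup>L M F) A"
proof -
  have "integrable M F \<and> ((\<lambda>m. integral\<^sup>L M (f m)) has_sum integral\<^sup>L M F) A"
  proof (cases "A = {}")
    case True
    have z: "F x = 0" if "x \<in> space M" for x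
      using hs[OF that] True has_sum_empty has_sum_unique by blast
    have "integrable M F \<longleftrightarrow> integrable M (\<lambda>_. 0 :: complex)" by (intro Bochner_Integration.integrable_cong refl z)
    moreover have "integral\<^sup>L M F = integral\<^sup>L M (\<lambda>_. 0 :: complex)" by (intro Bochner_Integration.integral_cong refl z)
    ultimately show ?thesis using True by simp
  next
    case False
    define S where "S = (\<lambda>L::nat. from_nat_into A ` {..L})"
    have S: "finite (S L)" "S L \<subseteq> A" for L using False by (auto simp: S_def intro: from_nat_into)
    have fl: "filterlim S (finite_subsets_at_top A) sequentially"
      unfolding S_def by (rule filterlim_finite_subsets_exhaustion[OF A False])
    define B where "B = infsum b A"
    have fi: "integrable M (f m)" if "m \<in> A" for m
    proof (rule Bochner_Integration.integrable_bound[of M "\<lambda>x. b m * w x"])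
      show "integrable M (\<lambda>x. b m * w x)" using w(1) by (rule integrable_mult_right)
      show "AE x in M. norm (f m x) \<le> norm (b m * w x)"
      proof (rule AE_I2)
        fix x assume "x \<in> space M"
        from bd[OF that this] show "norm (f m x) \<le> norm (b m * w x)" by simp
      qed
    qed (rule meas[OF that])
    have sm: "(\<lambda>x. \<Sum>m\<in>S L. f m x) \<in> borel_measurable M" for L
      using S(2)[of L] meas by (intro borel_measurable_sum) auto
    have lim: "(\<lambda>L. \<Sum>m\<in>S L. f m x) \<longlonglongrightarrow> F x" if "x \<in> space M" for x
      using hs[OF that] fl unfolding has_sum_def by (rule filterlim_compose)
    have dom: "norm (\<Sum>m\<in>S L. f m x) \<le> B * w x" if x: "x \<in> space M" for x L
    proof -
      have "norm (\<Sum>m\<in>S L. f m x) \<le> (\<Sum>m\<in>S L. b m * w x)"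
        using S(2)[of L] bd x by (intro sum_norm_le) auto
      also have "\<dots> = (\<Sum>m\<in>S L. b m) * w x" by (simp add: sum_distrib_right)
      also have "\<dots> \<le> B * w x" unfolding B_def
        using S[of L] b w(2)[OF x] by (intro mult_right_mono finite_sum_le_infsum) auto
      finally show ?thesis .
    qed
    have Fm: "F \<in> borel_measurable M"
      by (rule borel_measurable_LIMSEQ_metric[OF sm lim])
    have Bw: "integrable M (\<lambda>x. B * w x)" using w(1) by (rule integrable_mult_right)
    have IF: "integrable M F"
      by (rule integrable_dominated_convergence[OF Fm sm Bw AE_I2[OF lim] AE_I2[OF dom]])
    have "(\<lambda>L. integral\<^sup>L M (\<lambda>x. \<Sum>m\<in>S L. f m x)) \<longlonglongrightarrow> integral\<^sup>L M F"
      by (rule integral_dominated_convergence[OF Fm sm Bw AE_I2[OF lim] AE_I2[OF dom]])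
    moreover have "integral\<^sup>L M (\<lambda>x. \<Sum>m\<in>S L. f m x) = (\<Sum>m\<in>S L. integral\<^sup>L M (f m))" for L
      by (rule Bochner_Integration.integral_sum) (rule fi[OF subsetD[OF S(2)]])
    ultimately have l1: "(\<lambda>L. \<Sum>m\<in>S L. integral\<^sup>L M (f m)) \<longlonglongrightarrow> integral\<^sup>L M F" by simp
    have "(\<lambda>m. integral\<^sup>L M (f m)) summable_on A"
    proof (rule abs_summable_summable, rule Infinite_Sum.abs_summable_on_comparison_test')
      show "(\<lambda>m. b m * integral\<^sup>L M w) summable_on A" using b(1) by (rule summable_on_cmult_left)
      fix m assume m: "m \<in> A"
      have "norm (integral\<^sup>L M (f m)) \<le> integral\<^sup>L M (\<lambda>x. norm (f m x))" by (rule integral_norm_bound)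
      also have "\<dots> \<le> integral\<^sup>L M (\<lambda>x. b m * w x)"
        by (rule integral_mono[OF integrable_norm[OF fi[OF m]] integrable_mult_right[OF w(1)] bd[OF m]])
      finally show "norm (integral\<^sup>L M (f m)) \<le> b m * integral\<^sup>L M w" by simp
    qed
    then have hI: "((\<lambda>m. integral\<^sup>L M (f m)) has_sum infsum (\<lambda>m. integral\<^sup>L M (f m)) A) A"
      by (rule has_sum_infsum)
    then have l2: "(\<lambda>L. \<Sum>m\<in>S L. integral\<^sup>L M (f m)) \<longlonglongrightarrow> infsum (\<lambda>m. integral\<^sup>L M (f m)) A"
      using fl unfolding has_sum_def by (rule filterlim_compose)
    show ?thesis using IF hI unfolding LIMSEQ_unique[OF l2 l1] by (rule conjI)
  qed
  then show "integrable M F" "((\<lambda>m. integral\<^sup>L M (f m)) has_sum integral\<^sup>L M F) A" by auto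
qed

lemma zmon_nth:
  assumes "length zs = n" "length ms = n"
  shows "zmon zs ms = (\<Prod>i<n. (zs ! i) powi (ms ! i))"
  using assms
proof (induction zs ms arbitrary: n rule: list_induct2')
  case (4 z zs m ms)
  then obtain n' where n: "n = Suc n'" by (cases n) auto
  have "zmon zs ms = (\<Prod>i<n'. (zs ! i) powi (ms ! i))" using 4 n by auto
  then show ?case unfolding n by (simp add: prod.lessThan_Suc_shift del: prod.lessThan_Suc)
qed auto

section \<open>Fourier integrals over the torus\<close>

definition inv_circ :: "real \<Rightarrow> real \<Rightarrow> complex" where
  "inv_circ r t = of_real r * cis (- t)"

text \<open>The indicator is built in so that an integral over the box becomes a product of
  integrals over the whole line.\<close>

definition box_pow :: "real \<Rightarrow> int \<Rightarrow> real \<Rightarrow> complex" where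
  "box_pow r p t = indicator {0..2 * pi} t *\<^sub>R (inv_circ r t powi p)"

lemma norm_inv_circ [simp]: "norm (inv_circ r t) = \<bar>r\<bar>"
  by (simp add: inv_circ_def norm_mult)

lemma inv_circ_nonzero [simp]: "r \<noteq> 0 \<Longrightarrow> inv_circ r t \<noteq> 0"
  by (simp add: inv_circ_def)

lemma inv_circ_power_int: "inv_circ r t powi p = of_real (r powi p) * cis (- (of_int p * t))"
proof -
  have "cis (- t) powi p = cis (- (of_int p * t))"
    by (simp add: cis_power_int)
  then show ?thesis by (simp add: inv_circ_def power_int_mult_distrib)
qed

lemma box_pow_integral:
  assumes r: "0 < r"
  shows "integrable lborel (box_pow r p)" "integral\<^sup>L lborel (box_pow r p) = (if p = 0 then 2 * pi else 0)"
proof -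
  have b: "has_bochner_integral lborel (box_pow r p) (if p = 0 then 2 * pi else 0)"
  proof (cases "p = 0")
    case True
    have "has_bochner_integral lborel (\<lambda>t. indicator {0..2 * pi} t *\<^sub>R (1::complex)) (of_real (2 * pi) - of_real 0)"
    proof (rule has_bochner_integral_FTC_Icc)
      fix x :: real
      show "((\<lambda>x. of_real x) has_vector_derivative 1) (at x within {0..2 * pi})"
        using has_vector_derivative_of_real[of "\<lambda>x. x" 1] by (simp add: DERIV_ident)
    qed auto
    then show ?thesis using True by (simp add: box_pow_def[abs_def])
  next
    case False
    define G where "G = (\<lambda>t. of_real (r powi p) * cis (- (of_int p * t)) / (- \<i> * of_int p))"
    have "has_bochner_integral lborel (\<lambda>t. indicator {0..2 * pi} t *\<^sub>R (of_real (r powi p) * cis (- (of_int p * t)))) (G (2 * pi) - G 0)"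
    proof (rule has_bochner_integral_FTC_Icc)
      fix x :: real
      have "((\<lambda>t. of_real (r powi p) * cis (- (of_int p * t)) / (- \<i> * of_int p)) has_vector_derivative
          of_real (r powi p) * ((- of_int p) *\<^sub>R (\<i> * cis (- (of_int p * x)))) / (- \<i> * of_int p)) (at x within {0..2 * pi})"
        unfolding cis_conv_exp
        by (rule derivative_eq_intros has_vector_derivative_real_field refl | simp)+ (simp add: scaleR_conv_of_real mult_ac)
      also have "of_real (r powi p) * ((- of_int p) *\<^sub>R (\<i> * cis (- (of_int p * x)))) / (- \<i> * of_int p) = of_real (r powi p) * cis (- (of_int p * x))"
        using False by (simp add: scaleR_conv_of_real field_simps)
      finally show "(G has_vector_derivative of_real (r powi p) * cis (- (of_int p * x))) (at x within {0..2 * pi})"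
        unfolding G_def .
    next
      show "continuous_on {0..2 * pi} (\<lambda>x. of_real (r powi p) * cis (- (of_int p * x)))" by (intro continuous_intros)
    qed auto
    moreover have "G (2 * pi) = G 0"
    proof -
      have "cis (- (of_int p * (2 * pi))) = 1" using cis_multiple_2pi[of "of_int (- p)"] by (simp add: mult_ac)
      then show ?thesis by (simp add: G_def)
    qed
    ultimately show ?thesis using False by (simp add: box_pow_def[abs_def] inv_circ_power_int)
  qed
  then show "integrable lborel (box_pow r p)" "integral\<^sup>L lborel (box_pow r p) = (if p = 0 then 2 * pi else 0)"
    by (auto simp: has_bochner_integral_iff)
qed

interpretation lborel_product: product_sigma_finite "\<lambda>_::nat. lborel :: real measure"
  by standard

lemma torus_monomial_integral:
  assumes r: "0 < r"
  shows "integrable (\<Pi>\<^sub>M j\<in>{..<n}. lborel) (\<lambda>t. \<Prod>j<n. box_pow r (p j) (t j))"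
    "integral\<^sup>L (\<Pi>\<^sub>M j\<in>{..<n}. lborel) (\<lambda>t. \<Prod>j<n. box_pow r (p j) (t j)) = (if \<forall>j<n. p j = 0 then of_real (2 * pi) ^ n else 0)"
proof -
  show "integrable (\<Pi>\<^sub>M j\<in>{..<n}. lborel) (\<lambda>t. \<Prod>j<n. box_pow r (p j) (t j))"
    by (rule lborel_product.product_integrable_prod) (auto intro: box_pow_integral(1)[OF r])
  have "integral\<^sup>L (\<Pi>\<^sub>M j\<in>{..<n}. lborel) (\<lambda>t. \<Prod>j<n. box_pow r (p j) (t j)) = (\<Prod>j<n. integral\<^sup>L lborel (box_pow r (p j)))"
    by (rule lborel_product.product_integral_prod) (auto intro: box_pow_integral(1)[OF r])
  also have "\<dots> = (\<Prod>j<n. if p j = 0 then of_real (2 * pi) else 0)"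
    by (intro prod.cong refl) (simp add: box_pow_integral(2)[OF r])
  also have "\<dots> = (if \<forall>j<n. p j = 0 then of_real (2 * pi) ^ n else 0)"
  proof (cases "\<forall>j<n. p j = 0")
    case True
    then show ?thesis by simp
  next
    case False
    then obtain j where "j < n" "p j \<noteq> 0" by blast
    then have "(\<Prod>j<n. if p j = 0 then complex_of_real (2 * pi) else 0) = 0" by (intro prod_zero) auto
    then show ?thesis using False by (simp only: if_False)
  qed
  finally show "integral\<^sup>L (\<Pi>\<^sub>M j\<in>{..<n}. lborel) (\<lambda>t. \<Prod>j<n. box_pow r (p j) (t j)) = (if \<forall>j<n. p j = 0 then of_real (2 * pi) ^ n else 0)" .
qed

definition torus_point :: "real \<Rightarrow> nat \<Rightarrow> nat \<Rightarrow> (nat \<Rightarrow> real) \<Rightarrow> complex list" where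
  "torus_point r n k t = map (\<lambda>j. of_real r * cis (- t j)) [0..<k] @ map (\<lambda>j. cis (t j) / of_real r) [k..<n]"

lemma length_torus_point [simp]: "k \<le> n \<Longrightarrow> length (torus_point r n k t) = n"
  by (simp add: torus_point_def)

lemma torus_point_nth:
  assumes r: "0 < r" and "j < n" "k \<le> n"
  shows "torus_point r n k t ! j = (if j < k then inv_circ r (t j) else inverse (inv_circ r (t j)))"
  using assms by (auto simp: torus_point_def nth_append inv_circ_def cis_inverse field_simps simp flip: cis_inverse)

lemma torus_point_annulus:
  assumes r: "0 < r" "r < 1" and k: "k \<le> n"
  shows "set (torus_point r n k t) \<subseteq> closed_annulus r"
proof -
  have "r \<le> 1 / r" using r by (simp add: pos_le_divide_eq mult_le_one)
  then show ?thesis using r by (auto simp: torus_point_def closed_annulus_def norm_mult norm_divide)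
qed

text \<open>A point e^(i t) / r on the outer circle is the inverse of r e^(- i t), so every factor
  is a power of r e^(- i t_j). Only the multi-index for which all exponents cancel survives, and the
  powers of r cancel with them. The monomial thus reads off negative exponents in the first k
  variables and positive ones in the others.\<close>

theorem torus_integral_coeff:
  assumes r: "0 < r" "r < 1" and q: "0 < q" "q < r" and K: "0 \<le> K"
    and bd: "\<And>m. length m = n \<Longrightarrow> norm (c m) \<le> K * q ^ abssum m"
    and hs: "\<And>z. length z = n \<Longrightarrow> set z \<subseteq> closed_annulus r \<Longrightarrow> ((\<lambda>m. c m * zmon z m) has_sum F z) {m. length m = n}"
    and k: "k \<le> n" and e: "length e = n"
  shows "set_integrable (\<Pi>\<^sub>M j\<in>{..<n}. lborel) (\<Pi>\<^sub>E j\<in>{..<n}. {0..2 * pi})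
           (\<lambda>t. F (torus_point r n k t) * (\<Prod>j<n. inv_circ r (t j) ^ (e ! j)))" (is "set_integrable ?M ?B ?G")
    and "(LINT t : (\<Pi>\<^sub>E j\<in>{..<n}. {0..2 * pi}) | (\<Pi>\<^sub>M j\<in>{..<n}. lborel).
           F (torus_point r n k t) * (\<Prod>j<n. inv_circ r (t j) ^ (e ! j))) = of_real (2 * pi) ^ n * c (map (\<lambda>j. if j < k then - int (e ! j) else int (e ! j)) [0..<n])"
proof -
  define m0 where "m0 = map (\<lambda>j. if j < k then - int (e ! j) else int (e ! j)) [0..<n]"
  \<comment> \<open>The total exponent of r e^(- i t_j) in the term of index m; the sign changes on
    the outer circle.\<close>
  define p where "p = (\<lambda>m j. (if j < k then m ! j else - (m ! j)) + int (e ! j))"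
  define w :: "(nat \<Rightarrow> real) \<Rightarrow> real" where "w = (\<lambda>t. \<Prod>j<n. indicator {0..2 * pi} (t j))"
  define f where "f = (\<lambda>m t. c m * (\<Prod>j<n. box_pow r (p m j) (t j)))"
  have ind: "indicator ?B t = w t" if "t \<in> space ?M" for t
  proof (cases "t \<in> ?B")
    case True
    then have "\<forall>j\<in>{..<n}. indicator {0..2 * pi} (t j) = (1::real)" by (simp add: PiE_iff)
    then have "w t = 1" unfolding w_def by (rule prod.neutral)
    then show ?thesis using indicator_simps(1)[OF True] by metis
  next
    case False
    moreover have "t \<in> extensional {..<n}" using that by (simp add: space_PiM PiE_iff)
    ultimately obtain j where j: "j < n" "t j \<notin> {0..2 * pi}" unfolding PiE_iff by blast
    have "indicator {0..2 * pi} (t j) = (0::real)" by (rule indicator_simps(2)[OF j(2)])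
    then have "w t = 0" unfolding w_def by (rule prod_zero[OF finite_lessThan bexI]) (use j in simp)
    then show ?thesis using indicator_simps(2)[OF False] by metis
  qed
  have fx: "f m t = w t *\<^sub>R (c m * zmon (torus_point r n k t) m * (\<Prod>j<n. inv_circ r (t j) ^ (e ! j)))"
    if m: "length m = n" for m t
  proof -
    have "box_pow r (p m j) (t j) = of_real (indicator {0..2 * pi} (t j)) * ((torus_point r n k t ! j) powi (m ! j) * inv_circ r (t j) ^ (e ! j))"
      if j: "j < n" for j
    proof -
      have nz: "inv_circ r (t j) \<noteq> 0" using r by simp
      have "(torus_point r n k t ! j) powi (m ! j) = inv_circ r (t j) powi (if j < k then m ! j else - (m ! j))"
        using torus_point_nth[OF r(1) j k] by (simp add: power_int_minus power_int_inverse)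
      then show ?thesis unfolding box_pow_def p_def scaleR_conv_of_real
        using nz by (simp add: power_int_add)
    qed
    then have "(\<Prod>j<n. box_pow r (p m j) (t j)) = (\<Prod>j<n. of_real (indicator {0..2 * pi} (t j)) * ((torus_point r n k t ! j) powi (m ! j) * inv_circ r (t j) ^ (e ! j)))"
      by (intro prod.cong) auto
    also have "\<dots> = of_real (w t) * (zmon (torus_point r n k t) m * (\<Prod>j<n. inv_circ r (t j) ^ (e ! j)))"
      unfolding prod.distrib w_def using k m by (simp add: zmon_nth[of _ n])
    finally show ?thesis by (simp add: f_def scaleR_conv_of_real)
  qed
  define H where "H = (\<lambda>t. w t *\<^sub>R ?G t)"
  have cnt: "countable {m :: int list. length m = n}" by (rule countable_subset[OF subset_UNIV]) simp
  have fint: "integrable ?M (f m)" for m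
    unfolding f_def by (intro integrable_mult_right torus_monomial_integral(1) r)
  have sm: "(\<lambda>m. K * (q / r) ^ abssum m) summable_on {m. length m = n}"
    using q r by (intro summable_on_cmult_right summable_geometric_lists) auto
  have b0: "0 \<le> K * (q / r) ^ abssum m" for m using K q r by simp
  have iw: "integrable ?M w"
    unfolding w_def by (rule lborel_product.product_integrable_prod) auto
  have w0: "0 \<le> w t" for t unfolding w_def by (intro prod_nonneg) auto
  have fb: "norm (f m t) \<le> (K * (q / r) ^ abssum m) * w t" if "m \<in> {m. length m = n}" for m t
  proof -
    have m: "length m = n" using that by simp
    have "norm (c m * zmon (torus_point r n k t) m * (\<Prod>j<n. inv_circ r (t j) ^ (e ! j))) \<le> (K * q ^ abssum m) * (1 / r) ^ abssum m * 1"
      unfolding norm_mult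
    proof (intro mult_mono)
      show "norm (c m) \<le> K * q ^ abssum m" using m by (rule bd)
      show "norm (zmon (torus_point r n k t) m) \<le> (1 / r) ^ abssum m"
        using r k m by (intro norm_zmon_le torus_point_annulus) auto
      show "norm (\<Prod>j<n. inv_circ r (t j) ^ (e ! j)) \<le> 1"
        unfolding prod_norm[symmetric] norm_power norm_inv_circ using r by (intro prod_le_1) (auto intro: power_le_one)
    qed (use K q r in auto)
    also have "\<dots> = K * (q / r) ^ abssum m" by (simp add: power_divide)
    finally have "w t * norm (c m * zmon (torus_point r n k t) m * (\<Prod>j<n. inv_circ r (t j) ^ (e ! j)))
        \<le> w t * (K * (q / r) ^ abssum m)"
      by (rule mult_left_mono[OF _ w0])
    then show ?thesis unfolding fx[OF m] norm_scaleR abs_of_nonneg[OF w0] by (simp only: mult.commute)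
  qed
  have fh: "((\<lambda>m. f m t) has_sum H t) {m. length m = n}" for t
  proof -
    have "((\<lambda>m. c m * zmon (torus_point r n k t) m) has_sum F (torus_point r n k t)) {m. length m = n}"
      using r k by (intro hs torus_point_annulus) auto
    then have e1: "((\<lambda>m. (w t *\<^sub>R (\<Prod>j<n. inv_circ r (t j) ^ (e ! j))) * (c m * zmon (torus_point r n k t) m)) has_sum
      (w t *\<^sub>R (\<Prod>j<n. inv_circ r (t j) ^ (e ! j))) * F (torus_point r n k t)) {m. length m = n}"
      by (rule has_sum_cmult_right)
    have e2: "f m t = (w t *\<^sub>R (\<Prod>j<n. inv_circ r (t j) ^ (e ! j))) * (c m * zmon (torus_point r n k t) m)"
      if "m \<in> {m. length m = n}" for m
      using that by (simp add: fx mult_ac)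
    have e3: "H t = (w t *\<^sub>R (\<Prod>j<n. inv_circ r (t j) ^ (e ! j))) * F (torus_point r n k t)"
      by (simp add: H_def mult_ac)
    show ?thesis unfolding e3 by (rule iffD2[OF has_sum_cong[OF e2] e1])
  qed
  note swap = has_sum_integral_dominated[OF cnt borel_measurable_integrable[OF fint] sm b0 iw w0 fb fh]
  have eqH: "indicator ?B t *\<^sub>R ?G t = H t" if "t \<in> space ?M" for t
    by (simp only: ind[OF that] H_def)
  show "set_integrable ?M ?B ?G"
    unfolding set_integrable_def by (rule iffD2[OF Bochner_Integration.integrable_cong[OF refl eqH] swap(1)])
  have "(LINT t : ?B | ?M. ?G t) = integral\<^sup>L ?M H"
    unfolding set_lebesgue_integral_def by (rule Bochner_Integration.integral_cong[OF refl eqH])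
  moreover have "((\<lambda>m. integral\<^sup>L ?M (f m)) has_sum (of_real (2 * pi) ^ n * c m0)) {m. length m = n}"
  proof -
    have eq: "integral\<^sup>L ?M (f m) = (if m = m0 then of_real (2 * pi) ^ n * c m else 0)" if "m \<in> {m. length m = n}" for m
    proof -
      have m: "length m = n" using that by simp
      have "(\<forall>j<n. p m j = 0) \<longleftrightarrow> m = m0"
      proof
        assume *: "\<forall>j<n. p m j = 0"
        show "m = m0"
        proof (rule nth_equalityI)
          fix j assume "j < length m"
          then show "m ! j = m0 ! j" using *[rule_format, of j] m by (auto simp: p_def m0_def split: if_splits)
        qed (use m in \<open>simp add: m0_def\<close>)
      qed (auto simp: p_def m0_def)
      then show ?thesis unfolding f_def integral_mult_right_zero torus_monomial_integral(2)[OF r(1)] by simp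
    qed
    have "((\<lambda>m. if m = m0 then of_real (2 * pi) ^ n * c m else 0) has_sum (of_real (2 * pi) ^ n * c m0)) {m. length m = n}"
      by (rule has_sum_finite_neutralI[of "{m0}"]) (auto simp: m0_def)
    from iffD2[OF has_sum_cong[OF eq] this] show ?thesis .
  qed
  ultimately show "(LINT t : ?B | ?M. ?G t) = of_real (2 * pi) ^ n * c (map (\<lambda>j. if j < k then - int (e ! j) else int (e ! j)) [0..<n])"
    unfolding m0_def[symmetric] using has_sum_unique[OF swap(2)] by (simp only:)
qed

section \<open>The main term and the error term\<close>

definition pos_parts :: "int list \<Rightarrow> nat multiset" where
  "pos_parts m = image_mset nat (filter_mset (\<lambda>x. 0 < x) (mset m))"

definition neg_parts :: "int list \<Rightarrow> nat multiset" where
  "neg_parts m = image_mset (\<lambda>x. nat (- x)) (filter_mset (\<lambda>x. x < 0) (mset m))"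

text \<open>The entries of a multi-index of length n whose positive entries and negated negative
  entries both form l. Subtraction is truncated, so the size is n only for
  \<open>2 * size l \<le> n\<close>.\<close>

definition balanced :: "nat \<Rightarrow> nat multiset \<Rightarrow> int multiset" where
  "balanced n l = image_mset int l + image_mset (\<lambda>i. - int i) l + replicate_mset (n - 2 * size l) 0"

lemma zero_notin_parts: "0 \<notin># pos_parts m" "0 \<notin># neg_parts m"
  by (auto simp: pos_parts_def neg_parts_def)

lemma mset_eq_parts:
  "mset m = image_mset int (pos_parts m) + image_mset (\<lambda>i. - int i) (neg_parts m) + replicate_mset (count_list m 0) 0"
  by (induction m) (auto simp: pos_parts_def neg_parts_def)

lemma length_eq_parts: "length m = size (pos_parts m) + size (neg_parts m) + count_list m 0"
  by (metis mset_eq_parts size_mset size_union size_image_mset size_replicate_mset)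

lemma abssum_eq_parts: "abssum m = sum_mset (pos_parts m) + sum_mset (neg_parts m)"
  by (induction m) (auto simp: pos_parts_def neg_parts_def)

lemma parts_balanced:
  assumes m: "mset m = balanced n l" and l: "0 \<notin># l"
  shows "pos_parts m = l" "neg_parts m = l" "count_list m 0 = n - 2 * size l"
proof -
  have f1: "filter_mset (\<lambda>x. 0 < x) (image_mset int l) = image_mset int l"
    "filter_mset (\<lambda>x. x < 0) (image_mset int l) = {#}"
    "filter_mset (\<lambda>x. 0 < x) (image_mset (\<lambda>i. - int i) l) = {#}"
    "filter_mset (\<lambda>x. x < 0) (image_mset (\<lambda>i. - int i) l) = image_mset (\<lambda>i. - int i) l"
    using l by (induction l) auto
  show "pos_parts m = l" "neg_parts m = l"
    unfolding pos_parts_def neg_parts_def m balanced_def by (simp_all add: f1 image_mset.compositionality o_def)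
  have "count (mset m) 0 = n - 2 * size l"
    unfolding m balanced_def using l by (auto simp: count_eq_zero_iff)
  then show "count_list m 0 = n - 2 * size l" by (simp add: count_mset)
qed

lemma parts_eq_iff:
  assumes "length m = n" "0 \<notin># l"
  shows "pos_parts m = l \<and> neg_parts m = l \<longleftrightarrow> 2 * size l \<le> n \<and> mset m = balanced n l"
proof
  assume *: "pos_parts m = l \<and> neg_parts m = l"
  then have "n = 2 * size l + count_list m 0" using length_eq_parts[of m] assms by simp
  then show "2 * size l \<le> n \<and> mset m = balanced n l"
    using mset_eq_parts[of m] * by (simp add: balanced_def)
next
  assume "2 * size l \<le> n \<and> mset m = balanced n l"
  then show "pos_parts m = l \<and> neg_parts m = l" using parts_balanced[OF _ assms(2)] by blast
qed

lemma size_balanced: "2 * size l \<le> n \<Longrightarrow> size (balanced n l) = n"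
  by (simp add: balanced_def)

text \<open>The order of the stabiliser of an arrangement of A under permutation of positions, that
  is, the denominator of the multinomial coefficient.\<close>

definition fact_prod :: "'a multiset \<Rightarrow> nat" where
  "fact_prod A = (\<Prod>x\<in>set_mset A. fact (count A x))"

lemma fact_prod_pos: "0 < fact_prod A"
  by (simp add: fact_prod_def)

lemma fact_prod_union:
  assumes "set_mset A \<inter> set_mset B = {}"
  shows "fact_prod (A + B) = fact_prod A * fact_prod B"
proof -
  have "fact_prod (A + B) = (\<Prod>x\<in>set_mset A. fact (count (A + B) x)) * (\<Prod>x\<in>set_mset B. fact (count (A + B) x))"
    unfolding fact_prod_def set_mset_union using assms by (intro prod.union_disjoint) auto
  also have "(\<Prod>x\<in>set_mset A. fact (count (A + B) x)) = (fact_prod A :: nat)"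
    unfolding fact_prod_def
  proof (rule prod.cong)
    fix x assume "x \<in> set_mset A"
    then have "count B x = 0" using assms by (auto simp: not_in_iff)
    then show "(fact (count (A + B) x) :: nat) = fact (count A x)" by simp
  qed simp
  also have "(\<Prod>x\<in>set_mset B. fact (count (A + B) x)) = (fact_prod B :: nat)"
    unfolding fact_prod_def
  proof (rule prod.cong)
    fix x assume "x \<in> set_mset B"
    then have "count A x = 0" using assms by (auto simp: not_in_iff)
    then show "(fact (count (A + B) x) :: nat) = fact (count B x)" by simp
  qed simp
  finally show ?thesis .
qed

lemma count_image_mset_of_inj: "inj f \<Longrightarrow> count (image_mset f A) (f x) = count A x"
  by (induction A) (auto simp: inj_eq)

lemma fact_prod_image:
  assumes "inj f"
  shows "fact_prod (image_mset f A) = fact_prod A"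
  unfolding fact_prod_def using assms
  by (simp add: prod.reindex inj_on_subset[OF assms] count_image_mset_of_inj[OF assms])

lemma fact_prod_replicate: "fact_prod (replicate_mset k x) = fact k"
  by (cases "k = 0") (auto simp: fact_prod_def)

lemma card_permutations_fact_prod:
  "real (card (permutations_of_multiset A)) = fact (size A) / real (fact_prod A)"
proof -
  have "card (permutations_of_multiset A) * fact_prod A = fact (size A)"
    unfolding fact_prod_def by (rule card_permutations_of_multiset_aux)
  then have "real (card (permutations_of_multiset A)) * real (fact_prod A) = fact (size A)"
    by (metis of_nat_fact of_nat_mult)
  then show ?thesis using fact_prod_pos[of A] by (simp add: field_simps)
qed

lemma card_padded:
  assumes "0 \<notin># l" "size l \<le> k"
  shows "real (card (permutations_of_multiset (l + replicate_mset (k - size l) 0))) = fact k / (real (fact_prod l) * fact (k - size l))"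
proof -
  have "fact_prod (l + replicate_mset (k - size l) 0) = fact_prod l * fact (k - size l)"
    using assms by (subst fact_prod_union) (auto simp: fact_prod_replicate split: if_splits)
  then show ?thesis using assms by (simp add: card_permutations_fact_prod)
qed

lemma card_balanced:
  assumes "0 \<notin># l" "2 * size l \<le> n"
  shows "real (card (permutations_of_multiset (balanced n l))) = fact n / (real (fact_prod l) ^ 2 * fact (n - 2 * size l))"
proof -
  have p: "0 < x" if "x \<in># l" for x using that assms(1) by (metis neq0_conv)
  have "fact_prod (balanced n l) = fact_prod (image_mset int l) * fact_prod (image_mset (\<lambda>i. - int i) l) * fact_prod (replicate_mset (n - 2 * size l) (0::int))"
    unfolding balanced_def using p
    by (subst fact_prod_union, force split: if_splits, subst fact_prod_union, force) simp
  also have "\<dots> = fact_prod l ^ 2 * fact (n - 2 * size l)"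
    by (simp add: fact_prod_image inj_def fact_prod_replicate power2_eq_square)
  finally show ?thesis using assms by (simp add: card_permutations_fact_prod size_balanced)
qed

text \<open>Both sides count the ways of splitting a balanced list into two blocks such that the
  negative entries lie in the first block and the positive ones in the second.\<close>

lemma binomial_card_padded_sum:
  assumes l: "0 \<notin># l" "2 * size l \<le> n"
  defines "a \<equiv> (\<lambda>k. if size l \<le> k then real (card (permutations_of_multiset (l + replicate_mset (k - size l) 0))) else 0)"
  shows "(\<Sum>k=0..n. real (n choose k) * (a k * a (n - k))) = 2 ^ (n - 2 * size l) * real (card (permutations_of_multiset (balanced n l)))"
proof -
  define s where "s = size l"
  define p where "p = real (card (permutations_of_multiset (balanced n l)))"
  have Z: "real (fact_prod l) > 0" using fact_prod_pos[of l] by simp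
  have "(\<Sum>k=0..n. real (n choose k) * (a k * a (n - k))) = (\<Sum>k\<in>{s..n - s}. real (n choose k) * (a k * a (n - k)))"
    by (rule sum.mono_neutral_right) (auto simp: a_def s_def)
  \<comment> \<open>For a given balanced list, the s negative entries are forced into the first
    block, and the other k - s places there are filled by choosing among its n - 2 s zeros.\<close>
  also have "\<dots> = (\<Sum>k\<in>{s..n - s}. p * real ((n - 2 * s) choose (k - s)))"
  proof (rule sum.cong)
    fix k assume "k \<in> {s..n - s}"
    then have k: "s \<le> k" "s \<le> n - k" "k \<le> n" using l(2) by (auto simp: s_def)
    have e: "n - 2 * s - (k - s) = n - k - s" using k by simp
    have c1: "real (n choose k) = fact n / (fact k * fact (n - k))" using k by (simp add: binomial_fact)
    have c2: "real ((n - 2 * s) choose (k - s)) = fact (n - 2 * s) / (fact (k - s) * fact (n - k - s))"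
      using k l(2) by (subst binomial_fact) (auto simp: s_def e[unfolded s_def] add.commute)
    have a1: "a k = fact k / (real (fact_prod l) * fact (k - s))" "a (n - k) = fact (n - k) / (real (fact_prod l) * fact (n - k - s))"
    proof -
      have k1: "size l \<le> k" "size l \<le> n - k" using k by (simp_all add: s_def)
      show "a k = fact k / (real (fact_prod l) * fact (k - s))" "a (n - k) = fact (n - k) / (real (fact_prod l) * fact (n - k - s))"
        unfolding a_def s_def by (simp_all only: k1 if_True card_padded[OF l(1) k1(1)] card_padded[OF l(1) k1(2)])
    qed
    have p1: "p = fact n / (real (fact_prod l) ^ 2 * fact (n - 2 * s))" using l by (simp add: p_def s_def card_balanced)
    show "real (n choose k) * (a k * a (n - k)) = p * real ((n - 2 * s) choose (k - s))"
      unfolding c1 c2 a1 p1 using Z by (simp add: field_simps power2_eq_square)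
  qed simp
  also have "\<dots> = p * (\<Sum>k\<in>{s..n - s}. real ((n - 2 * s) choose (k - s)))" by (simp add: sum_distrib_left)
  also have "(\<Sum>k\<in>{s..n - s}. real ((n - 2 * s) choose (k - s))) = (\<Sum>i\<le>n - 2 * s. real ((n - 2 * s) choose i))"
    by (rule sum.reindex_bij_witness[of _ "\<lambda>i. i + s" "\<lambda>k. k - s"]) (use l(2) in \<open>auto simp: s_def\<close>)
  also have "\<dots> = 2 ^ (n - 2 * s)" by (metis choose_row_sum of_nat_numeral of_nat_power of_nat_sum)
  finally show ?thesis by (simp add: p_def s_def mult.commute)
qed

lemma monomial_sym_map:
  assumes "size l \<le> b - a" "a \<le> b"
  shows "monomial_sym l (map g [a..<b]) =
    (\<Sum>\<alpha>\<in>permutations_of_multiset (l + replicate_mset (b - a - size l) 0). \<Prod>i<b - a. g (a + i) ^ (\<alpha> ! i))"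
  using assms unfolding monomial_sym_def by (auto intro!: sum.cong prod.cong)

lemma length_permutations_padded:
  "\<alpha> \<in> permutations_of_multiset (l + replicate_mset (k - size l) 0) \<Longrightarrow> size l \<le> k \<Longrightarrow> length \<alpha> = k"
  by (auto simp: permutations_of_multiset_def simp flip: size_mset)

lemma replicate_mset_add: "replicate_mset (a + b) x = replicate_mset a x + replicate_mset b x"
  by (induction a) auto

lemma prod_lessThan_add:
  fixes f :: "nat \<Rightarrow> 'a :: comm_monoid_mult"
  shows "(\<Prod>j<k + d. f j) = (\<Prod>j<k. f j) * (\<Prod>i<d. f (k + i))"
  by (induction d) (auto simp: mult.assoc)

lemma prod_append_powers:
  fixes g :: "nat \<Rightarrow> complex"
  assumes "length \<alpha> = k" "length \<beta> = n - k" "k \<le> n"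
  shows "(\<Prod>i<k. g i ^ (\<alpha> ! i)) * (\<Prod>i<n - k. g (k + i) ^ (\<beta> ! i)) = (\<Prod>j<n. g j ^ ((\<alpha> @ \<beta>) ! j))"
proof -
  have "(\<Prod>j<n. g j ^ ((\<alpha> @ \<beta>) ! j)) = (\<Prod>j<k + (n - k). g j ^ ((\<alpha> @ \<beta>) ! j))" using assms by simp
  also have "\<dots> = (\<Prod>j<k. g j ^ ((\<alpha> @ \<beta>) ! j)) * (\<Prod>i<n - k. g (k + i) ^ ((\<alpha> @ \<beta>) ! (k + i)))"
    by (rule prod_lessThan_add)
  also have "\<dots> = (\<Prod>i<k. g i ^ (\<alpha> ! i)) * (\<Prod>i<n - k. g (k + i) ^ (\<beta> ! i))"
    using assms by (intro arg_cong2[of _ _ _ _ "(*)"] prod.cong) (auto simp: nth_append)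
  finally show ?thesis ..
qed

section \<open>The main term as a sum over multi-indices\<close>

text \<open>The Haar expectation of the product of power sums with exponents m, with the moment
  replaced by its stable value; each zero exponent contributes a factor N.\<close>

definition model_term :: "nat \<Rightarrow> int list \<Rightarrow> complex" where
  "model_term N m = of_nat N ^ count_list m 0 * hall_inner (pos_parts m) (neg_parts m)"

locale laurent_family =
  fixes r q K :: real and n :: nat and c :: "int list \<Rightarrow> complex" and F :: "complex list \<Rightarrow> complex"
  assumes r: "0 < r" "r < 1" and q: "0 < q" "q < r" and K: "0 \<le> K"
    and coeff_bound: "\<And>m. length m = n \<Longrightarrow> norm (c m) \<le> K * q ^ abssum m"
    and coeff_sym: "\<And>m m'. length m = n \<Longrightarrow> mset m = mset m' \<Longrightarrow> c m = c m'"
    and expansion: "\<And>z. length z = n \<Longrightarrow> set z \<subseteq> closed_annulus r \<Longrightarrow> ((\<lambda>m. c m * zmon z m) has_sum F z) {m. length m = n}"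
begin

abbreviation "torus_box \<equiv> \<Pi>\<^sub>E j\<in>{..<n}. {0..2 * pi}"
abbreviation "torus_measure \<equiv> \<Pi>\<^sub>M j\<in>{..<n}. (lborel :: real measure)"

text \<open>Each pair of arrangements in the two monomial symmetric polynomials extracts a
  coefficient whose index is some rearrangement of \<open>balanced n l\<close>. By symmetry all
  these coefficients equal c m, so only the number of pairs matters.\<close>

lemma torus_integral_monomials:
  assumes k: "k \<le> n" and l: "0 \<notin># l" and s: "size l \<le> k" "size l \<le> n - k" and m: "mset m = balanced n l"
  shows "(LINT t : torus_box | torus_measure. F (torus_point r n k t) *
      monomial_sym l (map (\<lambda>j. inv_circ r (t j)) [0..<k]) * monomial_sym l (map (\<lambda>j. inv_circ r (t j)) [k..<n]))
    = of_real (2 * pi) ^ n * (of_nat (card (permutations_of_multiset (l + replicate_mset (k - size l) 0))) *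
        of_nat (card (permutations_of_multiset (l + replicate_mset (n - k - size l) 0))) * c m)"
proof -
  define P where "P = permutations_of_multiset (l + replicate_mset (k - size l) 0)"
  define Q where "Q = permutations_of_multiset (l + replicate_mset (n - k - size l) 0)"
  define G where "G = (\<lambda>e t. F (torus_point r n k t) * (\<Prod>j<n. inv_circ r (t j) ^ (e ! j)))"
  have len: "length (\<alpha> @ \<beta>) = n" "length \<alpha> = k" "length \<beta> = n - k" if "\<alpha> \<in> P" "\<beta> \<in> Q" for \<alpha> \<beta>
  proof -
    show 1: "length \<alpha> = k" by (rule length_permutations_padded[OF that(1)[unfolded P_def] s(1)])
    show 2: "length \<beta> = n - k" by (rule length_permutations_padded[OF that(2)[unfolded Q_def] s(2)])
    show "length (\<alpha> @ \<beta>) = n" using 1 2 k by simp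
  qed
  have int: "(LINT t : torus_box | torus_measure. G (\<alpha> @ \<beta>) t) = of_real (2 * pi) ^ n * c m"
    and integ: "set_integrable torus_measure torus_box (G (\<alpha> @ \<beta>))" if ab: "\<alpha> \<in> P" "\<beta> \<in> Q" for \<alpha> \<beta>
  proof -
    note L = len[OF ab]
    note T = torus_integral_coeff[OF r q K coeff_bound expansion k L(1)]
    show "set_integrable torus_measure torus_box (G (\<alpha> @ \<beta>))" unfolding G_def by (rule T(1))
    define m0 where "m0 = map (\<lambda>j. if j < k then - int ((\<alpha> @ \<beta>) ! j) else int ((\<alpha> @ \<beta>) ! j)) [0..<n]"
    have "m0 = map (\<lambda>x. - int x) \<alpha> @ map int \<beta>"
      using L k by (intro nth_equalityI) (auto simp: m0_def nth_append)
    moreover have "mset \<alpha> = l + replicate_mset (k - size l) 0" "mset \<beta> = l + replicate_mset (n - k - size l) 0"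
      using ab by (auto simp: P_def Q_def permutations_of_multiset_def)
    ultimately have "mset m0 = image_mset (\<lambda>x. - int x) l + replicate_mset (k - size l) 0 + (image_mset int l + replicate_mset (n - k - size l) 0)"
      by (simp flip: mset_map) (simp add: mset_map)
    also have "\<dots> = balanced n l"
    proof -
      have "n - 2 * size l = (k - size l) + (n - k - size l)" using s k by simp
      then have "replicate_mset (n - 2 * size l) (0::int) = replicate_mset (k - size l) 0 + replicate_mset (n - k - size l) 0"
        by (simp only: replicate_mset_add)
      then show ?thesis by (simp add: balanced_def)
    qed
    finally have "mset m0 = mset m" using m by simp
    moreover have "length m0 = n" by (simp add: m0_def)
    ultimately have "c m0 = c m" by (intro coeff_sym)
    then show "(LINT t : torus_box | torus_measure. G (\<alpha> @ \<beta>) t) = of_real (2 * pi) ^ n * c m"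
      using T(2) unfolding G_def m0_def by simp
  qed
  have fin: "finite P" "finite Q" by (simp_all add: P_def Q_def)
  have eq: "F (torus_point r n k t) * monomial_sym l (map (\<lambda>j. inv_circ r (t j)) [0..<k]) * monomial_sym l (map (\<lambda>j. inv_circ r (t j)) [k..<n])
     = (\<Sum>\<alpha>\<in>P. \<Sum>\<beta>\<in>Q. G (\<alpha> @ \<beta>) t)" for t
  proof -
    have m1: "monomial_sym l (map (\<lambda>j. inv_circ r (t j)) [0..<k]) = (\<Sum>\<alpha>\<in>P. \<Prod>i<k. inv_circ r (t i) ^ (\<alpha> ! i))"
      using monomial_sym_map[of l k 0 "\<lambda>j. inv_circ r (t j)"] s by (simp add: P_def)
    have m2: "monomial_sym l (map (\<lambda>j. inv_circ r (t j)) [k..<n]) = (\<Sum>\<beta>\<in>Q. \<Prod>i<n - k. inv_circ r (t (k + i)) ^ (\<beta> ! i))"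
      using monomial_sym_map[of l n k "\<lambda>j. inv_circ r (t j)"] s k by (simp add: Q_def)
    have "x * sum f P * sum g Q = (\<Sum>\<alpha>\<in>P. \<Sum>\<beta>\<in>Q. x * (f \<alpha> * g \<beta>))" for x :: complex and f g
      by (subst mult.assoc, subst sum_product) (simp only: sum_distrib_left)
    then show ?thesis unfolding m1 m2
    proof (rule trans, intro sum.cong refl)
      fix \<alpha> \<beta> assume ab: "\<alpha> \<in> P" "\<beta> \<in> Q"
      show "F (torus_point r n k t) * ((\<Prod>i<k. inv_circ r (t i) ^ \<alpha> ! i) * (\<Prod>i<n - k. inv_circ r (t (k + i)) ^ \<beta> ! i))
        = G (\<alpha> @ \<beta>) t"
        unfolding G_def prod_append_powers[OF len(2,3)[OF ab] k, where g = "\<lambda>j. inv_circ r (t j)"] ..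
    qed
  qed
  have "(LINT t : torus_box | torus_measure. \<Sum>\<alpha>\<in>P. \<Sum>\<beta>\<in>Q. G (\<alpha> @ \<beta>) t)
     = (\<Sum>\<alpha>\<in>P. LINT t : torus_box | torus_measure. \<Sum>\<beta>\<in>Q. G (\<alpha> @ \<beta>) t)"
    unfolding set_lebesgue_integral_def scaleR_sum_right using integ[unfolded set_integrable_def]
    by (intro Bochner_Integration.integral_sum Bochner_Integration.integrable_sum)
  also have "\<dots> = (\<Sum>\<alpha>\<in>P. \<Sum>\<beta>\<in>Q. LINT t : torus_box | torus_measure. G (\<alpha> @ \<beta>) t)"
    unfolding set_lebesgue_integral_def scaleR_sum_right using integ[unfolded set_integrable_def]
    by (intro sum.cong refl Bochner_Integration.integral_sum)
  also have "\<dots> = (\<Sum>\<alpha>\<in>P. \<Sum>\<beta>\<in>Q. of_real (2 * pi) ^ n * c m)"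
    by (intro sum.cong refl int)
  also have "\<dots> = of_real (2 * pi) ^ n * (of_nat (card P) * of_nat (card Q) * c m)" by simp
  finally show ?thesis unfolding eq P_def Q_def .
qed

definition main_term :: "nat \<Rightarrow> nat multiset \<Rightarrow> complex" where
  "main_term N l = (of_nat N / 2) powi (int n - 2 * int (size l)) * (of_nat (zee l) / of_real (2 * pi) ^ n) *
     (\<Sum>k=0..n. of_nat (n choose k) * (LINT t : torus_box | torus_measure. F (torus_point r n k t) *
       monomial_sym l (map (\<lambda>j. inv_circ r (t j)) [0..<k]) * monomial_sym l (map (\<lambda>j. inv_circ r (t j)) [k..<n])))"

lemma monomial_sym_eq_0: "length xs < size l \<Longrightarrow> monomial_sym l xs = 0"
  by (simp add: monomial_sym_def)

text \<open>Summing over k counts every rearrangement of \<open>balanced n l\<close> 2^(n - 2 * size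
  l) times, which cancels the power of 2 in (N / 2)^(n - 2 * size l).\<close>

lemma main_term_eq:
  assumes l: "0 \<notin># l"
  shows "main_term N l = (\<Sum>m | length m = n \<and> pos_parts m = l \<and> neg_parts m = l. c m * model_term N m)"
proof (cases "2 * size l \<le> n")
  case False
  \<comment> \<open>When l has more than n / 2 parts, one of the two blocks is shorter than l and
    its monomial polynomial is zero. This case contains all negative exponents of
    \<open>powi\<close>.\<close>
  have "(LINT t : torus_box | torus_measure. F (torus_point r n k t) *
       monomial_sym l (map (\<lambda>j. inv_circ r (t j)) [0..<k]) * monomial_sym l (map (\<lambda>j. inv_circ r (t j)) [k..<n])) = 0"
    if "k \<le> n" for k
  proof -
    have "k < size l \<or> n - k < size l" using False that by linarith
    then have z: "F (torus_point r n k t) * monomial_sym l (map (\<lambda>j. inv_circ r (t j)) [0..<k])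
        * monomial_sym l (map (\<lambda>j. inv_circ r (t j)) [k..<n]) = 0" for t
      by (auto simp: monomial_sym_eq_0)
    show ?thesis unfolding z by (simp add: set_lebesgue_integral_def)
  qed
  then have "main_term N l = 0" by (simp add: main_term_def)
  moreover have e: "{m. length m = n \<and> pos_parts m = l \<and> neg_parts m = l} = {}"
    using parts_eq_iff[OF _ l] False by auto
  ultimately show ?thesis unfolding e by simp
next
  case True
  obtain m where m: "mset m = balanced n l" using ex_mset by blast
  define a where "a = (\<lambda>k. if size l \<le> k then real (card (permutations_of_multiset (l + replicate_mset (k - size l) 0))) else 0)"
  have li: "(LINT t : torus_box | torus_measure. F (torus_point r n k t) *
       monomial_sym l (map (\<lambda>j. inv_circ r (t j)) [0..<k]) * monomial_sym l (map (\<lambda>j. inv_circ r (t j)) [k..<n]))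
     = of_real (2 * pi) ^ n * (of_real (a k * a (n - k)) * c m)" if k: "k \<le> n" for k
  proof (cases "size l \<le> k \<and> size l \<le> n - k")
    case s: True
    then show ?thesis using torus_integral_monomials[OF k l _ _ m] by (simp add: a_def)
  next
    case False
    then have z: "F (torus_point r n k t) * monomial_sym l (map (\<lambda>j. inv_circ r (t j)) [0..<k])
        * monomial_sym l (map (\<lambda>j. inv_circ r (t j)) [k..<n]) = 0" for t
      by (auto simp: monomial_sym_eq_0)
    show ?thesis unfolding z using False by (auto simp: set_lebesgue_integral_def a_def)
  qed
  define p where "p = card (permutations_of_multiset (balanced n l))"
  have "(\<Sum>k=0..n. of_nat (n choose k) * (LINT t : torus_box | torus_measure. F (torus_point r n k t) *
       monomial_sym l (map (\<lambda>j. inv_circ r (t j)) [0..<k]) * monomial_sym l (map (\<lambda>j. inv_circ r (t j)) [k..<n])))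
     = (\<Sum>k=0..n. of_real (2 * pi) ^ n * c m * of_real (real (n choose k) * (a k * a (n - k))))"
  proof (rule sum.cong)
    fix k assume "k \<in> {0..n}"
    then have k: "k \<le> n" by simp
    show "of_nat (n choose k) * (LINT t : torus_box | torus_measure. F (torus_point r n k t) *
       monomial_sym l (map (\<lambda>j. inv_circ r (t j)) [0..<k]) * monomial_sym l (map (\<lambda>j. inv_circ r (t j)) [k..<n]))
     = of_real (2 * pi) ^ n * c m * of_real (real (n choose k) * (a k * a (n - k)))"
      unfolding li[OF k] by simp
  qed simp
  also have "\<dots> = of_real (2 * pi) ^ n * c m * of_real (\<Sum>k=0..n. real (n choose k) * (a k * a (n - k)))"
    by (simp add: sum_distrib_left)
  also have "(\<Sum>k=0..n. real (n choose k) * (a k * a (n - k))) = 2 ^ (n - 2 * size l) * real p"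
    unfolding a_def p_def by (rule binomial_card_padded_sum[OF l True])
  finally have S: "(\<Sum>k=0..n. of_nat (n choose k) * (LINT t : torus_box | torus_measure. F (torus_point r n k t) *
       monomial_sym l (map (\<lambda>j. inv_circ r (t j)) [0..<k]) * monomial_sym l (map (\<lambda>j. inv_circ r (t j)) [k..<n])))
     = of_real (2 * pi) ^ n * c m * of_real (2 ^ (n - 2 * size l) * real p)" .
  have pw: "(of_nat N / 2 :: complex) powi (int n - 2 * int (size l)) = (of_nat N / 2) ^ (n - 2 * size l)"
  proof -
    have "int n - 2 * int (size l) = int (n - 2 * size l)" using True by simp
    then show ?thesis by (simp only: power_int_of_nat)
  qed
  have "main_term N l = of_nat p * (c m * (of_nat N ^ (n - 2 * size l) * of_nat (zee l)))"
    unfolding main_term_def S pw by (simp add: power_divide field_simps)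
  also have "\<dots> = (\<Sum>m'\<in>permutations_of_multiset (balanced n l). c m' * model_term N m')"
  proof -
    have "(\<Sum>m'\<in>permutations_of_multiset (balanced n l). c m' * model_term N m') =
      (\<Sum>m'\<in>permutations_of_multiset (balanced n l). c m * (of_nat N ^ (n - 2 * size l) * of_nat (zee l)))"
    proof (rule sum.cong)
      fix m' assume "m' \<in> permutations_of_multiset (balanced n l)"
      then have m': "mset m' = balanced n l" by (simp add: permutations_of_multiset_def)
      then have "length m' = n" using size_balanced[OF True] by (metis size_mset)
      then have "c m' = c m" using m m' by (intro coeff_sym) auto
      then show "c m' * model_term N m' = c m * (of_nat N ^ (n - 2 * size l) * of_nat (zee l))"
        using parts_balanced[OF m' l] by (simp add: model_term_def hall_inner_def)
    qed simp
    then show ?thesis by (simp add: p_def)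
  qed
  also have "permutations_of_multiset (balanced n l) = {m. length m = n \<and> pos_parts m = l \<and> neg_parts m = l}"
  proof (intro Set.set_eqI iffI)
    fix m' assume "m' \<in> permutations_of_multiset (balanced n l)"
    then have m': "mset m' = balanced n l" by (simp add: permutations_of_multiset_def)
    then have "length m' = n" using size_balanced[OF True] by (metis size_mset)
    then show "m' \<in> {m. length m = n \<and> pos_parts m = l \<and> neg_parts m = l}" using parts_balanced[OF m' l] by simp
  next
    fix m' assume "m' \<in> {m. length m = n \<and> pos_parts m = l \<and> neg_parts m = l}"
    then show "m' \<in> permutations_of_multiset (balanced n l)"
      using parts_eq_iff[of m' n l] l by (simp add: permutations_of_multiset_def)
  qed
  finally show ?thesis .
qed

text \<open>Model terms vanish unless positive and negative parts agree; the remaining indices are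
  grouped into finite fibres by the common partition.\<close>

lemma has_sum_main_term:
  assumes "((\<lambda>m. c m * model_term N m) has_sum S) {m. length m = n}"
  shows "(main_term N has_sum S) partitions"
proof (rule has_sum_SigmaD)
  define B where "B = (\<lambda>l. {m. length m = n \<and> pos_parts m = l \<and> neg_parts m = l})"
  have "bij_betw snd (Sigma partitions B) {m. length m = n \<and> pos_parts m = neg_parts m}"
    by (rule bij_betwI[where g = "\<lambda>m. (pos_parts m, m)"]) (auto simp: B_def partitions_def zero_notin_parts)
  moreover have "((\<lambda>m. c m * model_term N m) has_sum S) {m. length m = n \<and> pos_parts m = neg_parts m}"
    using assms by (rule has_sum_cong_neutral[THEN iffD1, rotated -1]) (auto simp: model_term_def hall_inner_def)
  ultimately show "((\<lambda>x. c (snd x) * model_term N (snd x)) has_sum S) (Sigma partitions B)"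
    using has_sum_reindex_bij_betw[of snd "Sigma partitions B" _ "\<lambda>m. c m * model_term N m" S] by blast
  fix l assume l: "l \<in> partitions"
  have fin: "finite (B l)"
  proof (rule finite_subset)
    show "B l \<subseteq> permutations_of_multiset (balanced n l)"
      using parts_eq_iff[of _ n l] l by (auto simp: B_def permutations_of_multiset_def partitions_def)
  qed simp
  show "((\<lambda>m. c (snd (l, m)) * model_term N (snd (l, m))) has_sum main_term N l) (B l)"
    using main_term_eq[of l N] l has_sum_finite[OF fin] by (simp add: B_def partitions_def)
qed

end

section \<open>Eigenvalue sums as products of traces\<close>

lemma sum_lists_zmon:
  fixes N :: nat
  shows "(\<Sum>js | length js = length m \<and> set js \<subseteq> {..<N}. zmon (map \<rho> js) m) = (\<Prod>x\<leftarrow>m. \<Sum>j<N. \<rho> j powi x)"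
proof (induction m)
  case Nil
  have "{js :: nat list. length js = length ([] :: int list) \<and> set js \<subseteq> {..<N}} = {[]}" by auto
  then show ?case by simp
next
  case (Cons x m)
  define L where "L = {js. length js = length m \<and> set js \<subseteq> {..<N}}"
  have "bij_betw (\<lambda>(j, js). j # js) ({..<N} \<times> L) {js. length js = length (x # m) \<and> set js \<subseteq> {..<N}}"
    by (rule bij_betwI[where g = "\<lambda>js. (hd js, tl js)"]) (auto simp: L_def length_Suc_conv)
  then have "(\<Sum>js | length js = length (x # m) \<and> set js \<subseteq> {..<N}. zmon (map \<rho> js) (x # m))
    = (\<Sum>p\<in>{..<N} \<times> L. zmon (map \<rho> (case p of (j, js) \<Rightarrow> j # js)) (x # m))"
    by (rule sum.reindex_bij_betw[symmetric])
  also have "\<dots> = (\<Sum>j<N. \<Sum>js\<in>L. \<rho> j powi x * zmon (map \<rho> js) m)"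
    by (subst sum.cartesian_product) (auto intro!: sum.cong)
  also have "\<dots> = (\<Sum>j<N. \<rho> j powi x) * (\<Sum>js\<in>L. zmon (map \<rho> js) m)" by (simp add: sum_product)
  finally show ?case using Cons by (simp add: L_def)
qed

text \<open>The power sum of the eigenvalues with integer exponent x: for eigenvalues of modulus
  one, inversion is conjugation.\<close>

definition signed_powtr :: "nat \<Rightarrow> int \<Rightarrow> complex mat \<Rightarrow> complex" where
  "signed_powtr N x g = (if x \<ge> 0 then powtr N (nat x) g else cnj (powtr N (nat (- x)) g))"

lemma sum_eigvals_power_int:
  assumes g: "g \<in> unitary_group N"
  shows "(\<Sum>j<N. (eigvals g ! j) powi x) = signed_powtr N x g"
proof -
  have c: "g \<in> carrier_mat N N" using g by (simp add: unitary_group_def)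
  show ?thesis
  proof (cases "x \<ge> 0")
    case True
    then show ?thesis using sum_eigvals_power[OF c, of "nat x"] by (simp add: signed_powtr_def power_int_def)
  next
    case False
    have "(eigvals g ! j) powi x = cnj ((eigvals g ! j) ^ nat (- x))" if "j < N" for j
    proof -
      have "eigvals g ! j * cnj (eigvals g ! j) = 1"
        using norm_eigvals_unitary[OF g that] by (simp add: complex_norm_square[symmetric])
      then have "inverse (eigvals g ! j) = cnj (eigvals g ! j)" by (rule inverse_unique)
      then show ?thesis using False by (simp add: power_int_def)
    qed
    then have "(\<Sum>j<N. (eigvals g ! j) powi x) = cnj (\<Sum>j<N. (eigvals g ! j) ^ nat (- x))" by simp
    then show ?thesis using False sum_eigvals_power[OF c, of "nat (- x)"] by (simp add: signed_powtr_def)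
  qed
qed

lemma prod_signed_powtr:
  assumes g: "g \<in> carrier_mat N N"
  shows "(\<Prod>x\<leftarrow>m. signed_powtr N x g) =
     of_nat N ^ count_list m 0 * (powtr_prod N (pos_parts m) g * cnj (powtr_prod N (neg_parts m) g))"
proof (induction m)
  case (Cons x m)
  consider "x = 0" | "0 < x" | "x < 0" by linarith
  then show ?case
    by cases (use Cons in \<open>auto simp: signed_powtr_def pos_parts_def neg_parts_def powtr_0[OF g]\<close>)
qed (simp add: pos_parts_def neg_parts_def)

lemma norm_powtr_le:
  assumes g: "g \<in> unitary_group N"
  shows "norm (powtr N k g) \<le> real N"
proof -
  have "norm (powtr N k g) \<le> (\<Sum>i<N. 1)"
    unfolding powtr_def pw_def using pow_mat_unitary[OF g, of k]
    by (intro sum_norm_le norm_unitary_entry_le) auto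
  then show ?thesis by simp
qed

lemma norm_prod_signed_powtr_le:
  assumes g: "g \<in> unitary_group N"
  shows "norm (\<Prod>x\<leftarrow>m. signed_powtr N x g) \<le> real N ^ length m"
proof (induction m)
  case (Cons x m)
  have "norm (signed_powtr N x g) \<le> real N" using norm_powtr_le[OF g] by (simp add: signed_powtr_def)
  then show ?case using Cons by (simp add: norm_mult mult_mono)
qed simp

section \<open>Size of the remaining terms\<close>

text \<open>Each part is at most the sum and each multiplicity at most the number of parts. For
  bounded length the bound is polynomial in the degree, which exponential decay can absorb.\<close>

lemma zee_le: "zee l \<le> (size l * sum_mset l) ^ size l"
proof -
  have "zee l \<le> (\<Prod>i\<in>set_mset l. (size l * sum_mset l) ^ count l i)"
    unfolding zee_def
  proof (rule prod_mono, intro conjI)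
    fix i assume i: "i \<in> set_mset l"
    obtain l' where "l = add_mset i l'" using multi_member_split[OF i] by blast
    then have "i \<le> sum_mset l" by simp
    then have a: "i ^ count l i \<le> sum_mset l ^ count l i" by (rule power_mono) simp
    have "fact (count l i) \<le> count l i ^ count l i" using fact_le_power[where 'a = nat, of "count l i"] by simp
    also have "\<dots> \<le> size l ^ count l i" by (intro power_mono count_le_size) simp
    finally have b: "fact (count l i) \<le> size l ^ count l i" .
    have "i ^ count l i * fact (count l i) \<le> sum_mset l ^ count l i * size l ^ count l i" using a b by (rule mult_le_mono)
    then show "i ^ count l i * fact (count l i) \<le> (size l * sum_mset l) ^ count l i" by (simp add: power_mult_distrib mult.commute)
  qed simp
  also have "\<dots> = (size l * sum_mset l) ^ size l" by (simp add: power_sum size_multiset_overloaded_eq)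
  finally show ?thesis .
qed

text \<open>Write \<theta> as the square of \<tau>: one factor \<tau>^s absorbs the polynomial, and
  the other remains as the decay.\<close>

lemma geometric_times_polynomial_bound:
  fixes \<theta> :: real
  assumes th: "0 < \<theta>" "\<theta> < 1"
  shows "\<exists>C \<tau>. 0 \<le> C \<and> 0 < \<tau> \<and> \<tau> < 1 \<and> (\<forall>s::nat. \<theta> ^ s * (1 + (real n * (1 + real s)) ^ n) \<le> C * \<tau> ^ s)"
proof -
  define \<tau> where "\<tau> = sqrt \<theta>"
  have tau: "0 < \<tau>" "\<tau> < 1" "\<theta> = \<tau> * \<tau>" using th by (auto simp: \<tau>_def)
  \<comment> \<open>Each of the n factors 1 + s receives its own \<sigma>^s; the exponent
    \<open>Suc n\<close> keeps the root meaningful for n = 0.\<close>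
  define \<sigma> where "\<sigma> = root (Suc n) \<tau>"
  have sig: "0 < \<sigma>" "\<sigma> < 1" using tau by (auto simp: \<sigma>_def)
  have sig3: "\<sigma> ^ Suc n = \<tau>" unfolding \<sigma>_def using tau by (intro real_root_pow_pos) auto
  have "(\<lambda>s. real s * \<sigma> ^ s) \<longlonglongrightarrow> 0" using sig by (intro powser_times_n_limit_0) auto
  then have "Bseq (\<lambda>s. real s * \<sigma> ^ s)" by (intro convergent_imp_Bseq convergentI)
  then obtain B where B: "\<And>s. norm (real s * \<sigma> ^ s) \<le> B" unfolding Bseq_def by blast
  have B0: "0 \<le> B" using B[of 0] by simp
  have b1: "(1 + real s) * \<sigma> ^ s \<le> 1 + B" for s
  proof -
    have "\<sigma> ^ s \<le> 1" using sig by (intro power_le_one) auto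
    moreover have "real s * \<sigma> ^ s \<le> B" using B[of s] by simp
    ultimately show ?thesis by (simp add: distrib_right)
  qed
  have "\<theta> ^ s * (1 + (real n * (1 + real s)) ^ n) \<le> (1 + (real n * (1 + B)) ^ n) * \<tau> ^ s" for s
  proof -
    have ts: "0 \<le> \<tau> ^ s" "\<tau> ^ s \<le> 1" using tau by (auto intro: power_le_one)
    have "\<tau> ^ s = (\<sigma> ^ s) ^ Suc n" by (simp only: sig3[symmetric] power_mult[symmetric] mult.commute)
    also have "\<dots> \<le> (\<sigma> ^ s) ^ n" using sig by (intro power_decreasing) (auto intro: power_le_one)
    finally have "\<tau> ^ s * (real n * (1 + real s)) ^ n \<le> (\<sigma> ^ s) ^ n * (real n * (1 + real s)) ^ n"
      by (intro mult_right_mono) auto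
    also have "\<dots> = (real n * ((1 + real s) * \<sigma> ^ s)) ^ n" by (simp only: power_mult_distrib mult_ac)
    also have "\<dots> \<le> (real n * (1 + B)) ^ n"
      using b1[of s] sig by (intro power_mono mult_left_mono) auto
    finally have p: "\<tau> ^ s * (1 + (real n * (1 + real s)) ^ n) \<le> 1 + (real n * (1 + B)) ^ n"
      using ts by (simp add: distrib_left)
    have "\<theta> ^ s * (1 + (real n * (1 + real s)) ^ n) = \<tau> ^ s * (\<tau> ^ s * (1 + (real n * (1 + real s)) ^ n))"
      by (simp add: tau(3) power_mult_distrib)
    also have "\<dots> \<le> \<tau> ^ s * (1 + (real n * (1 + B)) ^ n)" using p ts by (intro mult_left_mono) auto
    finally show ?thesis by (simp add: mult.commute)
  qed
  then show ?thesis using tau B0 by (intro exI[of _ "1 + (real n * (1 + B)) ^ n"] exI[of _ \<tau>]) auto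
qed

context haar_measure
begin

definition haar_term :: "int list \<Rightarrow> complex" where
  "haar_term m = of_nat N ^ count_list m 0 * powtr_moment (pos_parts m) (neg_parts m)"

lemma expectation_prod_signed_powtr:
  "integrable M (\<lambda>g. of_nat N ^ count_list m 0 * (powtr_prod N (pos_parts m) g * cnj (powtr_prod N (neg_parts m) g)))"
  "expectation (\<lambda>g. of_nat N ^ count_list m 0 * (powtr_prod N (pos_parts m) g * cnj (powtr_prod N (neg_parts m) g))) = haar_term m"
  using integrable_powtr_prod by (simp_all add: haar_term_def powtr_moment_def)

lemma norm_haar_term_le: "norm (haar_term m) \<le> real N ^ length m"
proof -
  let ?f = "\<lambda>g. of_nat N ^ count_list m 0 * (powtr_prod N (pos_parts m) g * cnj (powtr_prod N (neg_parts m) g))"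
  have "norm (haar_term m) \<le> expectation (\<lambda>g. norm (?f g))"
    unfolding expectation_prod_signed_powtr(2)[symmetric] by (rule integral_norm_bound)
  also have "\<dots> \<le> expectation (\<lambda>g. real N ^ length m)"
  proof (rule integral_mono)
    show "integrable M (\<lambda>g. norm (?f g))" by (intro integrable_norm expectation_prod_signed_powtr(1))
    fix g assume "g \<in> space M"
    then have g: "g \<in> unitary_group N" by (simp add: space_M)
    show "norm (?f g) \<le> real N ^ length m"
      using norm_prod_signed_powtr_le[OF g, of m] unfolding prod_signed_powtr[OF unitary_carrier[OF g]] .
  qed simp
  finally show ?thesis by (simp add: prob_space)
qed

text \<open>On the unit circle the Laurent series may be summed over all index lists, where each
  monomial factorises into traces. The factor N^n bounds their product, so q^|m| dominates on a
  probability space and expectation passes inside.\<close>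

lemma has_sum_haar_term:
  assumes "laurent_family r q K n c F"
  shows "((\<lambda>m. c m * haar_term m) has_sum
     expectation (\<lambda>g. \<Sum>js | length js = n \<and> set js \<subseteq> {..<N}. F (map (\<lambda>j. eigvals g ! j) js))) {m. length m = n}"
proof -
  interpret laurent_family r q K n c F by fact
  define f where "f = (\<lambda>m g. c m * (of_nat N ^ count_list m 0 * (powtr_prod N (pos_parts m) g * cnj (powtr_prod N (neg_parts m) g))))"
  have fi: "integrable M (f m)" for m unfolding f_def by (intro integrable_mult_right expectation_prod_signed_powtr(1))
  have fe: "expectation (f m) = c m * haar_term m" for m
    unfolding f_def using expectation_prod_signed_powtr[of m] by simp
  have cnt: "countable {m :: int list. length m = n}" by (rule countable_subset[OF subset_UNIV]) simp
  have sb: "(\<lambda>m. K * real N ^ n * q ^ abssum m) summable_on {m. length m = n}"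
    using q r by (intro summable_on_cmult_right summable_geometric_lists) auto
  have b0: "0 \<le> K * real N ^ n * q ^ abssum m" for m using K q by simp
  have fb: "norm (f m g) \<le> K * real N ^ n * q ^ abssum m * 1" if "m \<in> {m. length m = n}" "g \<in> space M" for m g
  proof -
    have g: "g \<in> unitary_group N" using that(2) by (simp add: space_M)
    have m: "length m = n" using that(1) by simp
    have "norm (f m g) \<le> (K * q ^ abssum m) * real N ^ n"
      unfolding f_def norm_mult[of "c m"] prod_signed_powtr[OF unitary_carrier[OF g], symmetric]
      using norm_prod_signed_powtr_le[OF g, of m] coeff_bound[OF m] m K q by (intro mult_mono) auto
    then show ?thesis by (simp add: mult_ac)
  qed
  have fh: "((\<lambda>m. f m g) has_sum (\<Sum>js | length js = n \<and> set js \<subseteq> {..<N}. F (map (\<lambda>j. eigvals g ! j) js))) {m. length m = n}"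
    if "g \<in> space M" for g
  proof -
    have g: "g \<in> unitary_group N" using that by (simp add: space_M)
    have fin: "finite {js. length js = n \<and> set js \<subseteq> {..<N}}"
      using finite_lists_length_eq[of "{..<N}" n] by (simp add: conj_commute)
    have "((\<lambda>m. \<Sum>js | length js = n \<and> set js \<subseteq> {..<N}. c m * zmon (map (\<lambda>j. eigvals g ! j) js) m) has_sum
      (\<Sum>js | length js = n \<and> set js \<subseteq> {..<N}. F (map (\<lambda>j. eigvals g ! j) js))) {m. length m = n}"
    proof (rule has_sum_finite_sum[OF fin])
      fix js assume js: "js \<in> {js. length js = n \<and> set js \<subseteq> {..<N}}"
      have "set (map (\<lambda>j. eigvals g ! j) js) \<subseteq> closed_annulus r"
      proof
        fix z assume "z \<in> set (map (\<lambda>j. eigvals g ! j) js)"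
        then obtain j where "j < N" "z = eigvals g ! j" using js by auto
        then have "norm z = 1" using norm_eigvals_unitary[OF g] by simp
        then show "z \<in> closed_annulus r" using r by (simp add: closed_annulus_def)
      qed
      then show "((\<lambda>m. c m * zmon (map (\<lambda>j. eigvals g ! j) js) m) has_sum F (map (\<lambda>j. eigvals g ! j) js)) {m. length m = n}"
        using js by (intro expansion) auto
    qed
    moreover have "f m g = (\<Sum>js | length js = n \<and> set js \<subseteq> {..<N}. c m * zmon (map (\<lambda>j. eigvals g ! j) js) m)"
      if "m \<in> {m. length m = n}" for m
    proof -
      have "(\<Sum>js | length js = n \<and> set js \<subseteq> {..<N}. zmon (map (\<lambda>j. eigvals g ! j) js) m) = (\<Prod>x\<leftarrow>m. signed_powtr N x g)"
        using sum_lists_zmon[where m = m and N = N and \<rho> = "\<lambda>j. eigvals g ! j"] that by (simp add: sum_eigvals_power_int[OF g])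
      then show ?thesis unfolding f_def prod_signed_powtr[OF unitary_carrier[OF g], symmetric] by (simp flip: sum_distrib_left)
    qed
    ultimately show ?thesis by (rule iffD2[OF has_sum_cong, rotated])
  qed
  have one: "integrable M (\<lambda>_. 1 :: real)" "\<And>x. x \<in> space M \<Longrightarrow> (0::real) \<le> 1" by auto
  have "((\<lambda>m. expectation (f m)) has_sum
     expectation (\<lambda>g. \<Sum>js | length js = n \<and> set js \<subseteq> {..<N}. F (map (\<lambda>j. eigvals g ! j) js))) {m. length m = n}"
    by (rule has_sum_integral_dominated(2)[OF cnt borel_measurable_integrable[OF fi] sb b0 one fb fh])
  then show ?thesis by (simp only: fe)
qed

lemma norm_model_term_le:
  assumes N: "1 \<le> N" and m: "length m = n"
  shows "norm (model_term N m) \<le> real N ^ n * (real n * (1 + real (abssum m))) ^ n"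
proof (cases "pos_parts m = neg_parts m \<and> n \<noteq> 0")
  case True
  define l where "l = pos_parts m"
  define s where "s = abssum m"
  have size: "size l \<le> n" "count_list m 0 \<le> n" using length_eq_parts[of m] m by (auto simp: l_def)
  have sum: "sum_mset l \<le> s" using abssum_eq_parts[of m] by (simp add: l_def s_def)
  have "real (zee l) \<le> real ((size l * sum_mset l) ^ size l)" using zee_le[of l] by (simp only: of_nat_le_iff)
  also have "\<dots> = (real (size l) * real (sum_mset l)) ^ size l" by (simp only: of_nat_power of_nat_mult)
  also have "\<dots> \<le> (real n * (1 + real s)) ^ size l"
    using size sum by (intro power_mono mult_mono) (auto simp del: of_nat_sum_mset)
  also have "\<dots> \<le> (real n * (1 + real s)) ^ n"
  proof (rule power_increasing[OF size(1)])
    have "1 * 1 \<le> real n * (1 + real s)" using True by (intro mult_mono) auto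
    then show "1 \<le> real n * (1 + real s)" by simp
  qed
  finally have z: "real (zee l) \<le> (real n * (1 + real s)) ^ n" .
  have "real N ^ count_list m 0 \<le> real N ^ n" using N size(2) by (intro power_increasing) auto
  then have "real N ^ count_list m 0 * real (zee l) \<le> real N ^ n * (real n * (1 + real s)) ^ n"
    using z by (intro mult_mono) auto
  then show ?thesis using True
    by (simp add: model_term_def hall_inner_def norm_mult norm_power l_def s_def)
next
  case False
  show ?thesis
  proof (cases "n = 0")
    case True
    then have "m = []" using m by simp
    then show ?thesis using True by (simp add: model_term_def hall_inner_def pos_parts_def neg_parts_def zee_def)
  next
    case n0: False
    then have "model_term N m = 0" using False by (simp add: model_term_def hall_inner_def)
    then show ?thesis by simp
  qed
qed

text \<open>If the degrees of the two parts agree, each is half of \<open>abssum m\<close>, hence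
  below N, and the moment is the Hall inner product. Otherwise the moment vanishes by rotation and
  the Hall product because the parts differ.\<close>

lemma haar_term_eq_model_term:
  assumes "abssum m < 2 * N"
  shows "haar_term m = model_term N m"
proof (cases "sum_mset (pos_parts m) = sum_mset (neg_parts m)")
  case True
  then have "sum_mset (pos_parts m) \<le> N" using assms abssum_eq_parts[of m] by simp
  then show ?thesis
    using powtr_moment_eq_hall_inner[OF zero_notin_parts] by (simp add: haar_term_def model_term_def)
next
  case False
  then have "pos_parts m \<noteq> neg_parts m" by auto
  then show ?thesis using powtr_moment_eq_0[OF False] by (simp add: haar_term_def model_term_def hall_inner_def)
qed

end

text \<open>Only indices with \<open>abssum m\<close> at least 2 N contribute to the difference.
  There q^s = r^s (q / r)^s with r^s \<le> r^(2 N), and (q / r)^s absorbs the polynomial weights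
  with a summable \<tau>^s to spare.\<close>

lemma (in laurent_family) haar_integral_asymptotics:
  "\<exists>C. \<forall>N\<ge>1. \<forall>M. normalized_haar N M \<longrightarrow>
     norm ((\<integral>g. (\<Sum>js | length js = n \<and> set js \<subseteq> {..<N}. F (map (\<lambda>j. eigvals g ! j) js)) \<partial>M)
       - infsum (main_term N) partitions) \<le> C * r ^ (2 * N) * real N ^ n"
proof -
  have "0 < q / r" "q / r < 1" using q r by auto
  from geometric_times_polynomial_bound[OF this, of n]
  obtain C1 \<tau> where C1: "0 \<le> C1" "0 < \<tau>" "\<tau> < 1"
    "\<And>s. (q / r) ^ s * (1 + (real n * (1 + real s)) ^ n) \<le> C1 * \<tau> ^ s" by blast
  define T where "T = infsum (\<lambda>m. \<tau> ^ abssum m) {m. length m = n}"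
  have sT: "(\<lambda>m. \<tau> ^ abssum m) summable_on {m. length m = n}" using C1 by (intro summable_geometric_lists) auto
  show ?thesis
  proof (intro exI[of _ "K * C1 * T"] allI impI)
    fix N :: nat and M assume N: "1 \<le> N" and haar: "normalized_haar N M"
    interpret haar_measure N M using haar by unfold_locales
    have N0: "0 \<le> real N ^ n" by simp
    \<comment> \<open>The exponent j is free so that one estimate serves twice: j = 0 for
      summability of the model series, and j = 2 N for the error.\<close>
    have cm: "norm (c m * x) \<le> K * C1 * real N ^ n * r ^ j * \<tau> ^ abssum m"
      if m: "length m = n" and x: "norm x \<le> real N ^ n * (1 + (real n * (1 + real (abssum m))) ^ n)" and j: "j \<le> abssum m" for m x j
    proof -
      let ?s = "abssum m"
      let ?p = "1 + (real n * (1 + real ?s)) ^ n"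
      have "norm (c m * x) \<le> (K * q ^ ?s) * (real N ^ n * ?p)"
        unfolding norm_mult using coeff_bound[OF m] x K q by (intro mult_mono) auto
      also have "q ^ ?s = r ^ ?s * (q / r) ^ ?s" using r by (simp flip: power_mult_distrib)
      also have "K * (r ^ ?s * (q / r) ^ ?s) * (real N ^ n * ?p) = (K * real N ^ n * r ^ ?s) * ((q / r) ^ ?s * ?p)" by (simp only: mult_ac)
      also have "\<dots> \<le> (K * real N ^ n * r ^ j) * (C1 * \<tau> ^ ?s)"
      proof (rule mult_mono)
        have "r ^ ?s \<le> r ^ j" using r j by (intro power_decreasing) auto
        then show "K * real N ^ n * r ^ ?s \<le> K * real N ^ n * r ^ j" using K by (intro mult_left_mono) auto
        show "(q / r) ^ ?s * ?p \<le> C1 * \<tau> ^ ?s" by (rule C1(4))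
      qed (use K r q in auto)
      finally show ?thesis by (simp only: mult_ac)
    qed
    have sum_model: "(\<lambda>m. c m * model_term N m) summable_on {m. length m = n}"
    proof (rule abs_summable_summable, rule Infinite_Sum.abs_summable_on_comparison_test')
      show "(\<lambda>m. K * C1 * real N ^ n * r ^ 0 * \<tau> ^ abssum m) summable_on {m. length m = n}"
        using sT by (rule summable_on_cmult_right)
      fix m :: "int list" assume "m \<in> {m. length m = n}"
      then have m: "length m = n" by simp
      have "norm (model_term N m) \<le> real N ^ n * (1 + (real n * (1 + real (abssum m))) ^ n)"
        using norm_model_term_le[OF N m] by (rule order_trans) (intro mult_left_mono; simp)
      then show "norm (c m * model_term N m) \<le> K * C1 * real N ^ n * r ^ 0 * \<tau> ^ abssum m"
        by (rule cm[OF m]) simp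
    qed
    have hm: "((\<lambda>m. c m * model_term N m) has_sum infsum (main_term N) partitions) {m. length m = n}"
      using has_sum_infsum[OF sum_model] infsumI[OF has_sum_main_term[OF has_sum_infsum[OF sum_model]]] by simp
    have hh: "((\<lambda>m. c m * haar_term m) has_sum
       (\<integral>g. (\<Sum>js | length js = n \<and> set js \<subseteq> {..<N}. F (map (\<lambda>j. eigvals g ! j) js)) \<partial>M)) {m. length m = n}"
      by (rule has_sum_haar_term) unfold_locales
    have "((\<lambda>m. c m * haar_term m - c m * model_term N m) has_sum
       ((\<integral>g. (\<Sum>js | length js = n \<and> set js \<subseteq> {..<N}. F (map (\<lambda>j. eigvals g ! j) js)) \<partial>M) - infsum (main_term N) partitions)) {m. length m = n}"
      using has_sum_add[OF hh has_sum_uminusI[OF hm]] by simp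
    moreover have "((\<lambda>m. K * C1 * real N ^ n * r ^ (2 * N) * \<tau> ^ abssum m) has_sum (K * C1 * real N ^ n * r ^ (2 * N) * T)) {m. length m = n}"
      unfolding T_def by (intro has_sum_cmult_right has_sum_infsum sT)
    ultimately have "norm ((\<integral>g. (\<Sum>js | length js = n \<and> set js \<subseteq> {..<N}. F (map (\<lambda>j. eigvals g ! j) js)) \<partial>M) - infsum (main_term N) partitions)
      \<le> K * C1 * real N ^ n * r ^ (2 * N) * T"
    proof (rule norm_infsum_le)
      fix m :: "int list" assume "m \<in> {m. length m = n}"
      then have m: "length m = n" by simp
      show "norm (c m * haar_term m - c m * model_term N m) \<le> K * C1 * real N ^ n * r ^ (2 * N) * \<tau> ^ abssum m"
      proof (cases "abssum m < 2 * N")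
        case True
        then show ?thesis using haar_term_eq_model_term[OF True] K C1 r by simp
      next
        case False
        have "norm (haar_term m - model_term N m) \<le> real N ^ n + real N ^ n * (real n * (1 + real (abssum m))) ^ n"
          using norm_haar_term_le[of m] norm_model_term_le[OF N m] m by (intro order_trans[OF norm_triangle_ineq4] add_mono) auto
        then have "norm (haar_term m - model_term N m) \<le> real N ^ n * (1 + (real n * (1 + real (abssum m))) ^ n)"
          by (simp add: distrib_left)
        then have "norm (c m * (haar_term m - model_term N m)) \<le> K * C1 * real N ^ n * r ^ (2 * N) * \<tau> ^ abssum m"
          using False by (intro cm[OF m]) auto
        then show ?thesis by (simp add: right_diff_distrib)
      qed
    qed
    then show "norm ((\<integral>g. (\<Sum>js | length js = n \<and> set js \<subseteq> {..<N}. F (map (\<lambda>j. eigvals g ! j) js)) \<partial>M) - infsum (main_term N) partitions)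
      \<le> K * C1 * T * r ^ (2 * N) * real N ^ n" by (simp only: mult_ac)
  qed
qed

theorem mainTheorem10:
  fixes r :: real and n :: nat
    and h :: "complex \<Rightarrow> complex"
    and f :: "complex list \<Rightarrow> complex"
  assumes r: "0 < r" "r < 1"
    and n: "1 \<le> n"
    and h_mero: "h meromorphic_on cball 0 (1 / r)"
    and h_holo: "h holomorphic_on closed_annulus r"
    and f_sym: "\<And>xs ys. length xs = n \<Longrightarrow> mset xs = mset ys \<Longrightarrow> f xs = f ys"
    and f_mero: "\<And>zs. length zs = n - 1 \<Longrightarrow> set zs \<subseteq> closed_annulus r \<Longrightarrow>
                   (\<lambda>z. f (z # zs)) meromorphic_on cball 0 (1 / r)"
    and f_holo: "\<exists>U. open U \<and> closed_annulus r \<subseteq> U \<and>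
                   (\<forall>zs. length zs = n - 1 \<and> set zs \<subseteq> U \<longrightarrow>
                      (\<lambda>z. f (z # zs)) holomorphic_on U)"
  shows "\<exists>C. \<forall>N\<ge>1. \<forall>M. normalized_haar N M \<longrightarrow>
    norm (
      (\<integral>g. (\<Sum>js | length js = n \<and> set js \<subseteq> {..<N}.
              (\<Prod>j\<leftarrow>js. h (eigvals g ! j)) * f (map (\<lambda>j. eigvals g ! j) js)) \<partial>M)
      - (\<Sum>\<^sub>\<infinity>l\<in>partitions.
          (of_nat N / 2) powi (int n - 2 * int (size l)) *
          (of_nat (zee l) / of_real (2 * pi) ^ n) *
          (\<Sum>k=0..n. of_nat (n choose k) *
            (LINT t : (\<Pi>\<^sub>E j\<in>{..<n}. {0..2 * pi}) | (\<Pi>\<^sub>M j\<in>{..<n}. lborel).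
              (\<Prod>j\<in>{0..<k}. h (of_real r * cis (- t j))) *
              (\<Prod>j\<in>{k..<n}. h (cis (t j) / of_real r)) *
              f (map (\<lambda>j. of_real r * cis (- t j)) [0..<k] @
                 map (\<lambda>j. cis (t j) / of_real r) [k..<n]) *
              monomial_sym l (map (\<lambda>j. of_real r * cis (- t j)) [0..<k]) *
              monomial_sym l (map (\<lambda>j. of_real r * cis (- t j)) [k..<n])))))
    \<le> C * r ^ (2 * N) * real N ^ (3 * n + 2)"
proof -
  \<comment> \<open>Coefficient decay with q < r requires room beyond the closed annulus, so h is
    first extended to an open neighbourhood, which is then intersected with the one given for
    f.\<close>
  have "h analytic_on closed_annulus r"
    by (rule meromorphic_imp_analytic_annulus[OF r h_mero h_holo])
  then obtain V0 where V0: "open V0" "closed_annulus r \<subseteq> V0" "h holomorphic_on V0"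
    by (auto simp: analytic_on_holomorphic)
  obtain U where U: "open U" "closed_annulus r \<subseteq> U"
    "\<And>zs. length zs = n - 1 \<Longrightarrow> set zs \<subseteq> U \<Longrightarrow> (\<lambda>z. f (z # zs)) holomorphic_on U"
    using f_holo by blast
  define V where "V = V0 \<inter> U"
  have V: "open V" "closed_annulus r \<subseteq> V" "V \<subseteq> V0" "V \<subseteq> U" using V0 U by (auto simp: V_def)
  define F where "F = (\<lambda>zs. (\<Prod>z\<leftarrow>zs. h z) * f zs)"
  have sep: "sephol V n F" unfolding F_def
  proof (rule sephol_prod_list_times[OF _ _ f_sym])
    show "h holomorphic_on V" using V0(3) V(3) by (rule holomorphic_on_subset)
    show "(\<lambda>z. f (z # zs)) holomorphic_on V" if "length zs = n - 1" "set zs \<subseteq> V" for zs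
      by (rule holomorphic_on_subset[OF U(3)[OF that(1) order_trans[OF that(2) V(4)]] V(4)])
  qed
  have symF: "F xs = F ys" if "length xs = n" "mset xs = mset ys" for xs ys
  proof -
    have "(\<Prod>z\<leftarrow>xs. h z) = (\<Prod>z\<leftarrow>ys. h z)" using that(2) by (metis mset_map prod_mset_prod_list)
    then show ?thesis using f_sym[OF that] by (simp add: F_def)
  qed
  obtain q K c where qKc: "0 < q" "q < r" "0 \<le> K"
     "\<And>m. length m = n \<Longrightarrow> norm (c m) \<le> K * q ^ abssum m"
     "\<And>m m'. length m = n \<Longrightarrow> mset m = mset m' \<Longrightarrow> c m = c m'"
     "\<And>z. length z = n \<Longrightarrow> set z \<subseteq> closed_annulus r \<Longrightarrow> ((\<lambda>m. c m * zmon z m) has_sum F z) {m. length m = n}"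
    using symmetric_laurent_expansion[OF r V(1,2) sep symF] by blast
  interpret laurent_family r q K n c F
    by (rule laurent_family.intro[OF r qKc])
  have F_torus: "F (torus_point r n k t) = (\<Prod>j\<in>{0..<k}. h (of_real r * cis (- t j))) * (\<Prod>j\<in>{k..<n}. h (cis (t j) / of_real r)) *
      f (map (\<lambda>j. of_real r * cis (- t j)) [0..<k] @ map (\<lambda>j. cis (t j) / of_real r) [k..<n])" for k t
    by (simp add: F_def torus_point_def o_def flip: prod.distinct_set_conv_list)
  have main: "main_term N l = (of_nat N / 2) powi (int n - 2 * int (size l)) *
          (of_nat (zee l) / of_real (2 * pi) ^ n) *
          (\<Sum>k=0..n. of_nat (n choose k) *
            (LINT t : (\<Pi>\<^sub>E j\<in>{..<n}. {0..2 * pi}) | (\<Pi>\<^sub>M j\<in>{..<n}. lborel).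
              (\<Prod>j\<in>{0..<k}. h (of_real r * cis (- t j))) *
              (\<Prod>j\<in>{k..<n}. h (cis (t j) / of_real r)) *
              f (map (\<lambda>j. of_real r * cis (- t j)) [0..<k] @
                 map (\<lambda>j. cis (t j) / of_real r) [k..<n]) *
              monomial_sym l (map (\<lambda>j. of_real r * cis (- t j)) [0..<k]) *
              monomial_sym l (map (\<lambda>j. of_real r * cis (- t j)) [k..<n])))" for N l
    unfolding main_term_def F_torus inv_circ_def ..
  have lhs: "(\<Prod>j\<leftarrow>js. h (eigvals g ! j)) * f (map (\<lambda>j. eigvals g ! j) js) = F (map (\<lambda>j. eigvals g ! j) js)" for js g
    by (simp add: F_def o_def)
  from haar_integral_asymptotics obtain C where C: "\<And>N M. 1 \<le> N \<Longrightarrow> normalized_haar N M \<Longrightarrow>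
     norm ((\<integral>g. (\<Sum>js | length js = n \<and> set js \<subseteq> {..<N}. F (map (\<lambda>j. eigvals g ! j) js)) \<partial>M)
       - infsum (main_term N) partitions) \<le> C * r ^ (2 * N) * real N ^ n" by blast
  show ?thesis
    unfolding main[symmetric] lhs
  proof (intro exI[of _ "\<bar>C\<bar>"] allI impI)
    fix N :: nat and M assume N: "1 \<le> N" and M: "normalized_haar N M"
    have "C * r ^ (2 * N) \<le> \<bar>C\<bar> * r ^ (2 * N)" using r by (intro mult_right_mono) auto
    \<comment> \<open>The estimate obtained has N^n, weakened here to the stated power; |C| is taken
      because C carries no sign information.\<close>
    moreover have "real N ^ n \<le> real N ^ (3 * n + 2)" using N by (intro power_increasing) auto
    ultimately have "C * r ^ (2 * N) * real N ^ n \<le> \<bar>C\<bar> * r ^ (2 * N) * real N ^ (3 * n + 2)"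
      using r by (intro mult_mono) auto
    with C[OF N M] show "norm ((\<integral>g. (\<Sum>js | length js = n \<and> set js \<subseteq> {..<N}. F (map (\<lambda>j. eigvals g ! j) js)) \<partial>M)
       - infsum (main_term N) partitions) \<le> \<bar>C\<bar> * r ^ (2 * N) * real N ^ (3 * n + 2)" by (rule order_trans)
  qed
qed

end
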